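(* Let $Y$ be a Banach space. Then $Y$ has the alternate quotient lifting property (AQLP) if and only if $Y$ is isomorphic to $\ell_1(\Gamma)$ for some index set $\Gamma$.
   Context: $L(Y,X)$ denotes the space of bounded linear operators from $Y$ to $X$. A Banach space $Y$ has the alternate quotient lifting property (AQLP) if for every Banach space $X$, every closed subspace $J$ of $X$ and every bounded linear operator $S:Y\to X/J$, there exists $\hat S\in L(Y,X)$ such that $S=\pi\circ\hat S$, where $\pi:X\to X/J$ is the quotient map (no norm condition on $\hat S$ is required). "Isomorphic" means linearly homeomorphic. $\ell_1(\Gamma)$ is the space of absolutely summable scalar families indexed by $\Gamma$, with the $\ell_1$-norm. *)

theory Defs
  imports "HOL-Analysis.Analysis" "HOL-Algebra.Module" "HOL-Algebra.AbelCoset"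
begin

text \<open>
  Banach spaces are represented by records with explicit carriers, because the lifting property
  quantifies over all Banach spaces and their quotients, which is impossible with the type class
  \<^class>\<open>banach\<close>. The vector space structure is that of a module over the scalar field.

  The scalar type ranges over the sort
  \<open>{real_normed_field, euclidean_space}\<close>: a finite-dimensional real normed field with
  multiplicative norm. Both \<^typ>\<open>real\<close> and \<^typ>\<open>complex\<close> are instances and, up to isomorphism,
  they are the only ones, so real and complex Banach spaces are treated simultaneously.
\<close>

definition scalar_field :: "'k::field ring" where
  "scalar_field = \<lparr>carrier = UNIV, mult = (*), one = 1, zero = 0, add = (+)\<rparr>"

lemma cring_scalar_field: "cring (scalar_field :: 'k::field ring)"
  unfolding scalar_field_def
proof (rule cringI)
  show "abelian_group \<lparr>carrier = UNIV :: 'k set, mult = (*), one = 1, zero = 0, add = (+)\<rparr>"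
    by (rule abelian_groupI) (auto simp: algebra_simps intro: exI[of _ "- x" for x])
  show "comm_monoid \<lparr>carrier = UNIV :: 'k set, mult = (*), one = 1, zero = 0, add = (+)\<rparr>"
    by (rule comm_monoidI) auto
qed (auto simp: algebra_simps)

text \<open>
  The fields \<^const>\<open>monoid.mult\<close> and \<^const>\<open>monoid.one\<close> inherited from the module record of the
  library carry no information about a module.
\<close>

record ('k, 'a) nspace = "('k, 'a) Module.module" +
  vnorm :: "'a \<Rightarrow> real"

text \<open>
  The value 0 off the carrier is irrelevant, but \<^locale>\<open>Metric_space\<close> demands symmetry and
  nonnegativity on the whole type.
\<close>

definition vdist :: "('k, 'a) nspace \<Rightarrow> 'a \<Rightarrow> 'a \<Rightarrow> real" where
  "vdist V x y = (if x \<in> carrier V \<and> y \<in> carrier V then vnorm V (x \<ominus>\<^bsub>V\<^esub> y) else 0)"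

definition vtopology :: "('k, 'a) nspace \<Rightarrow> 'a topology" where
  "vtopology V = Metric_space.mtopology (carrier V) (vdist V)"

locale normed_vspace =
  Module.module scalar_field V
  for V :: "('k::{real_normed_field, euclidean_space}, 'a) nspace" (structure) +
  assumes vnorm_eq_zero: "x \<in> carrier V \<Longrightarrow> vnorm V x = 0 \<longleftrightarrow> x = \<zero>\<^bsub>V\<^esub>"
    and vnorm_triangle:
      "x \<in> carrier V \<Longrightarrow> y \<in> carrier V \<Longrightarrow> vnorm V (x \<oplus>\<^bsub>V\<^esub> y) \<le> vnorm V x + vnorm V y"
    and vnorm_smult: "x \<in> carrier V \<Longrightarrow> vnorm V (c \<odot>\<^bsub>V\<^esub> x) = norm c * vnorm V x"
begin

lemma vnorm_minus: "x \<in> carrier V \<Longrightarrow> vnorm V (\<ominus>\<^bsub>V\<^esub> x) = vnorm V x"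
proof -
  assume x: "x \<in> carrier V"
  have one: "\<one>\<^bsub>scalar_field\<^esub> = (1 :: 'k)"
    by (simp add: scalar_field_def)
  have "(\<ominus>\<^bsub>scalar_field\<^esub> \<one>\<^bsub>scalar_field\<^esub>) = (- 1 :: 'k)"
    by (rule R.minus_equality) (auto simp: scalar_field_def)
  then have "\<ominus>\<^bsub>V\<^esub> x = (- 1) \<odot>\<^bsub>V\<^esub> x"
    using smult_l_minus[of "\<one>\<^bsub>scalar_field\<^esub>" x] x smult_one[OF x] by simp
  then show ?thesis
    using vnorm_smult[OF x, of "- 1"] by simp
qed

lemma vnorm_nonneg: "x \<in> carrier V \<Longrightarrow> 0 \<le> vnorm V x"
  using vnorm_triangle[of x "\<ominus>\<^bsub>V\<^esub> x"] vnorm_minus[of x] vnorm_eq_zero[of "\<zero>\<^bsub>V\<^esub>"]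
  by (simp add: M.r_neg)

lemma metric: "Metric_space (carrier V) (vdist V)"
proof
  have swap: "y \<ominus>\<^bsub>V\<^esub> x = \<ominus>\<^bsub>V\<^esub> (x \<ominus>\<^bsub>V\<^esub> y)"
    if "x \<in> carrier V" "y \<in> carrier V" for x y
    using that by (simp add: a_minus_def M.minus_add M.a_comm)
  show "vdist V x y = vdist V y x" for x y
    using swap[of x y] vnorm_minus[of "x \<ominus>\<^bsub>V\<^esub> y"] by (auto simp: vdist_def)
  show "0 \<le> vdist V x y" for x y
    by (auto simp: vdist_def intro: vnorm_nonneg)
  show "vdist V x y = 0 \<longleftrightarrow> x = y" if "x \<in> carrier V" "y \<in> carrier V" for x y
  proof -
    have "x \<ominus>\<^bsub>V\<^esub> y = \<zero>\<^bsub>V\<^esub> \<longleftrightarrow> x = y"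
      using that M.minus_equality[of x "\<ominus>\<^bsub>V\<^esub> y"] by (auto simp: a_minus_def M.r_neg)
    then show ?thesis
      using that vnorm_eq_zero[of "x \<ominus>\<^bsub>V\<^esub> y"] by (simp add: vdist_def)
  qed
  show "vdist V x z \<le> vdist V x y + vdist V y z"
    if xyz: "x \<in> carrier V" "y \<in> carrier V" "z \<in> carrier V" for x y z
  proof -
    have "(x \<ominus>\<^bsub>V\<^esub> y) \<oplus>\<^bsub>V\<^esub> (y \<ominus>\<^bsub>V\<^esub> z) = x \<oplus>\<^bsub>V\<^esub> (\<ominus>\<^bsub>V\<^esub> y \<oplus>\<^bsub>V\<^esub> (y \<ominus>\<^bsub>V\<^esub> z))"
      using xyz by (simp add: a_minus_def M.a_assoc)
    also have "\<dots> = x \<ominus>\<^bsub>V\<^esub> z"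
      using xyz by (simp add: a_minus_def M.r_neg1)
    finally show ?thesis
      using vnorm_triangle[of "x \<ominus>\<^bsub>V\<^esub> y" "y \<ominus>\<^bsub>V\<^esub> z"] xyz by (simp add: vdist_def)
  qed
qed

end

sublocale normed_vspace \<subseteq> Metric_space "carrier V" "vdist V"
  by (rule metric)

locale banach_space = normed_vspace V
  for V :: "('k::{real_normed_field, euclidean_space}, 'a) nspace" (structure) +
  assumes complete: mcomplete

definition linear_map :: "('k, 'a) nspace \<Rightarrow> ('k, 'b) nspace \<Rightarrow> ('a \<Rightarrow> 'b) \<Rightarrow> bool" where
  "linear_map V W T \<longleftrightarrow>
     T \<in> carrier V \<rightarrow> carrier W \<and>
     (\<forall>x\<in>carrier V. \<forall>y\<in>carrier V. T (x \<oplus>\<^bsub>V\<^esub> y) = T x \<oplus>\<^bsub>W\<^esub> T y) \<and>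
     (\<forall>c. \<forall>x\<in>carrier V. T (c \<odot>\<^bsub>V\<^esub> x) = c \<odot>\<^bsub>W\<^esub> T x)"

text \<open>Operators are only determined by their values on the carrier.\<close>

definition bounded_operators :: "('k, 'a) nspace \<Rightarrow> ('k, 'b) nspace \<Rightarrow> ('a \<Rightarrow> 'b) set" where
  "bounded_operators V W =
     {T. linear_map V W T \<and> (\<exists>C. \<forall>x\<in>carrier V. vnorm W (T x) \<le> C * vnorm V x)}"

definition isomorphic :: "('k, 'a) nspace \<Rightarrow> ('k, 'b) nspace \<Rightarrow> bool" where
  "isomorphic V W \<longleftrightarrow>
     (\<exists>T. linear_map V W T \<and> homeomorphic_map (vtopology V) (vtopology W) T)"

definition closed_subspace ::
    "('k::field, 'a) nspace \<Rightarrow> 'a set \<Rightarrow> bool" where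
  "closed_subspace V J \<longleftrightarrow> submodule J scalar_field V \<and> closedin (vtopology V) J"

text \<open>
  The elements of the quotient are the cosets \<open>J +> x\<close>. The union defining scalar multiplication
  collapses to \<open>c \<odot> (J +> x) = J +> (c \<odot> x)\<close>; this form also gives \<open>J\<close> for \<open>c = 0\<close>.
\<close>

definition quotient_space :: "('k, 'a) nspace \<Rightarrow> 'a set \<Rightarrow> ('k, 'a set) nspace" where
  "quotient_space V J =
     \<lparr>carrier = a_rcosets\<^bsub>V\<^esub> J, mult = undefined, one = undefined,
      zero = J, add = set_add V,
      smult = (\<lambda>c A. \<Union>a\<in>A. J +>\<^bsub>V\<^esub> (c \<odot>\<^bsub>V\<^esub> a)),
      vnorm = (\<lambda>A. INF a\<in>A. vnorm V a)\<rparr>"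

text \<open>
  A formula of HOL cannot quantify over types, so the lifting property is relative to a type
  \<open>'x\<close> from which the elements of the Banach spaces \<open>X\<close> are taken. For a space \<open>Y\<close> with elements of
  type \<open>'y\<close> and scalars of type \<open>'k\<close> it is to be used with \<open>'x = 'u + ('y \<Rightarrow> 'k)\<close> for an arbitrary
  type \<open>'u\<close>. Every Banach space with elements of type \<open>'u\<close> has an isometric copy in this type, so
  with \<open>'u\<close> arbitrary no Banach space \<open>X\<close> is excluded. The second summand makes the type large
  enough to contain a copy of \<open>\<ell>\<^sub>1\<close> over any set of elements of \<open>Y\<close>; over a type that is too
  small (a singleton type, for example) the property would hold
  trivially. Index sets are taken from the same type.
\<close>

definition aqlp ::
    "'x itself \<Rightarrow> ('k::{real_normed_field, euclidean_space}, 'y) nspace \<Rightarrow> bool" where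
  "aqlp (_ :: 'x itself) Y \<longleftrightarrow>
     (\<forall>(X :: ('k, 'x) nspace) J.
        banach_space X \<longrightarrow> closed_subspace X J \<longrightarrow>
        (\<forall>S \<in> bounded_operators Y (quotient_space X J).
           \<exists>S' \<in> bounded_operators Y X. \<forall>y\<in>carrier Y. S y = J +>\<^bsub>X\<^esub> S' y))"

definition ell1 :: "'g set \<Rightarrow> ('k::real_normed_field, 'g \<Rightarrow> 'k) nspace" where
  "ell1 \<Gamma> =
     \<lparr>carrier = {f. (\<forall>g. g \<notin> \<Gamma> \<longrightarrow> f g = 0) \<and> (\<lambda>g. norm (f g)) summable_on \<Gamma>},
      mult = undefined, one = undefined,
      zero = (\<lambda>_. 0), add = (\<lambda>f h g. f g + h g),
      smult = (\<lambda>c f g. c * f g),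
      vnorm = (\<lambda>f. \<Sum>\<^sub>\<infinity>g\<in>\<Gamma>. norm (f g))\<rparr>"

end

theory Submission
  imports Defs
begin

text \<open>
  A bounded operator on \<open>\<ell>\<^sub>1(\<Gamma>)\<close> is the same thing as a bounded family of vectors, the images of the
  unit vectors (\<open>ell1_extension\<close>, \<open>ell1_operator_eqI\<close>). Hence an operator from \<open>\<ell>\<^sub>1(\<Gamma>)\<close> to \<open>X/J\<close> is
  lifted by choosing, for each unit vector, a representative of its image of bounded norm
  (\<open>ell1_aqlp\<close>).

  Conversely, let \<open>Y\<close> have the lifting property and let \<open>D\<close> be a subset of its unit ball that comes
  within distance \<open>1/2\<close> of every point of the ball. Sending the unit vector at \<open>d\<close> to \<open>d\<close> gives a
  surjection of \<open>\<ell>\<^sub>1(D)\<close> onto \<open>Y\<close>, and lifting the identity of \<open>Y\<close> through it makes \<open>Y\<close> a retract of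
  \<open>\<ell>\<^sub>1(D)\<close>, that is, isomorphic to a complemented subspace (\<open>aqlp_net_retract\<close>). What remains is the
  theorem of Koethe that such a space is itself an \<open>\<ell>\<^sub>1\<close>. It follows from the decomposition method of
  Pelczynski (\<open>isomorphic_ell1_of_mutual_retracts\<close>) once \<open>\<ell>\<^sub>1(\<nat> \<times> D)\<close> is also a retract of \<open>Y\<close>, so the
  point is to find a net \<open>D\<close> that is no larger than the index set of some \<open>\<ell>\<^sub>1\<close> inside \<open>Y\<close>.

  Embed \<open>Y\<close> in \<open>\<ell>\<^sub>1\<close> of its unit ball and take a maximal family \<open>\<G>\<close> of disjoint finite sets of
  coordinates each of which carries at least three quarters of the norm of some vector of \<open>Y\<close>.
  Because these vectors are almost disjointly supported, they span a complemented copy of \<open>\<ell>\<^sub>1(\<G>)\<close>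
  (\<open>disjoint_norming_retract\<close>). Because \<open>\<G>\<close> is maximal, every vector of \<open>Y\<close> has at least a quarter of
  its norm on the coordinates in \<open>B = \<Union>\<G>\<close> (\<open>maximal_norming_bounded_below\<close>), so that \<open>Y\<close> embeds in
  \<open>\<ell>\<^sub>1(B)\<close>. If \<open>\<G>\<close> is infinite, then \<open>B\<close> is no larger than \<open>\<G>\<close>, and approximation by finitely
  supported vectors with entries in a countable dense set of scalars gives a net \<open>D\<close> of at most that
  size (\<open>small_net\<close>). If \<open>\<G>\<close> is finite, then \<open>Y\<close> has finite dimension and a choice of coordinates is
  an isomorphism (\<open>finite_dimensional_isomorphic_ell1\<close>).
\<close>

section \<open>Normed spaces with explicit carriers\<close>

context normed_vspace
begin

lemma smult_carrier [simp]: "x \<in> carrier V \<Longrightarrow> c \<odot>\<^bsub>V\<^esub> x \<in> carrier V"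
  using smult_closed[of c x] by (simp add: scalar_field_def)

lemma one_smult [simp]: "x \<in> carrier V \<Longrightarrow> 1 \<odot>\<^bsub>V\<^esub> x = x"
  using smult_one[of x] by (simp add: scalar_field_def)

lemma zero_smult [simp]: "x \<in> carrier V \<Longrightarrow> 0 \<odot>\<^bsub>V\<^esub> x = \<zero>\<^bsub>V\<^esub>"
  using smult_l_null[of x] by (simp add: scalar_field_def)

lemma smult_zero [simp]: "c \<odot>\<^bsub>V\<^esub> \<zero>\<^bsub>V\<^esub> = \<zero>\<^bsub>V\<^esub>"
  using smult_r_null[of c] by (simp add: scalar_field_def)

lemma smult_smult: "x \<in> carrier V \<Longrightarrow> c \<odot>\<^bsub>V\<^esub> (d \<odot>\<^bsub>V\<^esub> x) = (c * d) \<odot>\<^bsub>V\<^esub> x"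
  using smult_assoc1[of c d x] by (simp add: scalar_field_def)

lemma smult_add_left:
  "x \<in> carrier V \<Longrightarrow> (c + d) \<odot>\<^bsub>V\<^esub> x = c \<odot>\<^bsub>V\<^esub> x \<oplus>\<^bsub>V\<^esub> d \<odot>\<^bsub>V\<^esub> x"
  using smult_l_distr[of c d x] by (simp add: scalar_field_def)

lemma smult_add_right:
  "x \<in> carrier V \<Longrightarrow> y \<in> carrier V \<Longrightarrow> c \<odot>\<^bsub>V\<^esub> (x \<oplus>\<^bsub>V\<^esub> y) = c \<odot>\<^bsub>V\<^esub> x \<oplus>\<^bsub>V\<^esub> c \<odot>\<^bsub>V\<^esub> y"
  using smult_r_distr[of c x y] by (simp add: scalar_field_def)

lemma a_inv_eq_smult: "x \<in> carrier V \<Longrightarrow> \<ominus>\<^bsub>V\<^esub> x = (- 1) \<odot>\<^bsub>V\<^esub> x"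
proof (rule M.minus_equality)
  assume x: "x \<in> carrier V"
  show "(- 1) \<odot>\<^bsub>V\<^esub> x \<oplus>\<^bsub>V\<^esub> x = \<zero>\<^bsub>V\<^esub>"
    using smult_add_left[OF x, of "- 1" 1] x by simp
qed auto

lemma diff_eq: "x \<in> carrier V \<Longrightarrow> y \<in> carrier V \<Longrightarrow> x \<ominus>\<^bsub>V\<^esub> y = x \<oplus>\<^bsub>V\<^esub> (- 1) \<odot>\<^bsub>V\<^esub> y"
  by (simp add: a_minus_def a_inv_eq_smult)

lemma vnorm_zero [simp]: "vnorm V \<zero>\<^bsub>V\<^esub> = 0"
  using vnorm_eq_zero[of "\<zero>\<^bsub>V\<^esub>"] by simp

lemma vdist_eq: "x \<in> carrier V \<Longrightarrow> y \<in> carrier V \<Longrightarrow> vdist V x y = vnorm V (x \<ominus>\<^bsub>V\<^esub> y)"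
  by (simp add: vdist_def)

lemma diff_self: "x \<in> carrier V \<Longrightarrow> x \<ominus>\<^bsub>V\<^esub> x = \<zero>\<^bsub>V\<^esub>"
  by (simp add: a_minus_def M.r_neg)

lemma diff_zero: "x \<in> carrier V \<Longrightarrow> x \<ominus>\<^bsub>V\<^esub> \<zero>\<^bsub>V\<^esub> = x"
  by (simp add: a_minus_def)

lemma add_diff_cancel: "x \<in> carrier V \<Longrightarrow> y \<in> carrier V \<Longrightarrow> y \<oplus>\<^bsub>V\<^esub> (x \<ominus>\<^bsub>V\<^esub> y) = x"
  by (simp add: a_minus_def M.a_lcomm M.r_neg)

lemma diff_add_cancel: "x \<in> carrier V \<Longrightarrow> y \<in> carrier V \<Longrightarrow> (x \<oplus>\<^bsub>V\<^esub> y) \<ominus>\<^bsub>V\<^esub> y = x"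
  by (simp add: a_minus_def M.a_assoc M.r_neg)

lemma add_diff_add:
  assumes "a \<in> carrier V" "b \<in> carrier V" "l \<in> carrier V" "m \<in> carrier V"
  shows "(a \<oplus>\<^bsub>V\<^esub> b) \<ominus>\<^bsub>V\<^esub> (l \<oplus>\<^bsub>V\<^esub> m) = (a \<ominus>\<^bsub>V\<^esub> l) \<oplus>\<^bsub>V\<^esub> (b \<ominus>\<^bsub>V\<^esub> m)"
  using assms by (simp add: a_minus_def M.minus_add M.a_ac)

lemma vdist_add_le:
  assumes "a \<in> carrier V" "b \<in> carrier V" "l \<in> carrier V" "m \<in> carrier V"
  shows "vdist V (a \<oplus>\<^bsub>V\<^esub> b) (l \<oplus>\<^bsub>V\<^esub> m) \<le> vdist V a l + vdist V b m"
  using assms vnorm_triangle[of "a \<ominus>\<^bsub>V\<^esub> l" "b \<ominus>\<^bsub>V\<^esub> m"] by (simp add: vdist_eq add_diff_add)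

lemma vdist_smult:
  assumes "a \<in> carrier V" "b \<in> carrier V"
  shows "vdist V (c \<odot>\<^bsub>V\<^esub> a) (c \<odot>\<^bsub>V\<^esub> b) = norm c * vdist V a b"
proof -
  have "c \<odot>\<^bsub>V\<^esub> a \<ominus>\<^bsub>V\<^esub> c \<odot>\<^bsub>V\<^esub> b = c \<odot>\<^bsub>V\<^esub> (a \<ominus>\<^bsub>V\<^esub> b)"
    using assms by (simp add: diff_eq smult_add_right smult_smult)
  then show ?thesis
    using assms by (simp add: vdist_eq vnorm_smult)
qed

lemma vdist_zero_right: "x \<in> carrier V \<Longrightarrow> vdist V x \<zero>\<^bsub>V\<^esub> = vnorm V x"
  by (simp add: vdist_eq diff_zero)

lemma vnorm_finsum_le:
  "finite F \<Longrightarrow> u \<in> F \<rightarrow> carrier V \<Longrightarrow> vnorm V (finsum V u F) \<le> (\<Sum>g\<in>F. vnorm V (u g))"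
proof (induction F rule: finite_induct)
  case empty
  then show ?case by simp
next
  case (insert g F)
  then have "finsum V u F \<in> carrier V" by auto
  with insert show ?case
    using vnorm_triangle[of "u g" "finsum V u F"] by (simp add: M.finsum_insert Pi_def)
qed

end

lemma normed_vspaceI:
  fixes V :: "('k::{real_normed_field, euclidean_space}, 'a) nspace" (structure)
  assumes "\<zero> \<in> carrier V"
    and "\<And>x y. x \<in> carrier V \<Longrightarrow> y \<in> carrier V \<Longrightarrow> x \<oplus> y \<in> carrier V"
    and "\<And>c x. x \<in> carrier V \<Longrightarrow> c \<odot> x \<in> carrier V"
    and "\<And>x y z. x \<in> carrier V \<Longrightarrow> y \<in> carrier V \<Longrightarrow> z \<in> carrier V \<Longrightarrow>
      (x \<oplus> y) \<oplus> z = x \<oplus> (y \<oplus> z)"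
    and "\<And>x y. x \<in> carrier V \<Longrightarrow> y \<in> carrier V \<Longrightarrow> x \<oplus> y = y \<oplus> x"
    and "\<And>x. x \<in> carrier V \<Longrightarrow> \<zero> \<oplus> x = x"
    and "\<And>x. x \<in> carrier V \<Longrightarrow> (- 1) \<odot> x \<oplus> x = \<zero>"
    and "\<And>c d x. x \<in> carrier V \<Longrightarrow> (c + d) \<odot> x = c \<odot> x \<oplus> d \<odot> x"
    and "\<And>c x y. x \<in> carrier V \<Longrightarrow> y \<in> carrier V \<Longrightarrow> c \<odot> (x \<oplus> y) = c \<odot> x \<oplus> c \<odot> y"
    and "\<And>c d x. x \<in> carrier V \<Longrightarrow> (c * d) \<odot> x = c \<odot> (d \<odot> x)"
    and "\<And>x. x \<in> carrier V \<Longrightarrow> 1 \<odot> x = x"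
    and "\<And>x. x \<in> carrier V \<Longrightarrow> vnorm V x = 0 \<longleftrightarrow> x = \<zero>"
    and "\<And>x y. x \<in> carrier V \<Longrightarrow> y \<in> carrier V \<Longrightarrow> vnorm V (x \<oplus> y) \<le> vnorm V x + vnorm V y"
    and "\<And>c x. x \<in> carrier V \<Longrightarrow> vnorm V (c \<odot> x) = norm c * vnorm V x"
  shows "normed_vspace V"
proof (intro normed_vspace.intro normed_vspace_axioms.intro)
  show "Module.module scalar_field V"
  proof (rule moduleI)
    show "cring (scalar_field :: 'k ring)" by (rule cring_scalar_field)
    show "abelian_group V"
      by (rule abelian_groupI) (use assms in \<open>blast+\<close>)
  qed (use assms in \<open>auto simp: scalar_field_def\<close>)
qed (use assms in auto)

section \<open>Bounded operators\<close>

lemma bounded_operatorsI: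
  assumes "\<And>x. x \<in> carrier V \<Longrightarrow> T x \<in> carrier W"
    and "\<And>x y. x \<in> carrier V \<Longrightarrow> y \<in> carrier V \<Longrightarrow> T (x \<oplus>\<^bsub>V\<^esub> y) = T x \<oplus>\<^bsub>W\<^esub> T y"
    and "\<And>c x. x \<in> carrier V \<Longrightarrow> T (c \<odot>\<^bsub>V\<^esub> x) = c \<odot>\<^bsub>W\<^esub> T x"
    and "\<And>x. x \<in> carrier V \<Longrightarrow> vnorm W (T x) \<le> C * vnorm V x"
  shows "T \<in> bounded_operators V W"
  unfolding bounded_operators_def linear_map_def
  using assms by (intro CollectI conjI exI[of _ C]) auto

lemma bop_closed: "T \<in> bounded_operators V W \<Longrightarrow> x \<in> carrier V \<Longrightarrow> T x \<in> carrier W"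
  by (auto simp: bounded_operators_def linear_map_def)

lemma bop_add:
  "T \<in> bounded_operators V W \<Longrightarrow> x \<in> carrier V \<Longrightarrow> y \<in> carrier V \<Longrightarrow>
    T (x \<oplus>\<^bsub>V\<^esub> y) = T x \<oplus>\<^bsub>W\<^esub> T y"
  by (auto simp: bounded_operators_def linear_map_def)

lemma bop_smult:
  "T \<in> bounded_operators V W \<Longrightarrow> x \<in> carrier V \<Longrightarrow> T (c \<odot>\<^bsub>V\<^esub> x) = c \<odot>\<^bsub>W\<^esub> T x"
  by (auto simp: bounded_operators_def linear_map_def)

text \<open>
  An operator is a function on the whole type whose values off the carrier are arbitrary, so
  equality of operators has to be weakened to agreement on the carrier.
\<close>

lemma bop_cong:
  assumes "normed_vspace V" and T: "T \<in> bounded_operators V W"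
    and eq: "\<And>x. x \<in> carrier V \<Longrightarrow> T' x = T x"
  shows "T' \<in> bounded_operators V W"
proof -
  interpret V: normed_vspace V by fact
  obtain C where "\<And>x. x \<in> carrier V \<Longrightarrow> vnorm W (T x) \<le> C * vnorm V x"
    using T by (auto simp: bounded_operators_def)
  then show ?thesis
    by (intro bounded_operatorsI[where C = C])
      (simp_all add: eq bop_closed[OF T] bop_add[OF T] bop_smult[OF T])
qed

lemma bop_bound:
  assumes "normed_vspace V" "T \<in> bounded_operators V W"
  obtains C where "C > 0" "\<And>x. x \<in> carrier V \<Longrightarrow> vnorm W (T x) \<le> C * vnorm V x"
proof -
  obtain C where C: "\<And>x. x \<in> carrier V \<Longrightarrow> vnorm W (T x) \<le> C * vnorm V x"
    using assms(2) by (auto simp: bounded_operators_def)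
  have "vnorm W (T x) \<le> (\<bar>C\<bar> + 1) * vnorm V x" if "x \<in> carrier V" for x
    using C[OF that] normed_vspace.vnorm_nonneg[OF assms(1) that]
      mult_right_mono[of C "\<bar>C\<bar> + 1" "vnorm V x"] by linarith
  then show ?thesis
    using that[of "\<bar>C\<bar> + 1"] by auto
qed

lemma bop_zero:
  assumes "normed_vspace V" "normed_vspace W" "T \<in> bounded_operators V W"
  shows "T \<zero>\<^bsub>V\<^esub> = \<zero>\<^bsub>W\<^esub>"
proof -
  interpret V: normed_vspace V by fact
  interpret W: normed_vspace W by fact
  have "T (0 \<odot>\<^bsub>V\<^esub> \<zero>\<^bsub>V\<^esub>) = 0 \<odot>\<^bsub>W\<^esub> T \<zero>\<^bsub>V\<^esub>"
    by (rule bop_smult[OF assms(3)]) simp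
  then show ?thesis
    by (simp add: bop_closed[OF assms(3)])
qed

lemma bop_diff:
  assumes "normed_vspace V" "normed_vspace W" "T \<in> bounded_operators V W"
    "x \<in> carrier V" "y \<in> carrier V"
  shows "T (x \<ominus>\<^bsub>V\<^esub> y) = T x \<ominus>\<^bsub>W\<^esub> T y"
proof -
  interpret V: normed_vspace V by fact
  interpret W: normed_vspace W by fact
  show ?thesis
    using assms(4,5) by (simp add: V.diff_eq W.diff_eq bop_closed[OF assms(3)]
        bop_add[OF assms(3)] bop_smult[OF assms(3)])
qed

lemma bop_id: "(\<lambda>x. x) \<in> bounded_operators V V"
  by (rule bounded_operatorsI[where C = 1]) auto

lemma bop_compose:
  assumes "normed_vspace V" "normed_vspace W"
    and S: "S \<in> bounded_operators V W" and T: "T \<in> bounded_operators W X"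
  shows "(\<lambda>x. T (S x)) \<in> bounded_operators V X"
proof -
  obtain C where C: "C > 0" "\<And>x. x \<in> carrier V \<Longrightarrow> vnorm W (S x) \<le> C * vnorm V x"
    using bop_bound[OF assms(1) S] by blast
  obtain D where D: "D > 0" "\<And>x. x \<in> carrier W \<Longrightarrow> vnorm X (T x) \<le> D * vnorm W x"
    using bop_bound[OF assms(2) T] by blast
  show ?thesis
  proof (rule bounded_operatorsI[where C = "D * C"])
    fix x assume x: "x \<in> carrier V"
    have "vnorm X (T (S x)) \<le> D * vnorm W (S x)"
      using D(2) bop_closed[OF S x] by blast
    also have "\<dots> \<le> D * (C * vnorm V x)"
      using C(2)[OF x] D(1) by (intro mult_left_mono) auto
    finally show "vnorm X (T (S x)) \<le> D * C * vnorm V x" by simp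
  qed (simp_all add: bop_closed[OF S] bop_closed[OF T] bop_add[OF S] bop_add[OF T]
      bop_smult[OF S] bop_smult[OF T])
qed

lemma bop_plus:
  assumes "normed_vspace V" "normed_vspace W"
    and S: "S \<in> bounded_operators V W" and T: "T \<in> bounded_operators V W"
  shows "(\<lambda>x. S x \<oplus>\<^bsub>W\<^esub> T x) \<in> bounded_operators V W"
proof -
  interpret W: normed_vspace W by fact
  obtain C where C: "C > 0" "\<And>x. x \<in> carrier V \<Longrightarrow> vnorm W (S x) \<le> C * vnorm V x"
    using bop_bound[OF assms(1) S] by blast
  obtain D where D: "D > 0" "\<And>x. x \<in> carrier V \<Longrightarrow> vnorm W (T x) \<le> D * vnorm V x"
    using bop_bound[OF assms(1) T] by blast
  show ?thesis
  proof (rule bounded_operatorsI[where C = "C + D"])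
    fix x assume x: "x \<in> carrier V"
    show "vnorm W (S x \<oplus>\<^bsub>W\<^esub> T x) \<le> (C + D) * vnorm V x"
      using W.vnorm_triangle[OF bop_closed[OF S x] bop_closed[OF T x]] C(2)[OF x] D(2)[OF x]
      by (simp add: distrib_right)
  next
    fix x y assume "x \<in> carrier V" "y \<in> carrier V"
    then show "S (x \<oplus>\<^bsub>V\<^esub> y) \<oplus>\<^bsub>W\<^esub> T (x \<oplus>\<^bsub>V\<^esub> y) = S x \<oplus>\<^bsub>W\<^esub> T x \<oplus>\<^bsub>W\<^esub> (S y \<oplus>\<^bsub>W\<^esub> T y)"
      by (simp add: bop_closed[OF S] bop_closed[OF T] bop_add[OF S] bop_add[OF T] W.M.a_ac)
  qed (simp_all add: bop_closed[OF S] bop_closed[OF T] bop_smult[OF S] bop_smult[OF T]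
      W.smult_add_right)
qed

lemma bop_minus:
  assumes "normed_vspace V" "normed_vspace W"
    and S: "S \<in> bounded_operators V W" and T: "T \<in> bounded_operators V W"
  shows "(\<lambda>x. S x \<ominus>\<^bsub>W\<^esub> T x) \<in> bounded_operators V W"
proof -
  interpret W: normed_vspace W by fact
  have scale: "(\<lambda>x. (- 1) \<odot>\<^bsub>W\<^esub> x) \<in> bounded_operators W W"
    by (rule bounded_operatorsI[where C = 1])
      (simp_all add: W.smult_add_right W.smult_smult W.vnorm_smult)
  have "(\<lambda>x. S x \<oplus>\<^bsub>W\<^esub> (- 1) \<odot>\<^bsub>W\<^esub> T x) \<in> bounded_operators V W"
    by (rule bop_plus[OF assms(1,2) S bop_compose[OF assms(1,2) T scale]])
  then show ?thesis
    by (rule bop_cong[OF assms(1)]) (simp add: W.diff_eq bop_closed[OF S] bop_closed[OF T])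
qed

text \<open>
  Continuity at the origin gives a ball that is mapped into the unit ball, and every nonzero vector
  can be rescaled into that ball.
\<close>

lemma continuous_imp_bounded_operator:
  fixes V :: "('k::{real_normed_field, euclidean_space}, 'a) nspace"
  assumes "normed_vspace V" "normed_vspace W"
    and T: "linear_map V W T" and cont: "continuous_map (vtopology V) (vtopology W) T"
  shows "T \<in> bounded_operators V W"
proof -
  interpret V: normed_vspace V by fact
  interpret W: normed_vspace W by fact
  interpret VW: Metric_space12 "carrier V" "vdist V" "carrier W" "vdist W" ..
  have Tc: "T x \<in> carrier W" if "x \<in> carrier V" for x
    using T that by (auto simp: linear_map_def)
  have Ts: "T (c \<odot>\<^bsub>V\<^esub> x) = c \<odot>\<^bsub>W\<^esub> T x" if "x \<in> carrier V" for c x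
    using T that by (auto simp: linear_map_def)
  have T0: "T \<zero>\<^bsub>V\<^esub> = \<zero>\<^bsub>W\<^esub>"
    using Ts[of "\<zero>\<^bsub>V\<^esub>" 0] by (simp add: Tc)
  obtain d where d: "d > 0" "\<And>x. x \<in> carrier V \<Longrightarrow> vdist V \<zero>\<^bsub>V\<^esub> x < d \<Longrightarrow> vdist W (T \<zero>\<^bsub>V\<^esub>) (T x) < 1"
    using cont unfolding vtopology_def V.metric_continuous_map[OF W.Metric_space_axioms]
    by (metis V.M.zero_closed zero_less_one)
  have small: "vnorm W (T x) < 1" if "x \<in> carrier V" "vnorm V x < d" for x
    using d(2)[OF that(1)] that Tc[OF that(1)]
      W.vdist_zero_right[of "T x"] V.vdist_zero_right[of x]
    by (simp add: T0 W.commute[of _ "\<zero>\<^bsub>W\<^esub>"] V.commute[of _ "\<zero>\<^bsub>V\<^esub>"])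
  have "vnorm W (T x) \<le> (2 / d) * vnorm V x" if x: "x \<in> carrier V" for x
  proof (cases "vnorm V x = 0")
    case True
    then show ?thesis using x by (simp add: V.vnorm_eq_zero T0)
  next
    case False
    then have pos: "vnorm V x > 0" using V.vnorm_nonneg[OF x] by simp
    define c where "c = d / (2 * vnorm V x)"
    have c: "c > 0" using pos d(1) by (simp add: c_def)
    have half: "c * vnorm V x = d / 2" using pos by (simp add: c_def)
    have "vnorm V (of_real c \<odot>\<^bsub>V\<^esub> x) < d"
      using c pos d(1) half by (simp add: V.vnorm_smult[OF x])
    then have "vnorm W (T (of_real c \<odot>\<^bsub>V\<^esub> x)) < 1"
      using small x by simp
    then have "c * vnorm W (T x) < 1"
      using c by (simp add: Ts[OF x] W.vnorm_smult[OF Tc[OF x]])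
    then show ?thesis
      using pos d(1) by (simp add: c_def field_simps)
  qed
  then show ?thesis
    using T unfolding bounded_operators_def by blast
qed

lemma bounded_operator_imp_continuous:
  assumes "normed_vspace V" "normed_vspace W" and T: "T \<in> bounded_operators V W"
  shows "continuous_map (vtopology V) (vtopology W) T"
proof -
  interpret V: normed_vspace V by fact
  interpret W: normed_vspace W by fact
  interpret VW: Metric_space12 "carrier V" "vdist V" "carrier W" "vdist W" ..
  obtain C where C: "C > 0" "\<And>x. x \<in> carrier V \<Longrightarrow> vnorm W (T x) \<le> C * vnorm V x"
    using bop_bound[OF assms(1) T] by blast
  have lip: "vdist W (T x) (T y) \<le> C * vdist V x y" if "x \<in> carrier V" "y \<in> carrier V" for x y
    using C(2)[of "x \<ominus>\<^bsub>V\<^esub> y"] that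
    by (simp add: V.vdist_eq W.vdist_eq bop_closed[OF T] bop_diff[OF assms(1,2) T])
  show ?thesis
    unfolding vtopology_def V.metric_continuous_map[OF W.Metric_space_axioms]
  proof (intro conjI ballI allI impI)
    fix a and e :: real assume a: "a \<in> carrier V" and e: "e > 0"
    show "\<exists>d>0. \<forall>x. x \<in> carrier V \<and> vdist V a x < d \<longrightarrow> vdist W (T a) (T x) < e"
    proof (intro exI[of _ "e / C"] conjI allI impI)
      fix x assume x: "x \<in> carrier V \<and> vdist V a x < e / C"
      then have "C * vdist V a x < e" using C(1) by (simp add: field_simps)
      then show "vdist W (T a) (T x) < e" using lip[of a x] a x by linarith
    qed (use C(1) e in simp)
  qed (auto intro: bop_closed[OF T])
qed

text \<open>
  The inverse of a linear homeomorphism is linear and continuous, and for linear maps continuity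
  and boundedness coincide. So an isomorphism amounts to a pair of mutually inverse operators.
\<close>

lemma isomorphic_iff:
  assumes "normed_vspace V" "normed_vspace W"
  shows "isomorphic V W \<longleftrightarrow>
    (\<exists>T\<in>bounded_operators V W. \<exists>S\<in>bounded_operators W V.
      (\<forall>x\<in>carrier V. S (T x) = x) \<and> (\<forall>y\<in>carrier W. T (S y) = y))"
proof
  interpret V: normed_vspace V by fact
  interpret W: normed_vspace W by fact
  have top: "topspace (vtopology V) = carrier V" "topspace (vtopology W) = carrier W"
    by (simp_all add: vtopology_def)
  {
    assume "isomorphic V W"
    then obtain T S where T: "linear_map V W T"
      and TS: "homeomorphic_maps (vtopology V) (vtopology W) T S"
      by (auto simp: isomorphic_def homeomorphic_map_maps)
    then have cT: "continuous_map (vtopology V) (vtopology W) T"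
      and cS: "continuous_map (vtopology W) (vtopology V) S"
      and ST: "\<And>x. x \<in> carrier V \<Longrightarrow> S (T x) = x" and TS': "\<And>y. y \<in> carrier W \<Longrightarrow> T (S y) = y"
      by (auto simp: homeomorphic_maps_def top)
    have Sc: "S y \<in> carrier V" if "y \<in> carrier W" for y
      using cS that by (auto simp: continuous_map_def top)
    have Tadd: "T (x \<oplus>\<^bsub>V\<^esub> y) = T x \<oplus>\<^bsub>W\<^esub> T y" if "x \<in> carrier V" "y \<in> carrier V" for x y
      using T that by (auto simp: linear_map_def)
    have Ts: "T (c \<odot>\<^bsub>V\<^esub> x) = c \<odot>\<^bsub>W\<^esub> T x" if "x \<in> carrier V" for c x
      using T that by (auto simp: linear_map_def)
    have "linear_map W V S"
      unfolding linear_map_def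
    proof (intro conjI ballI allI)
      fix x y assume "x \<in> carrier W" "y \<in> carrier W"
      then show "S (x \<oplus>\<^bsub>W\<^esub> y) = S x \<oplus>\<^bsub>V\<^esub> S y"
        using ST[of "S x \<oplus>\<^bsub>V\<^esub> S y"] by (simp add: Sc Tadd TS')
    next
      fix c x assume "x \<in> carrier W"
      then show "S (c \<odot>\<^bsub>W\<^esub> x) = c \<odot>\<^bsub>V\<^esub> S x"
        using ST[of "c \<odot>\<^bsub>V\<^esub> S x"] by (simp add: Sc Ts TS')
    qed (use Sc in auto)
    then have "S \<in> bounded_operators W V"
      by (rule continuous_imp_bounded_operator[OF assms(2,1) _ cS])
    moreover have "T \<in> bounded_operators V W"
      by (rule continuous_imp_bounded_operator[OF assms T cT])
    ultimately show "\<exists>T\<in>bounded_operators V W. \<exists>S\<in>bounded_operators W V.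
      (\<forall>x\<in>carrier V. S (T x) = x) \<and> (\<forall>y\<in>carrier W. T (S y) = y)"
      using ST TS' by blast
  }
  assume "\<exists>T\<in>bounded_operators V W. \<exists>S\<in>bounded_operators W V.
      (\<forall>x\<in>carrier V. S (T x) = x) \<and> (\<forall>y\<in>carrier W. T (S y) = y)"
  then obtain T S where T: "T \<in> bounded_operators V W" and S: "S \<in> bounded_operators W V"
    and inv: "\<And>x. x \<in> carrier V \<Longrightarrow> S (T x) = x" "\<And>y. y \<in> carrier W \<Longrightarrow> T (S y) = y"
    by blast
  then have "homeomorphic_maps (vtopology V) (vtopology W) T S"
    using bounded_operator_imp_continuous[OF assms T]
      bounded_operator_imp_continuous[OF assms(2,1) S]
    by (auto simp: homeomorphic_maps_def top)
  then show "isomorphic V W"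
    using T by (auto simp: isomorphic_def homeomorphic_map_maps bounded_operators_def)
qed

text \<open>
  A retract is, up to isomorphism, a complemented subspace: \<open>i \<circ> r\<close> is a projection of \<open>V\<close> onto
  the copy \<open>i(U)\<close> of \<open>U\<close>. Working with the two operators avoids forming subspaces and complements.
\<close>

definition retract :: "('k, 'a) nspace \<Rightarrow> ('k, 'b) nspace \<Rightarrow> bool" where
  "retract U V \<longleftrightarrow>
     (\<exists>i\<in>bounded_operators U V. \<exists>r\<in>bounded_operators V U. \<forall>u\<in>carrier U. r (i u) = u)"

lemma retract_trans:
  assumes "normed_vspace U" "normed_vspace V" "normed_vspace W" "retract U V" "retract V W"
  shows "retract U W"
proof -
  obtain i r where ir: "i \<in> bounded_operators U V" "r \<in> bounded_operators V U"
      "\<And>u. u \<in> carrier U \<Longrightarrow> r (i u) = u"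
    using assms(4) by (auto simp: retract_def)
  obtain j s where js: "j \<in> bounded_operators V W" "s \<in> bounded_operators W V"
      "\<And>u. u \<in> carrier V \<Longrightarrow> s (j u) = u"
    using assms(5) by (auto simp: retract_def)
  show ?thesis
    unfolding retract_def
    using bop_compose[OF assms(1,2) ir(1) js(1)] bop_compose[OF assms(3,2) js(2) ir(2)]
    by (intro bexI[of _ "\<lambda>x. j (i x)"] bexI[of _ "\<lambda>x. r (s x)"])
       (auto simp: js(3) ir(3) bop_closed[OF ir(1)])
qed

section \<open>The spaces \<open>\<ell>\<^sub>1(\<Gamma>)\<close>\<close>

lemma ell1_simps [simp]:
  "zero (ell1 \<Gamma>) = (\<lambda>_. 0)"
  "add (ell1 \<Gamma>) f h = (\<lambda>g. f g + h g)"
  "smult (ell1 \<Gamma>) c f = (\<lambda>g. c * f g)"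
  "vnorm (ell1 \<Gamma>) f = (\<Sum>\<^sub>\<infinity>g\<in>\<Gamma>. norm (f g))"
  by (simp_all add: ell1_def)

lemma ell1_carrier:
  "f \<in> carrier (ell1 \<Gamma>) \<longleftrightarrow> (\<forall>g. g \<notin> \<Gamma> \<longrightarrow> f g = 0) \<and> (\<lambda>g. norm (f g)) summable_on \<Gamma>"
  by (simp add: ell1_def)

lemma ell1_outside: "f \<in> carrier (ell1 \<Gamma>) \<Longrightarrow> g \<notin> \<Gamma> \<Longrightarrow> f g = 0"
  by (simp add: ell1_carrier)

lemma ell1_summable: "f \<in> carrier (ell1 \<Gamma>) \<Longrightarrow> (\<lambda>g. norm (f g)) summable_on \<Gamma>"
  by (simp add: ell1_carrier)

lemma ell1_sum_le_vnorm:
  "f \<in> carrier (ell1 \<Gamma>) \<Longrightarrow> finite F \<Longrightarrow> F \<subseteq> \<Gamma> \<Longrightarrow> (\<Sum>g\<in>F. norm (f g)) \<le> vnorm (ell1 \<Gamma>) f"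
  by (simp add: ell1_summable finite_sum_le_infsum)

lemma ell1_point_le_vnorm:
  "f \<in> carrier (ell1 \<Gamma>) \<Longrightarrow> norm (f g) \<le> vnorm (ell1 \<Gamma>) f"
  using ell1_sum_le_vnorm[of f \<Gamma> "{g}"] infsum_nonneg[of \<Gamma> "\<lambda>g. norm (f g)"]
  by (cases "g \<in> \<Gamma>") (auto simp: ell1_outside)

text \<open>
  Finite partial sums decide both membership in \<open>\<ell>\<^sub>1(\<Gamma>)\<close> and upper bounds for the norm. Most
  estimates below are reduced to finite sums in this way.
\<close>

lemma ell1I_bound:
  fixes f :: "'g \<Rightarrow> 'k::real_normed_field"
  assumes "\<And>g. g \<notin> \<Gamma> \<Longrightarrow> f g = 0"
    and "\<And>F. finite F \<Longrightarrow> F \<subseteq> \<Gamma> \<Longrightarrow> (\<Sum>g\<in>F. norm (f g)) \<le> C"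
  shows "f \<in> carrier (ell1 \<Gamma>)" "vnorm (ell1 \<Gamma>) f \<le> C"
proof -
  have "(\<lambda>g. norm (f g)) summable_on \<Gamma>"
    by (rule nonneg_bdd_above_summable_on) (use assms(2) in \<open>auto intro!: bdd_aboveI[of _ C]\<close>)
  then show "f \<in> carrier (ell1 \<Gamma>)" "vnorm (ell1 \<Gamma>) f \<le> C"
    using assms by (auto simp: ell1_carrier intro: infsum_le_finite_sums)
qed

lemma ell1_normed: "normed_vspace (ell1 \<Gamma> :: ('k::{real_normed_field, euclidean_space}, 'g \<Rightarrow> 'k) nspace)"
proof (rule normed_vspaceI)
  let ?E = "ell1 \<Gamma> :: ('k, 'g \<Rightarrow> 'k) nspace"
  show "f \<oplus>\<^bsub>?E\<^esub> h \<in> carrier ?E" and "vnorm ?E (f \<oplus>\<^bsub>?E\<^esub> h) \<le> vnorm ?E f + vnorm ?E h"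
    if f: "f \<in> carrier ?E" and h: "h \<in> carrier ?E" for f h
  proof -
    have le: "(\<Sum>g\<in>F. norm (f g + h g)) \<le> vnorm ?E f + vnorm ?E h"
      if "finite F" "F \<subseteq> \<Gamma>" for F
    proof -
      have "(\<Sum>g\<in>F. norm (f g + h g)) \<le> (\<Sum>g\<in>F. norm (f g) + norm (h g))"
        by (intro sum_mono norm_triangle_ineq)
      then show ?thesis
        using ell1_sum_le_vnorm[OF f that] ell1_sum_le_vnorm[OF h that] by (simp add: sum.distrib)
    qed
    have out: "f g + h g = 0" if "g \<notin> \<Gamma>" for g
      using that f h by (simp add: ell1_outside)
    show "f \<oplus>\<^bsub>?E\<^esub> h \<in> carrier ?E" "vnorm ?E (f \<oplus>\<^bsub>?E\<^esub> h) \<le> vnorm ?E f + vnorm ?E h"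
      using ell1I_bound[of \<Gamma> "\<lambda>g. f g + h g", OF out le] by simp_all
  qed
  show "c \<odot>\<^bsub>?E\<^esub> f \<in> carrier ?E" if "f \<in> carrier ?E" for c f
    using that by (simp add: ell1_carrier norm_mult summable_on_cmult_right)
  show "vnorm ?E (c \<odot>\<^bsub>?E\<^esub> f) = norm c * vnorm ?E f" if "f \<in> carrier ?E" for c f
    using that by (simp add: norm_mult infsum_cmult_right ell1_summable)
  show "vnorm ?E f = 0 \<longleftrightarrow> f = \<zero>\<^bsub>?E\<^esub>" if "f \<in> carrier ?E" for f
    using ell1_point_le_vnorm[OF that] by (force simp: fun_eq_iff)
qed (auto simp: ell1_carrier algebra_simps)

lemma ell1_diff:
  fixes f h :: "'g \<Rightarrow> 'k::{real_normed_field, euclidean_space}"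
  assumes "f \<in> carrier (ell1 \<Gamma>)" "h \<in> carrier (ell1 \<Gamma>)"
  shows "f \<ominus>\<^bsub>ell1 \<Gamma>\<^esub> h = (\<lambda>g. f g - h g)"
  using normed_vspace.diff_eq[OF ell1_normed assms] by simp

lemma ell1_vdist_sum_le:
  fixes f h :: "'g \<Rightarrow> 'k::{real_normed_field, euclidean_space}"
  assumes "f \<in> carrier (ell1 \<Gamma>)" "h \<in> carrier (ell1 \<Gamma>)" "finite F" "F \<subseteq> \<Gamma>"
  shows "(\<Sum>g\<in>F. norm (f g - h g)) \<le> vdist (ell1 \<Gamma>) f h"
proof -
  interpret E: normed_vspace "ell1 \<Gamma> :: ('k, 'g \<Rightarrow> 'k) nspace" by (rule ell1_normed)
  have "f \<ominus>\<^bsub>ell1 \<Gamma>\<^esub> h \<in> carrier (ell1 \<Gamma>)"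
    using assms by (intro E.M.minus_closed)
  then show ?thesis
    using ell1_sum_le_vnorm[of "f \<ominus>\<^bsub>ell1 \<Gamma>\<^esub> h" \<Gamma> F] assms
    by (simp add: E.vdist_eq ell1_diff del: ell1_simps)
qed

lemma ell1_vdist_leI:
  fixes f h :: "'g \<Rightarrow> 'k::{real_normed_field, euclidean_space}"
  assumes "f \<in> carrier (ell1 \<Gamma>)" "h \<in> carrier (ell1 \<Gamma>)"
    and "\<And>F. finite F \<Longrightarrow> F \<subseteq> \<Gamma> \<Longrightarrow> (\<Sum>g\<in>F. norm (f g - h g)) \<le> C"
  shows "vdist (ell1 \<Gamma>) f h \<le> C"
proof -
  interpret E: normed_vspace "ell1 \<Gamma> :: ('k, 'g \<Rightarrow> 'k) nspace" by (rule ell1_normed)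
  have "vnorm (ell1 \<Gamma>) (\<lambda>g. f g - h g) \<le> C"
    by (rule ell1I_bound(2)) (use assms in \<open>auto simp: ell1_outside\<close>)
  then show ?thesis
    using assms(1,2) by (simp add: E.vdist_eq ell1_diff)
qed

text \<open>
  A Cauchy sequence converges in every coordinate, and a bound for the finite partial sums of the
  differences of two terms survives when one of the terms passes to the limit.
\<close>

lemma ell1_banach:
  "banach_space (ell1 \<Gamma> :: ('k::{real_normed_field, euclidean_space}, 'g \<Rightarrow> 'k) nspace)"
proof -
  let ?E = "ell1 \<Gamma> :: ('k, 'g \<Rightarrow> 'k) nspace"
  interpret E: normed_vspace ?E by (rule ell1_normed)
  have "E.mcomplete"
    unfolding E.mcomplete_def
  proof (intro allI impI)
    fix \<sigma> assume \<sigma>: "E.MCauchy \<sigma>"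
    then have car: "\<sigma> n \<in> carrier ?E" for n
      by (auto simp: E.MCauchy_def)
    have cau: "\<exists>N. \<forall>m\<ge>N. \<forall>n\<ge>N. vdist ?E (\<sigma> m) (\<sigma> n) < e" if "e > 0" for e
    proof -
      have "\<forall>e>0. \<exists>N. \<forall>m n. N \<le> m \<longrightarrow> N \<le> n \<longrightarrow> vdist ?E (\<sigma> m) (\<sigma> n) < e"
        by (rule conjunct2[OF \<sigma>[unfolded E.MCauchy_def]])
      with that show ?thesis by meson
    qed
    have "convergent (\<lambda>n. \<sigma> n g)" for g
    proof (intro Cauchy_convergent metric_CauchyI)
      fix e :: real assume "e > 0"
      then obtain N where N: "\<And>m n. m \<ge> N \<Longrightarrow> n \<ge> N \<Longrightarrow> vdist ?E (\<sigma> m) (\<sigma> n) < e"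
        using cau by blast
      have "norm (\<sigma> m g - \<sigma> n g) \<le> vdist ?E (\<sigma> m) (\<sigma> n)" for m n
        using ell1_vdist_sum_le[OF car car, of "{g}" m n] E.nonneg[of "\<sigma> m" "\<sigma> n"]
        by (cases "g \<in> \<Gamma>") (auto simp: ell1_outside[OF car])
      then show "\<exists>N. \<forall>m\<ge>N. \<forall>n\<ge>N. dist (\<sigma> m g) (\<sigma> n g) < e"
        using N unfolding dist_norm by (intro exI[of _ N] allI impI) (rule le_less_trans)
    qed
    then obtain f where f: "\<And>g. (\<lambda>n. \<sigma> n g) \<longlonglongrightarrow> f g"
      unfolding convergent_def by metis
    have fout: "f g = 0" if "g \<notin> \<Gamma>" for g
      using f[of g] that by (simp add: ell1_outside[OF car] LIMSEQ_const_iff)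
    have tail: "(\<Sum>g\<in>F. norm (\<sigma> m g - f g)) \<le> e"
      if N: "\<And>m n. m \<ge> N \<Longrightarrow> n \<ge> N \<Longrightarrow> vdist ?E (\<sigma> m) (\<sigma> n) < e"
        and "m \<ge> N" "finite F" "F \<subseteq> \<Gamma>" for N m F e
    proof (rule LIMSEQ_le_const2)
      show "(\<lambda>n. \<Sum>g\<in>F. norm (\<sigma> m g - \<sigma> n g)) \<longlonglongrightarrow> (\<Sum>g\<in>F. norm (\<sigma> m g - f g))"
        by (intro tendsto_intros f)
      show "\<exists>K. \<forall>n\<ge>K. (\<Sum>g\<in>F. norm (\<sigma> m g - \<sigma> n g)) \<le> e"
        using ell1_vdist_sum_le[OF car car that(3,4)] N[OF that(2)]
        by (meson less_imp_le order_trans)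
    qed
    have fcar: "f \<in> carrier ?E"
    proof -
      obtain N where N: "\<And>m n. m \<ge> N \<Longrightarrow> n \<ge> N \<Longrightarrow> vdist ?E (\<sigma> m) (\<sigma> n) < 1"
        using cau[of 1] by auto
      have "(\<lambda>g. \<sigma> N g - f g) \<in> carrier ?E"
        by (rule ell1I_bound(1)[OF _ tail[OF N]]) (auto simp: fout ell1_outside[OF car])
      then have "\<sigma> N \<ominus>\<^bsub>?E\<^esub> (\<lambda>g. \<sigma> N g - f g) \<in> carrier ?E"
        using car by (intro E.M.minus_closed)
      then show ?thesis
        using \<open>(\<lambda>g. \<sigma> N g - f g) \<in> carrier ?E\<close> car by (simp add: ell1_diff)
    qed
    have "limitin E.mtopology \<sigma> f sequentially"
      unfolding E.limit_metric_sequentially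
    proof (intro conjI allI impI fcar)
      fix e :: real assume "e > 0"
      then obtain N where N: "\<And>m n. m \<ge> N \<Longrightarrow> n \<ge> N \<Longrightarrow> vdist ?E (\<sigma> m) (\<sigma> n) < e / 2"
        using cau[of "e / 2"] by auto
      have "vdist ?E (\<sigma> n) f \<le> e / 2" if "n \<ge> N" for n
        by (rule ell1_vdist_leI[OF car fcar tail[OF N that]])
      then show "\<exists>N. \<forall>n\<ge>N. \<sigma> n \<in> carrier ?E \<and> vdist ?E (\<sigma> n) f < e"
        using car \<open>e > 0\<close> by (intro exI[of _ N]) fastforce
    qed
    then show "\<exists>x. limitin E.mtopology \<sigma> x sequentially"
      by (rule exI[of "\<lambda>x. limitin E.mtopology \<sigma> x sequentially" f])
  qed
  then show ?thesis
    by (intro banach_space.intro ell1_normed banach_space_axioms.intro)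
qed

definition unit_vec :: "'g \<Rightarrow> 'g \<Rightarrow> 'k::zero_neq_one" where
  "unit_vec g = (\<lambda>h. if h = g then 1 else 0)"

lemma unit_vec_carrier [simp]: "g \<in> \<Gamma> \<Longrightarrow> (unit_vec g :: 'g \<Rightarrow> 'k::real_normed_field) \<in> carrier (ell1 \<Gamma>)"
  and vnorm_unit_vec: "g \<in> \<Gamma> \<Longrightarrow> vnorm (ell1 \<Gamma>) (unit_vec g :: 'g \<Rightarrow> 'k) = 1"
proof -
  assume g: "g \<in> \<Gamma>"
  have le: "(\<Sum>h\<in>F. norm (unit_vec g h :: 'k)) \<le> 1" if "finite F" "F \<subseteq> \<Gamma>" for F
  proof -
    have "(\<Sum>h\<in>F. norm (unit_vec g h :: 'k)) = (\<Sum>h\<in>F. if h = g then 1 else 0)"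
      by (intro sum.cong) (auto simp: unit_vec_def)
    then show ?thesis using that by (simp add: sum.delta)
  qed
  have out: "h \<notin> \<Gamma> \<Longrightarrow> (unit_vec g h :: 'k) = 0" for h using g by (auto simp: unit_vec_def)
  show car: "(unit_vec g :: 'g \<Rightarrow> 'k) \<in> carrier (ell1 \<Gamma>)"
    by (rule ell1I_bound(1)[OF out le])
  have "vnorm (ell1 \<Gamma>) (unit_vec g :: 'g \<Rightarrow> 'k) \<le> 1"
    by (rule ell1I_bound(2)[OF out le])
  moreover have "1 \<le> vnorm (ell1 \<Gamma>) (unit_vec g :: 'g \<Rightarrow> 'k)"
    using ell1_point_le_vnorm[OF car, of g] by (simp add: unit_vec_def)
  ultimately show "vnorm (ell1 \<Gamma>) (unit_vec g :: 'g \<Rightarrow> 'k) = 1" by simp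
qed

definition restrict_to :: "'g set \<Rightarrow> ('g \<Rightarrow> 'k) \<Rightarrow> 'g \<Rightarrow> 'k::zero" where
  "restrict_to A f = (\<lambda>g. if g \<in> A then f g else 0)"

lemma restrict_to_bounded:
  fixes \<Gamma> :: "'g set"
  assumes "A \<subseteq> \<Gamma>"
  shows "restrict_to A \<in> bounded_operators (ell1 \<Gamma> :: ('k::{real_normed_field, euclidean_space}, _) nspace) (ell1 A)"
    and "\<And>f :: 'g \<Rightarrow> 'k. f \<in> carrier (ell1 \<Gamma>) \<Longrightarrow> vnorm (ell1 A) (restrict_to A f) \<le> vnorm (ell1 \<Gamma>) f"
proof -
  have le: "(\<Sum>g\<in>F. norm (restrict_to A f g)) \<le> vnorm (ell1 \<Gamma>) f"
    if "f \<in> carrier (ell1 \<Gamma>)" "finite F" "F \<subseteq> A" for f :: "'g \<Rightarrow> 'k" and F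
  proof -
    have "(\<Sum>g\<in>F. norm (restrict_to A f g)) = (\<Sum>g\<in>F. norm (f g))"
      using that by (intro sum.cong) (auto simp: restrict_to_def)
    then show ?thesis using ell1_sum_le_vnorm[of f \<Gamma> F] that assms by auto
  qed
  have *: "restrict_to A f \<in> carrier (ell1 A)" "vnorm (ell1 A) (restrict_to A f) \<le> vnorm (ell1 \<Gamma>) f"
    if "f \<in> carrier (ell1 \<Gamma>)" for f :: "'g \<Rightarrow> 'k"
    using ell1I_bound[OF _ le[OF that], of A] by (auto simp: restrict_to_def)
  then show "restrict_to A \<in> bounded_operators (ell1 \<Gamma> :: ('k, _) nspace) (ell1 A)"
    by (intro bounded_operatorsI[where C = 1]) (auto simp: restrict_to_def)
  show "\<And>f :: 'g \<Rightarrow> 'k. f \<in> carrier (ell1 \<Gamma>) \<Longrightarrow> vnorm (ell1 A) (restrict_to A f) \<le> vnorm (ell1 \<Gamma>) f"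
    using *(2) .
qed

text \<open>
  The norm of \<open>f\<close> outside a finite set \<open>F\<close>, written as a difference so that it is accessible
  to finite sums; it tends to 0 along the finite subsets of \<open>\<Gamma>\<close>.
\<close>

definition tail :: "'g set \<Rightarrow> 'g set \<Rightarrow> ('g \<Rightarrow> 'k::real_normed_field) \<Rightarrow> real" where
  "tail \<Gamma> F f = vnorm (ell1 \<Gamma>) f - (\<Sum>g\<in>F. norm (f g))"

lemma tail_small:
  assumes "f \<in> carrier (ell1 \<Gamma>)" "e > 0"
  obtains F where "finite F" "F \<subseteq> \<Gamma>" "\<And>G. finite G \<Longrightarrow> F \<subseteq> G \<Longrightarrow> G \<subseteq> \<Gamma> \<Longrightarrow> tail \<Gamma> G f < e"
proof -
  have "((\<lambda>g. norm (f g)) has_sum vnorm (ell1 \<Gamma>) f) \<Gamma>"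
    using ell1_summable[OF assms(1)] by (simp add: has_sum_infsum)
  then have "\<forall>\<^sub>F F in finite_subsets_at_top \<Gamma>. dist (\<Sum>g\<in>F. norm (f g)) (vnorm (ell1 \<Gamma>) f) < e"
    unfolding has_sum_def using assms(2) by (rule tendstoD)
  then obtain F where F: "finite F" "F \<subseteq> \<Gamma>"
    "\<And>G. finite G \<Longrightarrow> F \<subseteq> G \<Longrightarrow> G \<subseteq> \<Gamma> \<Longrightarrow> dist (\<Sum>g\<in>G. norm (f g)) (vnorm (ell1 \<Gamma>) f) < e"
    by (auto simp: eventually_finite_subsets_at_top)
  show ?thesis
    by (rule that[OF F(1,2)]) (use F(3) in \<open>force simp: tail_def dist_real_def\<close>)
qed

lemma tail_nonneg: "f \<in> carrier (ell1 \<Gamma>) \<Longrightarrow> finite F \<Longrightarrow> F \<subseteq> \<Gamma> \<Longrightarrow> 0 \<le> tail \<Gamma> F f"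
  using ell1_sum_le_vnorm[of f \<Gamma> F] by (simp add: tail_def)

lemma sum_disjoint_le_tail:
  assumes "f \<in> carrier (ell1 \<Gamma>)" "finite F" "F \<subseteq> \<Gamma>" "finite G" "G \<subseteq> \<Gamma>" "F \<inter> G = {}"
  shows "(\<Sum>g\<in>G. norm (f g)) \<le> tail \<Gamma> F f"
  using ell1_sum_le_vnorm[of f \<Gamma> "F \<union> G"] assms by (simp add: tail_def sum.union_disjoint)

lemma vdist_restrict_finite:
  fixes f :: "'g \<Rightarrow> 'k::{real_normed_field, euclidean_space}"
  assumes f: "f \<in> carrier (ell1 \<Gamma>)" and "finite F" "F \<subseteq> \<Gamma>"
  shows "restrict_to F f \<in> carrier (ell1 \<Gamma>)" "vdist (ell1 \<Gamma>) f (restrict_to F f) \<le> tail \<Gamma> F f"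
proof -
  have "(\<Sum>g\<in>G. norm (restrict_to F f g)) \<le> vnorm (ell1 \<Gamma>) f" if "finite G" "G \<subseteq> \<Gamma>" for G
    by (rule order_trans[OF sum_mono ell1_sum_le_vnorm[OF f that]]) (simp add: restrict_to_def)
  then show car: "restrict_to F f \<in> carrier (ell1 \<Gamma>)"
    using assms by (intro ell1I_bound(1)) (auto simp: restrict_to_def)
  show "vdist (ell1 \<Gamma>) f (restrict_to F f) \<le> tail \<Gamma> F f"
  proof (rule ell1_vdist_leI[OF f car])
    fix G assume G: "finite G" "G \<subseteq> \<Gamma>"
    have "(\<Sum>g\<in>G. norm (f g - restrict_to F f g)) = (\<Sum>g\<in>G - F. norm (f g))"
      using G by (intro sum.mono_neutral_cong_right) (auto simp: restrict_to_def)
    also have "\<dots> \<le> tail \<Gamma> F f"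
      by (rule sum_disjoint_le_tail) (use assms G in auto)
    finally show "(\<Sum>g\<in>G. norm (f g - restrict_to F f g)) \<le> tail \<Gamma> F f" .
  qed
qed

text \<open>
  The induction step for evaluating an operator at a finitely supported vector. The target is an
  arbitrary record because quotient spaces occur as targets.
\<close>

lemma operator_restrict_insert:
  fixes f :: "'g \<Rightarrow> 'k::{real_normed_field, euclidean_space}"
  assumes T: "T \<in> bounded_operators (ell1 \<Gamma>) V" and f: "f \<in> carrier (ell1 \<Gamma>)"
    and F: "finite F" "insert g F \<subseteq> \<Gamma>" "g \<notin> F"
  shows "T (restrict_to (insert g F) f) = T (restrict_to F f) \<oplus>\<^bsub>V\<^esub> f g \<odot>\<^bsub>V\<^esub> T (unit_vec g)"
proof -
  let ?E = "ell1 \<Gamma> :: ('k, 'g \<Rightarrow> 'k) nspace"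
  interpret E: normed_vspace ?E by (rule ell1_normed)
  have u: "unit_vec g \<in> carrier ?E" and r: "restrict_to F f \<in> carrier ?E"
    using vdist_restrict_finite(1)[OF f, of F] F by auto
  have "restrict_to (insert g F) f = restrict_to F f \<oplus>\<^bsub>?E\<^esub> f g \<odot>\<^bsub>?E\<^esub> unit_vec g"
    using F(3) by (auto simp: restrict_to_def unit_vec_def)
  then show ?thesis
    using bop_add[OF T r E.smult_carrier[OF u]] bop_smult[OF T u] by (simp del: ell1_simps)
qed

section \<open>Operators on \<open>\<ell>\<^sub>1(\<Gamma>)\<close>\<close>

text \<open>
  The bound for the differences of a Cauchy sequence passes to the distance from its limit.
\<close>

lemma (in banach_space) limit_with_rate:
  assumes car: "\<And>n. \<sigma> n \<in> carrier V"
    and rate: "\<And>m n. n \<le> m \<Longrightarrow> vdist V (\<sigma> m) (\<sigma> n) \<le> b n" and b: "b \<longlonglongrightarrow> 0"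
  obtains l where "l \<in> carrier V" "\<And>n. vdist V l (\<sigma> n) \<le> b n"
proof -
  have "MCauchy \<sigma>"
    unfolding MCauchy_def
  proof (intro conjI allI impI)
    fix e :: real assume "e > 0"
    then obtain N where N: "\<And>n. n \<ge> N \<Longrightarrow> \<bar>b n\<bar> < e"
      using LIMSEQ_D[OF b, of e] by auto
    show "\<exists>N. \<forall>n n'. N \<le> n \<longrightarrow> N \<le> n' \<longrightarrow> vdist V (\<sigma> n) (\<sigma> n') < e"
    proof (intro exI[of _ N] allI impI)
      fix m n assume mn: "N \<le> m" "N \<le> n"
      show "vdist V (\<sigma> m) (\<sigma> n) < e"
      proof (cases "n \<le> m")
        case True
        then show ?thesis using rate[of n m] N[OF mn(2)] by linarith
      next
        case False
        then show ?thesis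
          using rate[of m n] N[OF mn(1)] commute[of "\<sigma> m" "\<sigma> n"] by linarith
      qed
    qed
  qed (use car in auto)
  then obtain l where l: "limitin mtopology \<sigma> l sequentially"
    using complete unfolding mcomplete_def by meson
  then have lc: "l \<in> carrier V"
    by (simp add: limit_metric_sequentially)
  have lim: "\<exists>N. \<forall>n\<ge>N. vdist V (\<sigma> n) l < e" if "e > 0" for e
    using l that unfolding limit_metric_sequentially by blast
  have "vdist V l (\<sigma> n) \<le> b n" for n
  proof (rule field_le_epsilon)
    fix e :: real assume "e > 0"
    then obtain N where N: "\<forall>n\<ge>N. vdist V (\<sigma> n) l < e" using lim by blast
    have "vdist V l (\<sigma> n) \<le> vdist V l (\<sigma> (max N n)) + vdist V (\<sigma> (max N n)) (\<sigma> n)"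
      by (rule triangle) (use car lc in auto)
    moreover have "vdist V l (\<sigma> (max N n)) < e"
      using N commute[of l] by simp
    ultimately show "vdist V l (\<sigma> n) \<le> b n + e"
      using rate[of n "max N n"] by simp
  qed
  with lc show ?thesis by (rule that)
qed

lemma bop_lipschitz:
  assumes "normed_vspace V" "normed_vspace W" "T \<in> bounded_operators V W"
    and bound: "\<And>x. x \<in> carrier V \<Longrightarrow> vnorm W (T x) \<le> C * vnorm V x"
    and "x \<in> carrier V" "y \<in> carrier V"
  shows "vdist W (T x) (T y) \<le> C * vdist V x y"
proof -
  interpret V: normed_vspace V by fact
  interpret W: normed_vspace W by fact
  show ?thesis
    using bound[of "x \<ominus>\<^bsub>V\<^esub> y"] assms(5,6)
    by (simp add: V.vdist_eq W.vdist_eq bop_closed[OF assms(3)] bop_diff[OF assms(1-3)])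
qed

lemma tail_scale: "tail \<Gamma> F (\<lambda>g. c * f g) = norm c * tail \<Gamma> F f"
  if "f \<in> carrier (ell1 \<Gamma>)" for c :: "'k::real_normed_field"
  using that
  by (simp add: tail_def norm_mult infsum_cmult_right ell1_summable right_diff_distrib sum_distrib_left)

text \<open>
  The universal property of \<open>\<ell>\<^sub>1(\<Gamma>)\<close>. The value at \<open>f\<close> should be the sum of all \<open>f g \<odot> x g\<close>.
  It is characterised without a limit as the vector whose distance to every finite partial sum
  over \<open>F\<close> is at most \<open>C\<close> times the tail of \<open>f\<close> outside \<open>F\<close>. There is only one such vector because
  tails tend to 0, and linearity follows from this uniqueness.
\<close>

lemma ell1_extension:
  fixes V :: "('k::{real_normed_field, euclidean_space}, 'a) nspace" and x :: "'g \<Rightarrow> 'a"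
  assumes "banach_space V" and C: "C \<ge> 0"
    and x: "\<And>g. g \<in> \<Gamma> \<Longrightarrow> x g \<in> carrier V" and xC: "\<And>g. g \<in> \<Gamma> \<Longrightarrow> vnorm V (x g) \<le> C"
  obtains T where "T \<in> bounded_operators (ell1 \<Gamma>) V"
    and "\<And>g. g \<in> \<Gamma> \<Longrightarrow> T (unit_vec g) = x g"
    and "\<And>f. f \<in> carrier (ell1 \<Gamma>) \<Longrightarrow> vnorm V (T f) \<le> C * vnorm (ell1 \<Gamma>) f"
proof -
  let ?E = "ell1 \<Gamma> :: ('k, 'g \<Rightarrow> 'k) nspace"
  interpret V: banach_space V by fact
  interpret E: banach_space ?E by (rule ell1_banach)
  define S where "S F f = finsum V (\<lambda>g. f g \<odot>\<^bsub>V\<^esub> x g) F" for F and f :: "'g \<Rightarrow> 'k"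
  have Sc: "S F f \<in> carrier V" if "F \<subseteq> \<Gamma>" for F f
    unfolding S_def using that x by (intro V.M.finsum_closed) auto
  have mono: "vdist V (S G f) (S F f) \<le> C * ((\<Sum>g\<in>G. norm (f g)) - (\<Sum>g\<in>F. norm (f g)))"
    if "finite G" "F \<subseteq> G" "G \<subseteq> \<Gamma>" for F G f
  proof -
    have fin: "finite F" "finite (G - F)" using that by (auto intro: finite_subset)
    have "S G f = S (F \<union> (G - F)) f"
      using that by (simp add: Un_absorb1)
    also have "\<dots> = S (G - F) f \<oplus>\<^bsub>V\<^esub> S F f"
      using fin that x unfolding S_def
      by (subst V.M.finsum_Un_disjoint) (auto intro!: V.M.a_comm V.M.finsum_closed)
    finally have "S G f \<ominus>\<^bsub>V\<^esub> S F f = S (G - F) f"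
      using V.diff_add_cancel[OF Sc Sc, of "G - F" F f f] that by auto
    then have "vdist V (S G f) (S F f) = vnorm V (S (G - F) f)"
      using Sc[of F f] Sc[of G f] that by (auto simp: V.vdist_eq)
    also have "\<dots> \<le> (\<Sum>g\<in>G - F. vnorm V (f g \<odot>\<^bsub>V\<^esub> x g))"
      unfolding S_def using fin that x by (intro V.vnorm_finsum_le) auto
    also have "\<dots> \<le> (\<Sum>g\<in>G - F. C * norm (f g))"
    proof (rule sum_mono)
      fix g assume "g \<in> G - F"
      then have "g \<in> \<Gamma>" using that by auto
      then show "vnorm V (f g \<odot>\<^bsub>V\<^esub> x g) \<le> C * norm (f g)"
        using mult_left_mono[OF xC norm_ge_zero[of "f g"]] x
        by (simp add: V.vnorm_smult mult.commute)
    qed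
    also have "\<dots> = C * ((\<Sum>g\<in>G. norm (f g)) - (\<Sum>g\<in>F. norm (f g)))"
      using that fin by (simp add: sum_diff flip: sum_distrib_left)
    finally show ?thesis .
  qed
  have mono_tail: "vdist V (S G f) (S F f) \<le> C * tail \<Gamma> F f"
    if "f \<in> carrier ?E" "finite G" "F \<subseteq> G" "G \<subseteq> \<Gamma>" for F G f
  proof -
    have "C * ((\<Sum>g\<in>G. norm (f g)) - (\<Sum>g\<in>F. norm (f g))) \<le> C * tail \<Gamma> F f"
      using ell1_sum_le_vnorm[OF that(1,2,4)] C unfolding tail_def by (intro mult_left_mono) auto
    then show ?thesis using mono[OF that(2-4), of f] by linarith
  qed
  have ex: "\<exists>l. l \<in> carrier V \<and> (\<forall>F. finite F \<longrightarrow> F \<subseteq> \<Gamma> \<longrightarrow> vdist V l (S F f) \<le> C * tail \<Gamma> F f)"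
    if f: "f \<in> carrier ?E" for f
  proof -
    have "\<exists>F. finite F \<and> F \<subseteq> \<Gamma> \<and> (\<forall>G. finite G \<longrightarrow> F \<subseteq> G \<longrightarrow> G \<subseteq> \<Gamma> \<longrightarrow> tail \<Gamma> G f < inverse (real (Suc n)))" for n
      using tail_small[OF f, of "inverse (real (Suc n))"] by (metis inverse_positive_iff_positive of_nat_0_less_iff zero_less_Suc)
    then obtain K where K: "\<And>n. finite (K n)" "\<And>n. K n \<subseteq> \<Gamma>"
      "\<And>n G. finite G \<Longrightarrow> K n \<subseteq> G \<Longrightarrow> G \<subseteq> \<Gamma> \<Longrightarrow> tail \<Gamma> G f < inverse (real (Suc n))"
      by metis
    define H where "H n = (\<Union>k\<le>n. K k)" for n
    define b where "b n = C * inverse (real (Suc n))" for n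
    have H: "finite (H n)" "H n \<subseteq> \<Gamma>" "K n \<subseteq> H n" for n
      using K by (auto simp: H_def)
    have Hb: "C * tail \<Gamma> (H n) f \<le> b n" for n
      using K(3)[OF H(1,3,2), of n] C unfolding b_def by (intro mult_left_mono) auto
    have b0: "b \<longlonglongrightarrow> 0"
      unfolding b_def using LIMSEQ_inverse_real_of_nat by (intro tendsto_mult_right_zero)
    have Hrate: "vdist V (S (H m) f) (S (H n) f) \<le> b n" if "n \<le> m" for m n
    proof -
      have "H n \<subseteq> H m" using that by (fastforce simp: H_def)
      then show ?thesis using mono_tail[OF f H(1) _ H(2), of "H n" m] Hb[of n] by linarith
    qed
    \<comment> \<open>The partial sums over the increasing sets \<open>H n\<close> determine the limit of the whole net.\<close>
    obtain l where l: "l \<in> carrier V" "\<And>n. vdist V l (S (H n) f) \<le> b n"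
      using V.limit_with_rate[of "\<lambda>n. S (H n) f" b, OF Sc[OF H(2)] Hrate b0] by blast
    have "vdist V l (S F f) \<le> C * tail \<Gamma> F f" if F: "finite F" "F \<subseteq> \<Gamma>" for F
    proof (rule LIMSEQ_le_const)
      show "(\<lambda>n. b n + b n + C * tail \<Gamma> F f) \<longlonglongrightarrow> C * tail \<Gamma> F f"
        using tendsto_add[OF tendsto_add[OF b0 b0] tendsto_const[of "C * tail \<Gamma> F f"]] by simp
      show "\<exists>N. \<forall>n\<ge>N. vdist V l (S F f) \<le> b n + b n + C * tail \<Gamma> F f"
      proof (intro exI allI impI)
        fix n
        have HF: "finite (H n \<union> F)" "H n \<union> F \<subseteq> \<Gamma>" using H F by auto
        have "vdist V l (S F f) \<le> vdist V l (S (H n) f) + vdist V (S (H n) f) (S F f)"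
          by (rule V.triangle) (use l Sc H F in auto)
        also have "vdist V (S (H n) f) (S F f) \<le>
            vdist V (S (H n) f) (S (H n \<union> F) f) + vdist V (S (H n \<union> F) f) (S F f)"
          by (rule V.triangle) (use Sc H F HF in auto)
        also have "vdist V (S (H n) f) (S (H n \<union> F) f) \<le> b n"
          using mono_tail[OF f HF(1) _ HF(2), of "H n"] Hb[of n]
            V.commute[of "S (H n) f" "S (H n \<union> F) f"] by simp
        also have "vdist V (S (H n \<union> F) f) (S F f) \<le> C * tail \<Gamma> F f"
          using mono_tail[OF f HF(1) _ HF(2), of F] by simp
        finally show "vdist V l (S F f) \<le> b n + b n + C * tail \<Gamma> F f"
          using l(2)[of n] by linarith
      qed
    qed
    then show ?thesis using l(1) by blast
  qed
  define T where "T f = (SOME l. l \<in> carrier V \<and>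
      (\<forall>F. finite F \<longrightarrow> F \<subseteq> \<Gamma> \<longrightarrow> vdist V l (S F f) \<le> C * tail \<Gamma> F f))" for f
  have Tc: "T f \<in> carrier V"
    and Tb: "\<And>F. finite F \<Longrightarrow> F \<subseteq> \<Gamma> \<Longrightarrow> vdist V (T f) (S F f) \<le> C * tail \<Gamma> F f"
    if "f \<in> carrier ?E" for f
    using someI_ex[OF ex[OF that]] unfolding T_def by blast+
  \<comment> \<open>Three tails, because the comparison of the values at \<open>f + h\<close>, \<open>f\<close> and \<open>h\<close>
    involves the tails of all three vectors.\<close>
  have unique: "l = l'"
    if lc: "l \<in> carrier V" "l' \<in> carrier V" and abc: "a1 \<in> carrier ?E" "a2 \<in> carrier ?E" "a3 \<in> carrier ?E"
      and l: "\<And>F. finite F \<Longrightarrow> F \<subseteq> \<Gamma> \<Longrightarrow> vdist V l (S F f) \<le> C * (tail \<Gamma> F a1 + tail \<Gamma> F a2 + tail \<Gamma> F a3)"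
      and l': "\<And>F. finite F \<Longrightarrow> F \<subseteq> \<Gamma> \<Longrightarrow> vdist V l' (S F f) \<le> C * (tail \<Gamma> F a1 + tail \<Gamma> F a2 + tail \<Gamma> F a3)"
    for l l' a1 a2 a3 f
  proof -
    have "vdist V l l' \<le> 0 + e" if "e > 0" for e
    proof -
      define e' where "e' = e / (6 * C + 1)"
      have e': "e' > 0" using that C by (simp add: e'_def)
      obtain F1 where F1: "finite F1" "F1 \<subseteq> \<Gamma>" "\<And>G. finite G \<Longrightarrow> F1 \<subseteq> G \<Longrightarrow> G \<subseteq> \<Gamma> \<Longrightarrow> tail \<Gamma> G a1 < e'"
        using tail_small[OF abc(1) e'] by metis
      obtain F2 where F2: "finite F2" "F2 \<subseteq> \<Gamma>" "\<And>G. finite G \<Longrightarrow> F2 \<subseteq> G \<Longrightarrow> G \<subseteq> \<Gamma> \<Longrightarrow> tail \<Gamma> G a2 < e'"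
        using tail_small[OF abc(2) e'] by metis
      obtain F3 where F3: "finite F3" "F3 \<subseteq> \<Gamma>" "\<And>G. finite G \<Longrightarrow> F3 \<subseteq> G \<Longrightarrow> G \<subseteq> \<Gamma> \<Longrightarrow> tail \<Gamma> G a3 < e'"
        using tail_small[OF abc(3) e'] by metis
      define F where "F = F1 \<union> F2 \<union> F3"
      have F: "finite F" "F \<subseteq> \<Gamma>" using F1 F2 F3 by (auto simp: F_def)
      have "tail \<Gamma> F a1 + tail \<Gamma> F a2 + tail \<Gamma> F a3 \<le> 3 * e'"
        using F1(3)[OF F(1) _ F(2)] F2(3)[OF F(1) _ F(2)] F3(3)[OF F(1) _ F(2)] by (force simp: F_def)
      then have "C * (tail \<Gamma> F a1 + tail \<Gamma> F a2 + tail \<Gamma> F a3) \<le> C * (3 * e')"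
        using C by (rule mult_left_mono)
      moreover have "vdist V l l' \<le> vdist V l (S F f) + vdist V (S F f) l'"
        by (rule V.triangle) (use lc Sc F in auto)
      ultimately have "vdist V l l' \<le> 6 * C * e'"
        using l[OF F] l'[OF F] V.commute[of "S F f" l'] by simp
      also have "\<dots> \<le> (6 * C + 1) * e'" using e' by (simp add: distrib_right)
      also have "\<dots> = e" using C by (simp add: e'_def)
      finally show ?thesis by simp
    qed
    then have "vdist V l l' \<le> 0" by (rule field_le_epsilon)
    then show ?thesis using V.nonneg[of l l'] V.zero[OF lc] by simp
  qed
  have Tadd: "T (\<lambda>g. f g + h g) = T f \<oplus>\<^bsub>V\<^esub> T h" if f: "f \<in> carrier ?E" and h: "h \<in> carrier ?E" for f h
  proof (rule unique[of _ _ f h "\<lambda>g. f g + h g" "\<lambda>g. f g + h g"])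
    have fh: "(\<lambda>g. f g + h g) \<in> carrier ?E" using E.M.a_closed[OF f h] by simp
    then show "(\<lambda>g. f g + h g) \<in> carrier ?E" .
    fix F assume F: "finite F" "F \<subseteq> \<Gamma>"
    have nn: "0 \<le> C * tail \<Gamma> F f" "0 \<le> C * tail \<Gamma> F h" "0 \<le> C * tail \<Gamma> F (\<lambda>g. f g + h g)"
      using tail_nonneg[OF f F] tail_nonneg[OF h F] tail_nonneg[OF fh F] C by simp_all
    show "vdist V (T (\<lambda>g. f g + h g)) (S F (\<lambda>g. f g + h g)) \<le>
        C * (tail \<Gamma> F f + tail \<Gamma> F h + tail \<Gamma> F (\<lambda>g. f g + h g))"
      using Tb[OF fh F] nn by (simp add: distrib_left)
    have "S F (\<lambda>g. f g + h g) = finsum V (\<lambda>g. f g \<odot>\<^bsub>V\<^esub> x g \<oplus>\<^bsub>V\<^esub> h g \<odot>\<^bsub>V\<^esub> x g) F"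
      unfolding S_def using F x by (intro V.M.finsum_cong') (auto simp: V.smult_add_left)
    also have "\<dots> = S F f \<oplus>\<^bsub>V\<^esub> S F h"
      unfolding S_def using F x by (intro V.M.finsum_addf) auto
    finally show "vdist V (T f \<oplus>\<^bsub>V\<^esub> T h) (S F (\<lambda>g. f g + h g)) \<le>
        C * (tail \<Gamma> F f + tail \<Gamma> F h + tail \<Gamma> F (\<lambda>g. f g + h g))"
      using V.vdist_add_le[OF Tc[OF f] Tc[OF h] Sc[OF F(2)] Sc[OF F(2)], of f h]
        Tb[OF f F] Tb[OF h F] nn by (simp add: distrib_left)
  qed (use f h Tc E.M.a_closed[OF f h] in auto)
  have Ts: "T (\<lambda>g. c * f g) = c \<odot>\<^bsub>V\<^esub> T f" if f: "f \<in> carrier ?E" for c f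
  proof (rule unique[of _ _ "\<lambda>g. c * f g" f f "\<lambda>g. c * f g"])
    have cf: "(\<lambda>g. c * f g) \<in> carrier ?E" using E.smult_carrier[OF f, of c] by simp
    then show "(\<lambda>g. c * f g) \<in> carrier ?E" .
    fix F assume F: "finite F" "F \<subseteq> \<Gamma>"
    have nn: "0 \<le> C * tail \<Gamma> F (\<lambda>g. c * f g)" "0 \<le> C * tail \<Gamma> F f"
      using tail_nonneg[OF cf F] tail_nonneg[OF f F] C by simp_all
    show "vdist V (T (\<lambda>g. c * f g)) (S F (\<lambda>g. c * f g)) \<le>
        C * (tail \<Gamma> F (\<lambda>g. c * f g) + tail \<Gamma> F f + tail \<Gamma> F f)"
      using Tb[OF cf F] nn by (simp add: distrib_left)
    have "S F (\<lambda>g. c * f g) = finsum V (\<lambda>g. c \<odot>\<^bsub>V\<^esub> (f g \<odot>\<^bsub>V\<^esub> x g)) F"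
      unfolding S_def using F x by (intro V.M.finsum_cong') (auto simp: V.smult_smult)
    also have "\<dots> = c \<odot>\<^bsub>V\<^esub> S F f"
      unfolding S_def using F x
      by (intro V.finsum_smult_ldistr[symmetric]) (auto simp: scalar_field_def)
    finally have "vdist V (c \<odot>\<^bsub>V\<^esub> T f) (S F (\<lambda>g. c * f g)) = norm c * vdist V (T f) (S F f)"
      using V.vdist_smult[OF Tc[OF f] Sc[OF F(2)]] by simp
    also have "\<dots> \<le> norm c * (C * tail \<Gamma> F f)"
      using Tb[OF f F] by (intro mult_left_mono) auto
    also have "\<dots> = C * tail \<Gamma> F (\<lambda>g. c * f g)"
      by (simp add: tail_scale[OF f])
    finally show "vdist V (c \<odot>\<^bsub>V\<^esub> T f) (S F (\<lambda>g. c * f g)) \<le>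
        C * (tail \<Gamma> F (\<lambda>g. c * f g) + tail \<Gamma> F f + tail \<Gamma> F f)"
      using nn by (simp add: distrib_left)
  qed (use f Tc E.smult_carrier[OF f, of c] in auto)
  have Tn: "vnorm V (T f) \<le> C * vnorm ?E f" if f: "f \<in> carrier ?E" for f
    using Tb[OF f, of "{}"] Tc[OF f] by (simp add: S_def tail_def V.vdist_zero_right)
  have "T \<in> bounded_operators ?E V"
    by (rule bounded_operatorsI[where C = C]) (use Tc Tadd Ts Tn in auto)
  moreover have "T (unit_vec g) = x g" if g: "g \<in> \<Gamma>" for g
  proof -
    have u: "unit_vec g \<in> carrier ?E" using g by simp
    have "S {g} (unit_vec g) = x g"
      using x[OF g] unfolding S_def by (subst V.M.finsum_insert) (auto simp: unit_vec_def)
    moreover have "tail \<Gamma> {g} (unit_vec g :: 'g \<Rightarrow> 'k) = 0"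
      using vnorm_unit_vec[OF g, where 'k = 'k] by (simp add: tail_def unit_vec_def del: ell1_simps)
    ultimately have "vdist V (T (unit_vec g)) (x g) \<le> 0"
      using Tb[OF u, of "{g}"] g by simp
    then show ?thesis
      using V.nonneg[of "T (unit_vec g)" "x g"] V.zero[OF Tc[OF u] x[OF g]] by simp
  qed
  ultimately show ?thesis using Tn by (rule that)
qed

text \<open>
  The finitely supported vectors are dense, and on them an operator is determined by its values
  at the unit vectors.
\<close>

lemma ell1_operator_eqI:
  fixes V :: "('k::{real_normed_field, euclidean_space}, 'a) nspace" and f :: "'g \<Rightarrow> 'k"
  assumes "normed_vspace V"
    and S: "S \<in> bounded_operators (ell1 \<Gamma>) V" and T: "T \<in> bounded_operators (ell1 \<Gamma>) V"
    and eq: "\<And>g. g \<in> \<Gamma> \<Longrightarrow> S (unit_vec g) = T (unit_vec g)" and f: "f \<in> carrier (ell1 \<Gamma>)"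
  shows "S f = T f"
proof -
  let ?E = "ell1 \<Gamma> :: ('k, 'g \<Rightarrow> 'k) nspace"
  interpret V: normed_vspace V by fact
  interpret E: normed_vspace ?E by (rule ell1_normed)
  note nE = ell1_normed[of \<Gamma>, where 'k = 'k]
  have fin: "S (restrict_to F f) = T (restrict_to F f)" if "finite F" "F \<subseteq> \<Gamma>" for F
    using that
  proof (induction F rule: finite_induct)
    case empty
    have "restrict_to {} f = \<zero>\<^bsub>?E\<^esub>" by (simp add: restrict_to_def)
    then show ?case using bop_zero[OF nE assms(1)] S T by metis
  next
    case (insert g F)
    then show ?case
      using operator_restrict_insert[OF S f insert.hyps(1) insert.prems insert.hyps(2)]
        operator_restrict_insert[OF T f insert.hyps(1) insert.prems insert.hyps(2)] eq
      by simp
  qed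
  obtain A where A: "A > 0" "\<And>x. x \<in> carrier ?E \<Longrightarrow> vnorm V (S x) \<le> A * vnorm ?E x"
    using bop_bound[OF nE S] by blast
  obtain B where B: "B > 0" "\<And>x. x \<in> carrier ?E \<Longrightarrow> vnorm V (T x) \<le> B * vnorm ?E x"
    using bop_bound[OF nE T] by blast
  have "vdist V (S f) (T f) \<le> 0 + e" if "e > 0" for e
  proof -
    have "e / (A + B) > 0" using that A B by simp
    then obtain F where F: "finite F" "F \<subseteq> \<Gamma>" and "tail \<Gamma> F f < e / (A + B)"
      using tail_small[OF f, of "e / (A + B)"] by (metis order_refl)
    then have t: "(A + B) * tail \<Gamma> F f < e" using A B by (simp add: field_simps)
    let ?r = "restrict_to F f"
    note r = vdist_restrict_finite[OF f F]
    have "vdist V (S f) (T f) \<le> vdist V (S f) (S ?r) + vdist V (S ?r) (T f)"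
      by (rule V.triangle) (use bop_closed[OF S] bop_closed[OF T] f r in auto)
    also have "vdist V (S f) (S ?r) \<le> A * vdist ?E f ?r"
      by (rule bop_lipschitz[OF nE assms(1) S A(2) f r(1)])
    also have "vdist V (S ?r) (T f) \<le> B * vdist ?E f ?r"
      using bop_lipschitz[OF nE assms(1) T B(2) f r(1)] V.commute fin[OF F] by metis
    finally have "vdist V (S f) (T f) \<le> (A + B) * vdist ?E f ?r" by (simp add: distrib_right)
    also have "\<dots> \<le> (A + B) * tail \<Gamma> F f" using A B r(2) by (intro mult_left_mono) auto
    finally show ?thesis using t by simp
  qed
  then have "vdist V (S f) (T f) \<le> 0" by (rule field_le_epsilon)
  then show ?thesis
    using V.nonneg[of "S f" "T f"] V.zero[OF bop_closed[OF S f] bop_closed[OF T f]] by simp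
qed

text \<open>
  The successive approximation in the proof of the open mapping theorem: if every \<open>y\<close> can be
  hit with an error of half its norm, then correcting the error again and again gives a series
  whose terms decrease geometrically and whose sum is mapped exactly to \<open>y\<close>.
\<close>

lemma approx_surjective_imp_surjective:
  assumes "banach_space V" "normed_vspace W" and T: "T \<in> bounded_operators V W" and c: "c \<ge> 0"
    and approx: "\<And>y. y \<in> carrier W \<Longrightarrow>
      \<exists>x\<in>carrier V. vnorm V x \<le> c * vnorm W y \<and> vnorm W (y \<ominus>\<^bsub>W\<^esub> T x) \<le> vnorm W y / 2"
    and y: "y \<in> carrier W"
  shows "\<exists>x\<in>carrier V. T x = y \<and> vnorm V x \<le> 2 * c * vnorm W y"
proof -
  interpret V: banach_space V by fact
  interpret W: normed_vspace W by fact
  have nV: "normed_vspace V" ..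
  obtain p where p: "\<And>y. y \<in> carrier W \<Longrightarrow> p y \<in> carrier V"
    "\<And>y. y \<in> carrier W \<Longrightarrow> vnorm V (p y) \<le> c * vnorm W y"
    "\<And>y. y \<in> carrier W \<Longrightarrow> vnorm W (y \<ominus>\<^bsub>W\<^esub> T (p y)) \<le> vnorm W y / 2"
    using approx by metis
  \<comment> \<open>\<open>r n\<close> is the error that is left after \<open>n\<close> corrections, and \<open>s n\<close> is the sum of the first
    \<open>n\<close> corrections.\<close>
  define r where "r n = rec_nat y (\<lambda>_ z. z \<ominus>\<^bsub>W\<^esub> T (p z)) n" for n
  have r_rec: "r 0 = y" "r (Suc n) = r n \<ominus>\<^bsub>W\<^esub> T (p (r n))" for n
    by (simp_all add: r_def)
  define s where "s n = rec_nat \<zero>\<^bsub>V\<^esub> (\<lambda>k z. z \<oplus>\<^bsub>V\<^esub> p (r k)) n" for n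
  have s_rec: "s 0 = \<zero>\<^bsub>V\<^esub>" "s (Suc n) = s n \<oplus>\<^bsub>V\<^esub> p (r n)" for n
    by (simp_all add: s_def)
  have r: "r n \<in> carrier W" for n
    by (induction n) (auto simp: r_rec y bop_closed[OF T] p(1) intro!: W.M.minus_closed)
  have s: "s n \<in> carrier V" for n
    by (induction n) (auto simp: s_rec p(1) r)
  \<comment> \<open>The sum of the geometric series of the bounds for the corrections.\<close>
  define M where "M = 2 * c * vnorm W y"
  have rn: "vnorm W (r n) \<le> vnorm W y * (1 / 2) ^ n" for n
  proof (induction n)
    case (Suc n)
    then show ?case using p(3)[OF r[of n]] by (simp add: r_rec)
  qed (simp add: r_rec)
  have step: "vdist V (s (n + k)) (s n) \<le> M * ((1 / 2) ^ n - (1 / 2) ^ (n + k))" for n k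
  proof (induction k)
    case (Suc k)
    have "vdist V (s (n + Suc k)) (s (n + k)) = vnorm V (p (r (n + k)))"
      using s[of "n + k"] p(1)[OF r[of "n + k"]]
      by (simp add: s_rec V.vdist_eq V.M.a_comm[of "s (n + k)"] V.diff_add_cancel)
    also have "\<dots> \<le> c * (vnorm W y * (1 / 2) ^ (n + k))"
      using p(2)[OF r[of "n + k"]] mult_left_mono[OF rn[of "n + k"] c] by linarith
    finally show ?case
      using Suc V.triangle[OF s[of "n + Suc k"] s[of "n + k"] s[of n]] by (simp add: M_def algebra_simps)
  qed (simp add: s V.zero)
  have M0: "M \<ge> 0" using c W.vnorm_nonneg[OF y] by (simp add: M_def)
  have rate: "vdist V (s m) (s n) \<le> M * (1 / 2) ^ n" if "n \<le> m" for m n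
  proof -
    have "M * ((1 / 2) ^ n - (1 / 2) ^ m) \<le> M * (1 / 2) ^ n"
      using M0 by (intro mult_left_mono) auto
    then show ?thesis using step[of n "m - n"] that by simp
  qed
  have pow: "(\<lambda>n. (1 / 2 :: real) ^ n) \<longlonglongrightarrow> 0" by (rule LIMSEQ_power_zero) simp
  have "(\<lambda>n. M * (1 / 2) ^ n) \<longlonglongrightarrow> 0" using pow by (rule tendsto_mult_right_zero)
  then obtain l where l: "l \<in> carrier V" "\<And>n. vdist V l (s n) \<le> M * (1 / 2) ^ n"
    using V.limit_with_rate[of s "\<lambda>n. M * (1 / 2) ^ n", OF s rate] by blast
  have Ts: "vdist W (T (s n)) y \<le> vnorm W y * (1 / 2) ^ n" for n
  proof -
    have "T (s n) \<oplus>\<^bsub>W\<^esub> r n = y"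
    proof (induction n)
      case 0
      then show ?case using bop_zero[OF nV assms(2) T] y by (simp add: s_rec r_rec)
    next
      case (Suc n)
      have "T (s (Suc n)) \<oplus>\<^bsub>W\<^esub> r (Suc n) =
          T (s n) \<oplus>\<^bsub>W\<^esub> (T (p (r n)) \<oplus>\<^bsub>W\<^esub> (r n \<ominus>\<^bsub>W\<^esub> T (p (r n))))"
        using s p(1) r by (simp add: s_rec r_rec bop_add[OF T] bop_closed[OF T] W.M.a_assoc)
      then show ?case using Suc p(1) r by (simp add: W.add_diff_cancel bop_closed[OF T])
    qed
    then have "y \<ominus>\<^bsub>W\<^esub> T (s n) = r n"
      using W.diff_add_cancel[of "r n" "T (s n)"] r[of n] bop_closed[OF T s[of n]]
      by (simp add: W.M.a_comm)
    then show ?thesis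
      using rn[of n] y bop_closed[OF T s[of n]] W.commute[of "T (s n)" y] by (simp add: W.vdist_eq)
  qed
  obtain K where K: "K > 0" "\<And>x. x \<in> carrier V \<Longrightarrow> vnorm W (T x) \<le> K * vnorm V x"
    using bop_bound[OF nV T] by blast
  have "vdist W (T l) y \<le> 0"
  proof (rule LIMSEQ_le_const)
    show "(\<lambda>n. (K * M + vnorm W y) * (1 / 2) ^ n) \<longlonglongrightarrow> 0"
      using pow by (rule tendsto_mult_right_zero)
    show "\<exists>N. \<forall>n\<ge>N. vdist W (T l) y \<le> (K * M + vnorm W y) * (1 / 2) ^ n"
    proof (intro exI allI impI)
      fix n
      have "vdist W (T l) y \<le> vdist W (T l) (T (s n)) + vdist W (T (s n)) y"
        by (rule W.triangle) (use bop_closed[OF T] l s y in auto)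
      also have "vdist W (T l) (T (s n)) \<le> K * vdist V l (s n)"
        by (rule bop_lipschitz[OF nV assms(2) T K(2) l(1) s])
      also have "\<dots> \<le> K * (M * (1 / 2) ^ n)" using K(1) l(2) by (intro mult_left_mono) auto
      finally show "vdist W (T l) y \<le> (K * M + vnorm W y) * (1 / 2) ^ n"
        using Ts[of n] by (simp add: algebra_simps)
    qed
  qed
  then have "T l = y"
    using W.nonneg[of "T l" y] W.zero[OF bop_closed[OF T l(1)] y] by simp
  moreover have "vnorm V l \<le> 2 * c * vnorm W y"
    using l(2)[of 0] by (simp add: s_rec V.vdist_zero_right[OF l(1)] M_def)
  ultimately show ?thesis using l(1) by blast
qed

section \<open>Quotients and lifting\<close>

locale subspace_quotient = normed_vspace V
  for V :: "('k::{real_normed_field, euclidean_space}, 'a) nspace" (structure) +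
  fixes J :: "'a set"
  assumes submodule: "submodule J scalar_field V"
begin

sublocale coset: abelian_subgroup J V
  by (rule abelian_subgroupI3)
    (use submodule M.abelian_group_axioms in \<open>auto simp: submodule_def additive_subgroup_def\<close>)

lemma J_carrier: "j \<in> J \<Longrightarrow> j \<in> carrier V"
  using submoduleE(1)[OF submodule] by blast

lemma J_smult: "j \<in> J \<Longrightarrow> c \<odot>\<^bsub>V\<^esub> j \<in> J"
  using submoduleE(4)[OF submodule, of c j] by (simp add: scalar_field_def)

lemma coset_iff:
  "x \<in> carrier V \<Longrightarrow> y \<in> carrier V \<Longrightarrow> y \<in> J +>\<^bsub>V\<^esub> x \<longleftrightarrow> y \<ominus>\<^bsub>V\<^esub> x \<in> J"
  by (simp add: coset.a_rcos_module a_minus_def)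

lemma quotient_carrier: "A \<in> carrier (quotient_space V J) \<longleftrightarrow> (\<exists>x\<in>carrier V. A = J +>\<^bsub>V\<^esub> x)"
  by (auto simp: quotient_space_def A_RCOSETS_def')

lemma quotient_add:
  "x \<in> carrier V \<Longrightarrow> y \<in> carrier V \<Longrightarrow>
    (J +>\<^bsub>V\<^esub> x) \<oplus>\<^bsub>quotient_space V J\<^esub> (J +>\<^bsub>V\<^esub> y) = J +>\<^bsub>V\<^esub> (x \<oplus>\<^bsub>V\<^esub> y)"
  by (simp add: quotient_space_def coset.a_rcos_sum)

lemma quotient_smult:
  assumes x: "x \<in> carrier V"
  shows "c \<odot>\<^bsub>quotient_space V J\<^esub> (J +>\<^bsub>V\<^esub> x) = J +>\<^bsub>V\<^esub> (c \<odot>\<^bsub>V\<^esub> x)"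
proof -
  have "J +>\<^bsub>V\<^esub> (c \<odot>\<^bsub>V\<^esub> a) = J +>\<^bsub>V\<^esub> (c \<odot>\<^bsub>V\<^esub> x)" if "a \<in> J +>\<^bsub>V\<^esub> x" for a
  proof -
    have a: "a \<in> carrier V"
      using that coset.a_rcosets_carrier[OF M.a_rcosetsI[OF _ x]] J_carrier by blast
    have "c \<odot>\<^bsub>V\<^esub> (a \<ominus>\<^bsub>V\<^esub> x) \<in> J"
      using that a x by (intro J_smult) (simp add: coset_iff)
    then have "c \<odot>\<^bsub>V\<^esub> a \<in> J +>\<^bsub>V\<^esub> (c \<odot>\<^bsub>V\<^esub> x)"
      using a x by (simp add: coset_iff diff_eq smult_add_right smult_smult)
    then show ?thesis
      using x by (simp add: coset.a_repr_independence')
  qed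
  then have "(\<Union>a\<in>J +>\<^bsub>V\<^esub> x. J +>\<^bsub>V\<^esub> (c \<odot>\<^bsub>V\<^esub> a)) = (\<Union>a\<in>J +>\<^bsub>V\<^esub> x. J +>\<^bsub>V\<^esub> (c \<odot>\<^bsub>V\<^esub> x))"
    by (intro SUP_cong refl)
  also have "\<dots> = J +>\<^bsub>V\<^esub> (c \<odot>\<^bsub>V\<^esub> x)"
    using coset.a_rcos_self[OF x] by (intro UN_constant_eq) auto
  finally show ?thesis
    by (simp add: quotient_space_def)
qed

lemma quotient_vnorm_less:
  assumes "A \<in> carrier (quotient_space V J)" "vnorm (quotient_space V J) A < e"
  obtains x where "x \<in> carrier V" "A = J +>\<^bsub>V\<^esub> x" "vnorm V x < e"
proof -
  obtain y where y: "y \<in> carrier V" "A = J +>\<^bsub>V\<^esub> y"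
    using assms(1) by (auto simp: quotient_carrier)
  have "(INF a\<in>A. vnorm V a) < e" using assms(2) by (simp add: quotient_space_def)
  moreover have "A \<noteq> {}" using coset.a_rcos_self[OF y(1)] y(2) by auto
  ultimately obtain x where x: "x \<in> A" "vnorm V x < e"
    by (auto dest: cInf_lessD[rotated])
  have "x \<in> carrier V"
    using x(1) y coset.a_rcosets_carrier[OF M.a_rcosetsI[OF _ y(1)]] J_carrier by blast
  moreover have "A = J +>\<^bsub>V\<^esub> x"
    using coset.a_repr_independence'[of x y] x(1) y by simp
  ultimately show ?thesis using x(2) by (rule that)
qed

lemma quotient_vnorm_le:
  assumes "x \<in> A" "A \<in> carrier (quotient_space V J)"
  shows "vnorm (quotient_space V J) A \<le> vnorm V x"
proof -
  have "A \<subseteq> carrier V"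
    using assms(2) coset.a_rcosets_carrier by (simp add: quotient_space_def)
  then have "bdd_below (vnorm V ` A)"
    by (intro bdd_belowI[of _ 0]) (auto intro: vnorm_nonneg)
  then show ?thesis
    using assms(1) by (simp add: quotient_space_def cINF_lower)
qed

end

lemma isomorphic_aqlp:
  fixes Y :: "('k::{real_normed_field, euclidean_space}, 'y) nspace"
  assumes "normed_vspace Y" "normed_vspace Z" "isomorphic Y Z" "aqlp TYPE('x) Z"
  shows "aqlp TYPE('x) Y"
  unfolding aqlp_def
proof (intro allI impI ballI)
  fix X :: "('k, 'x) nspace" and J S
  assume X: "banach_space X" "closed_subspace X J"
    and S: "S \<in> bounded_operators Y (quotient_space X J)"
  obtain T R where T: "T \<in> bounded_operators Y Z" and R: "R \<in> bounded_operators Z Y"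
    and RT: "\<And>y. y \<in> carrier Y \<Longrightarrow> R (T y) = y"
    using assms(3) unfolding isomorphic_iff[OF assms(1,2)] by blast
  have "(\<lambda>z. S (R z)) \<in> bounded_operators Z (quotient_space X J)"
    by (rule bop_compose[OF assms(2,1) R S])
  then have "\<exists>L\<in>bounded_operators Z X. \<forall>z\<in>carrier Z. S (R z) = J +>\<^bsub>X\<^esub> L z"
    using assms(4)[unfolded aqlp_def, rule_format, OF X] by simp
  then obtain L where L: "L \<in> bounded_operators Z X"
    and eq: "\<And>z. z \<in> carrier Z \<Longrightarrow> S (R z) = J +>\<^bsub>X\<^esub> L z"
    by blast
  show "\<exists>S'\<in>bounded_operators Y X. \<forall>y\<in>carrier Y. S y = J +>\<^bsub>X\<^esub> S' y"
  proof
    show "(\<lambda>y. L (T y)) \<in> bounded_operators Y X"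
      by (rule bop_compose[OF assms(1,2) T L])
    show "\<forall>y\<in>carrier Y. S y = J +>\<^bsub>X\<^esub> L (T y)"
      using eq[OF bop_closed[OF T]] by (simp add: RT)
  qed
qed

text \<open>
  Each unit vector has an image of norm at most \<open>C\<close> in the quotient, hence a representative of
  norm less than \<open>C + 1\<close>, and these representatives define the lifting \<open>T\<close>. It lifts \<open>S\<close> on finitely
  supported vectors; for arbitrary \<open>f\<close> it follows that \<open>T f\<close> has distance 0 from the coset \<open>S f\<close>,
  which is closed because \<open>J\<close> is.
\<close>

lemma ell1_aqlp:
  "aqlp TYPE('x) (ell1 \<Gamma> :: ('k::{real_normed_field, euclidean_space}, 'g \<Rightarrow> 'k) nspace)"
  unfolding aqlp_def
proof (intro allI impI ballI)
  fix X :: "('k, 'x) nspace" and J S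
  let ?E = "ell1 \<Gamma> :: ('k, 'g \<Rightarrow> 'k) nspace"
  let ?Q = "quotient_space X J"
  assume bX: "banach_space X" and J: "closed_subspace X J"
    and S: "S \<in> bounded_operators ?E ?Q"
  interpret X: banach_space X by fact
  interpret Q: subspace_quotient X J
    by (intro subspace_quotient.intro subspace_quotient_axioms.intro X.normed_vspace_axioms)
      (use J in \<open>simp add: closed_subspace_def\<close>)
  interpret E: normed_vspace ?E by (rule ell1_normed)
  have nE: "normed_vspace ?E" by (rule ell1_normed)
  have nX: "normed_vspace X" ..
  obtain C where C: "C > 0" "\<And>f. f \<in> carrier ?E \<Longrightarrow> vnorm ?Q (S f) \<le> C * vnorm ?E f"
    using bop_bound[OF nE S] by blast
  have "\<exists>x. x \<in> carrier X \<and> S (unit_vec g) = J +>\<^bsub>X\<^esub> x \<and> vnorm X x < C + 1" if "g \<in> \<Gamma>" for g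
  proof -
    have "vnorm ?Q (S (unit_vec g)) < C + 1"
      using C(2)[OF unit_vec_carrier[OF that]] vnorm_unit_vec[OF that, where 'k = 'k] by simp
    then show ?thesis
      using Q.quotient_vnorm_less[OF bop_closed[OF S unit_vec_carrier[OF that]]] by metis
  qed
  then obtain x where x: "\<And>g. g \<in> \<Gamma> \<Longrightarrow> x g \<in> carrier X"
    "\<And>g. g \<in> \<Gamma> \<Longrightarrow> S (unit_vec g) = J +>\<^bsub>X\<^esub> x g" "\<And>g. g \<in> \<Gamma> \<Longrightarrow> vnorm X (x g) < C + 1"
    by metis
  obtain T where T: "T \<in> bounded_operators ?E X" "\<And>g. g \<in> \<Gamma> \<Longrightarrow> T (unit_vec g) = x g"
    using ell1_extension[OF bX, of "C + 1" \<Gamma> x] x C(1) by (metis add_increasing less_eq_real_def zero_le_one)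
  obtain D where D: "D > 0" "\<And>f. f \<in> carrier ?E \<Longrightarrow> vnorm X (T f) \<le> D * vnorm ?E f"
    using bop_bound[OF nE T(1)] by blast
  have fin: "S (restrict_to F f) = J +>\<^bsub>X\<^esub> T (restrict_to F f)"
    if f: "f \<in> carrier ?E" and "finite F" "F \<subseteq> \<Gamma>" for F f
    using that(2,3)
  proof (induction F rule: finite_induct)
    case empty
    have z: "restrict_to {} f = 0 \<odot>\<^bsub>?E\<^esub> \<zero>\<^bsub>?E\<^esub>" by (simp add: restrict_to_def)
    have zc: "\<zero>\<^bsub>?E\<^esub> \<in> carrier ?E" by (rule E.M.zero_closed)
    obtain a where "a \<in> carrier X" "S \<zero>\<^bsub>?E\<^esub> = J +>\<^bsub>X\<^esub> a"
      using bop_closed[OF S zc] unfolding Q.quotient_carrier by blast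
    then show ?case
      unfolding z bop_smult[OF S zc] bop_smult[OF T(1) zc]
      using bop_closed[OF T(1) zc] by (simp add: Q.quotient_smult)
  next
    case (insert g F)
    have c: "restrict_to F f \<in> carrier ?E" "unit_vec g \<in> carrier ?E"
      using vdist_restrict_finite(1)[OF f, of F] insert by auto
    have IH: "S (restrict_to F f) = J +>\<^bsub>X\<^esub> T (restrict_to F f)" "S (unit_vec g) = J +>\<^bsub>X\<^esub> T (unit_vec g)"
      using insert x(2) T(2) by auto
    show ?case
      using operator_restrict_insert[OF S f insert.hyps(1) insert.prems insert.hyps(2)]
        operator_restrict_insert[OF T(1) f insert.hyps(1) insert.prems insert.hyps(2)] IH
        bop_closed[OF T(1) c(1)] bop_closed[OF T(1) c(2)]
      by (simp add: Q.quotient_add Q.quotient_smult)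
  qed
  have "S f = J +>\<^bsub>X\<^esub> T f" if f: "f \<in> carrier ?E" for f
  proof -
    obtain a where a: "a \<in> carrier X" "S f = J +>\<^bsub>X\<^esub> a"
      using bop_closed[OF S f] by (auto simp: Q.quotient_carrier)
    have Tf: "T f \<in> carrier X" by (rule bop_closed[OF T(1) f])
    \<comment> \<open>The vector \<open>f\<close> is a finitely supported vector \<open>r\<close> plus a small vector \<open>d\<close>. The coset of
      \<open>d\<close> has a small representative \<open>w\<close>, so \<open>T r + w\<close> lies in \<open>S f\<close> and is close to \<open>T f\<close>.\<close>
    have near: "\<exists>j\<in>J. vdist X (T f \<ominus>\<^bsub>X\<^esub> a) j < e" if e: "e > 0" for e
    proof -
      have "e / (C + D + 1) > 0" using e C D by simp
      then obtain F where F: "finite F" "F \<subseteq> \<Gamma>" and t: "tail \<Gamma> F f < e / (C + D + 1)"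
        using tail_small[OF f] by (metis order_refl)
      let ?r = "restrict_to F f"
      let ?d = "f \<ominus>\<^bsub>?E\<^esub> ?r"
      note r = vdist_restrict_finite[OF f F]
      have d: "?d \<in> carrier ?E" using f r(1) by (rule E.M.minus_closed)
      have dn: "vnorm ?E ?d < e / (C + D + 1)"
        using r(2) t E.vdist_eq[OF f r(1)] by simp
      have "vnorm ?Q (S ?d) < (C + 1) * (e / (C + D + 1))"
      proof -
        have "C * vnorm ?E ?d \<le> C * (e / (C + D + 1))"
          using dn C(1) by (intro mult_left_mono) auto
        then show ?thesis
          using C(2)[OF d] \<open>e / (C + D + 1) > 0\<close> by (simp only: distrib_right)
      qed
      then obtain w where w: "w \<in> carrier X" "S ?d = J +>\<^bsub>X\<^esub> w" "vnorm X w < (C + 1) * (e / (C + D + 1))"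
        using Q.quotient_vnorm_less[OF bop_closed[OF S d]] by metis
      have Tr: "T ?r \<in> carrier X" and Td: "T ?d \<in> carrier X"
        using bop_closed[OF T(1)] r(1) d by auto
      have Tfd: "T f = T ?r \<oplus>\<^bsub>X\<^esub> T ?d"
        using bop_add[OF T(1) r(1) d] E.add_diff_cancel[OF f r(1)] by simp
      have "S f = S ?r \<oplus>\<^bsub>?Q\<^esub> S ?d"
        using bop_add[OF S r(1) d] E.add_diff_cancel[OF f r(1)] by simp
      also have "\<dots> = J +>\<^bsub>X\<^esub> (T ?r \<oplus>\<^bsub>X\<^esub> w)"
        using fin[OF f F] w(1,2) Tr by (simp add: Q.quotient_add)
      finally have "T ?r \<oplus>\<^bsub>X\<^esub> w \<in> J +>\<^bsub>X\<^esub> a"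
        using a Tr w(1) Q.coset.a_rcos_self[of "T ?r \<oplus>\<^bsub>X\<^esub> w"] by simp
      then have jJ: "(T ?r \<oplus>\<^bsub>X\<^esub> w) \<ominus>\<^bsub>X\<^esub> a \<in> J"
        using a Tr w(1) by (simp add: Q.coset_iff)
      have "vdist X (T f \<ominus>\<^bsub>X\<^esub> a) ((T ?r \<oplus>\<^bsub>X\<^esub> w) \<ominus>\<^bsub>X\<^esub> a) \<le> vdist X (T f) (T ?r \<oplus>\<^bsub>X\<^esub> w) + 0"
        using X.vdist_add_le[OF Tf _ X.M.a_closed[OF Tr w(1)], of "\<ominus>\<^bsub>X\<^esub> a" "\<ominus>\<^bsub>X\<^esub> a"] a(1)
          X.zero[of "\<ominus>\<^bsub>X\<^esub> a" "\<ominus>\<^bsub>X\<^esub> a"]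
        by (simp add: a_minus_def)
      also have "vdist X (T f) (T ?r \<oplus>\<^bsub>X\<^esub> w) \<le> vdist X (T ?r) (T ?r) + vdist X (T ?d) w"
        unfolding Tfd by (rule X.vdist_add_le[OF Tr Td Tr w(1)])
      also have "vdist X (T ?r) (T ?r) = 0" using X.zero[OF Tr Tr] by simp
      also have "vdist X (T ?d) w \<le> vdist X (T ?d) \<zero>\<^bsub>X\<^esub> + vdist X \<zero>\<^bsub>X\<^esub> w"
        using X.triangle[OF Td _ w(1), of "\<zero>\<^bsub>X\<^esub>"] by simp
      also have "\<dots> = vnorm X (T ?d) + vnorm X w"
        using Td w(1) X.commute[of "\<zero>\<^bsub>X\<^esub>" w] by (simp add: X.vdist_zero_right)
      also have "\<dots> < D * (e / (C + D + 1)) + (C + 1) * (e / (C + D + 1))"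
      proof -
        have "D * vnorm ?E ?d \<le> D * (e / (C + D + 1))"
          using dn D(1) by (intro mult_left_mono) auto
        then show ?thesis using D(2)[OF d] w(3) by linarith
      qed
      also have "\<dots> = (C + D + 1) * (e / (C + D + 1))" by (simp only: distrib_right) 
      also have "\<dots> = e" using C(1) D(1) by simp
      finally show ?thesis using jJ by auto
    qed
    have "T f \<ominus>\<^bsub>X\<^esub> a \<in> J"
    proof (rule ccontr)
      assume "T f \<ominus>\<^bsub>X\<^esub> a \<notin> J"
      moreover have "closedin X.mtopology J"
        using J by (simp add: closed_subspace_def vtopology_def)
      ultimately obtain e where "e > 0" "disjnt J (X.mball (T f \<ominus>\<^bsub>X\<^esub> a) e)"
        using Tf a(1) unfolding X.closedin_metric by (meson DiffI X.M.minus_closed)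
      then show False
        using near[of e] Q.J_carrier Tf a(1) by (auto simp: disjnt_iff)
    qed
    then have "T f \<in> S f" using a Tf by (simp add: Q.coset_iff)
    then show ?thesis using a Q.coset.a_repr_independence'[of "T f" a] by simp
  qed
  then show "\<exists>S'\<in>bounded_operators ?E X. \<forall>y\<in>carrier ?E. S y = J +>\<^bsub>X\<^esub> S' y"
    using T(1) by blast
qed

text \<open>
  The identity of \<open>Y\<close> is lifted through \<open>T\<close>: with \<open>J\<close> the kernel of \<open>T\<close>, the fibres of \<open>T\<close> are the
  cosets of \<open>J\<close>, and sending \<open>y\<close> to its fibre is an operator \<open>S\<close> from \<open>Y\<close> to \<open>X/J\<close>, bounded because \<open>y\<close>
  has a preimage of norm at most \<open>K\<close> times its own. A lifting of \<open>S\<close> picks a point of each fibre.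
\<close>

lemma aqlp_right_inverse:
  fixes Y :: "('k::{real_normed_field, euclidean_space}, 'y) nspace" and X :: "('k, 'x) nspace"
  assumes aqlp: "aqlp TYPE('x) Y" and nY: "normed_vspace Y" and bX: "banach_space X"
    and T: "T \<in> bounded_operators X Y"
    and surj: "\<And>y. y \<in> carrier Y \<Longrightarrow> \<exists>x\<in>carrier X. T x = y \<and> vnorm X x \<le> K * vnorm Y y"
  shows "retract Y X"
proof -
  interpret X: banach_space X by fact
  interpret Y: normed_vspace Y by fact
  have nX: "normed_vspace X" ..
  define J where "J = {x \<in> carrier X. T x = \<zero>\<^bsub>Y\<^esub>}"
  have sub: "submodule J scalar_field X"
    by (rule X.submoduleI)
      (auto simp: J_def bop_zero[OF nX nY T] X.a_inv_eq_smult bop_smult[OF T] bop_add[OF T])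
  have J: "closed_subspace X J"
    unfolding closed_subspace_def
  proof (intro conjI sub)
    have "closedin (vtopology Y) {\<zero>\<^bsub>Y\<^esub>}"
      unfolding vtopology_def using Y.Hausdorff_space_mtopology
      by (intro closedin_Hausdorff_singleton) auto
    then have "closedin (vtopology X) {x \<in> topspace (vtopology X). T x \<in> {\<zero>\<^bsub>Y\<^esub>}}"
      by (rule closedin_continuous_map_preimage[OF bounded_operator_imp_continuous[OF nX nY T]])
    then show "closedin (vtopology X) J" by (simp add: vtopology_def J_def)
  qed
  interpret Q: subspace_quotient X J by (intro subspace_quotient.intro subspace_quotient_axioms.intro nX sub)
  let ?Q = "quotient_space X J"
  define S where "S y = {x \<in> carrier X. T x = y}" for y
  have S_eq: "S (T x) = J +>\<^bsub>X\<^esub> x" if x: "x \<in> carrier X" for x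
  proof -
    have "J \<subseteq> carrier X" using Q.J_carrier by auto
    then have "J +>\<^bsub>X\<^esub> x \<subseteq> carrier X"
      by (rule Q.coset.a_rcosets_carrier[OF X.M.a_rcosetsI[OF _ x]])
    moreover have "T z = T x \<longleftrightarrow> z \<ominus>\<^bsub>X\<^esub> x \<in> J" if z: "z \<in> carrier X" for z
    proof -
      have Tc: "T z \<in> carrier Y" "T x \<in> carrier Y" using x z by (simp_all add: bop_closed[OF T])
      have "T z = T x \<longleftrightarrow> vnorm Y (T z \<ominus>\<^bsub>Y\<^esub> T x) = 0"
        unfolding Y.vdist_eq[OF Tc, symmetric] using Y.zero[OF Tc] by simp
      also have "\<dots> \<longleftrightarrow> T (z \<ominus>\<^bsub>X\<^esub> x) = \<zero>\<^bsub>Y\<^esub>"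
        using Tc bop_diff[OF nX nY T z x] by (simp add: Y.vnorm_eq_zero)
      also have "\<dots> \<longleftrightarrow> z \<ominus>\<^bsub>X\<^esub> x \<in> J"
        unfolding J_def using X.M.minus_closed[OF z x] by blast
      finally show ?thesis .
    qed
    ultimately have "z \<in> S (T x) \<longleftrightarrow> z \<in> J +>\<^bsub>X\<^esub> x" for z
      using x unfolding S_def by (cases "z \<in> carrier X") (auto simp: Q.coset_iff)
    then show ?thesis by blast
  qed
  obtain s where s: "\<And>y. y \<in> carrier Y \<Longrightarrow> s y \<in> carrier X" "\<And>y. y \<in> carrier Y \<Longrightarrow> T (s y) = y"
    "\<And>y. y \<in> carrier Y \<Longrightarrow> vnorm X (s y) \<le> K * vnorm Y y"
    using surj by metis
  have Ss: "S y = J +>\<^bsub>X\<^esub> s y" if "y \<in> carrier Y" for y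
    using S_eq[OF s(1)[OF that]] s(2)[OF that] by simp
  have "S \<in> bounded_operators Y ?Q"
  proof (rule bounded_operatorsI[where C = K])
    fix y assume y: "y \<in> carrier Y"
    show c: "S y \<in> carrier ?Q"
      using Ss[OF y] s(1)[OF y] by (auto simp: Q.quotient_carrier)
    have "vnorm ?Q (S y) \<le> vnorm X (s y)"
      by (rule Q.quotient_vnorm_le[OF _ c]) (use s y in \<open>simp add: S_def\<close>)
    then show "vnorm ?Q (S y) \<le> K * vnorm Y y" using s(3)[OF y] by simp
    show "S (c \<odot>\<^bsub>Y\<^esub> y) = c \<odot>\<^bsub>?Q\<^esub> S y" for c
      using S_eq[of "c \<odot>\<^bsub>X\<^esub> s y"] s y
      by (simp add: Ss[OF y] Q.quotient_smult bop_smult[OF T])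
    show "S (y \<oplus>\<^bsub>Y\<^esub> z) = S y \<oplus>\<^bsub>?Q\<^esub> S z" if z: "z \<in> carrier Y" for z
      using S_eq[of "s y \<oplus>\<^bsub>X\<^esub> s z"] s y z
      by (simp add: Ss[OF y] Ss[OF z] Q.quotient_add bop_add[OF T])
  qed
  then have "\<exists>R\<in>bounded_operators Y X. \<forall>y\<in>carrier Y. S y = J +>\<^bsub>X\<^esub> R y"
    using aqlp[unfolded aqlp_def, rule_format, OF bX J] by simp
  then obtain R where R: "R \<in> bounded_operators Y X" "\<And>y. y \<in> carrier Y \<Longrightarrow> S y = J +>\<^bsub>X\<^esub> R y"
    by blast
  have "T (R y) = y" if "y \<in> carrier Y" for y
    using R(2)[OF that] Q.coset.a_rcos_self[OF bop_closed[OF R(1) that]] by (auto simp: S_def)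
  then show ?thesis
    using R(1) T by (auto simp: retract_def)
qed

text \<open>
  The lifting property of \<open>Y\<close> only concerns spaces whose vectors have one fixed type. A space over
  another type is carried into it along an injection.
\<close>

definition copy_space :: "('a \<Rightarrow> 'b) \<Rightarrow> ('k, 'a) nspace \<Rightarrow> ('k, 'b) nspace" where
  "copy_space h V =
     \<lparr>carrier = h ` carrier V, mult = undefined, one = undefined,
      zero = h \<zero>\<^bsub>V\<^esub>, add = (\<lambda>a b. h (inv_into UNIV h a \<oplus>\<^bsub>V\<^esub> inv_into UNIV h b)),
      smult = (\<lambda>c a. h (c \<odot>\<^bsub>V\<^esub> inv_into UNIV h a)),
      vnorm = (\<lambda>a. vnorm V (inv_into UNIV h a))\<rparr>"

lemma copy_space_banach:
  fixes V :: "('k::{real_normed_field, euclidean_space}, 'a) nspace" and h :: "'a \<Rightarrow> 'b"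
  assumes "banach_space V" and h: "inj h"
  shows "banach_space (copy_space h V)"
proof -
  interpret V: banach_space V by fact
  let ?C = "copy_space h V"
  have inv [simp]: "inv_into UNIV h (h x) = x" for x using h by simp
  have sel [simp]: "carrier ?C = h ` carrier V" "\<zero>\<^bsub>?C\<^esub> = h \<zero>\<^bsub>V\<^esub>"
    "h x \<oplus>\<^bsub>?C\<^esub> h y = h (x \<oplus>\<^bsub>V\<^esub> y)" "c \<odot>\<^bsub>?C\<^esub> h x = h (c \<odot>\<^bsub>V\<^esub> x)"
    "vnorm ?C (h x) = vnorm V x" for x y c
    by (simp_all add: copy_space_def)
  have neg: "(- 1) \<odot>\<^bsub>V\<^esub> x \<oplus>\<^bsub>V\<^esub> x = \<zero>\<^bsub>V\<^esub>" if "x \<in> carrier V" for x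
    using V.smult_add_left[OF that, of "- 1" 1] that by simp
  then have neg': "x \<oplus>\<^bsub>V\<^esub> (- 1) \<odot>\<^bsub>V\<^esub> x = \<zero>\<^bsub>V\<^esub>" if "x \<in> carrier V" for x
    using that V.M.a_comm[of x "(- 1) \<odot>\<^bsub>V\<^esub> x"] by simp
  have nC: "normed_vspace ?C"
    by (rule normed_vspaceI)
      (auto simp: V.M.a_ac neg' V.smult_add_left V.smult_add_right V.smult_smult
        V.vnorm_eq_zero V.vnorm_smult inj_eq[OF h] intro: V.vnorm_triangle)
  interpret C: normed_vspace ?C by (rule nC)
  have dist: "vdist ?C (h x) (h y) = vdist V x y" if "x \<in> carrier V" "y \<in> carrier V" for x y
    using that C.diff_eq[of "h x" "h y"] V.diff_eq[of x y] by (simp add: C.vdist_eq V.vdist_eq)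
  have "C.mcomplete"
    unfolding C.mcomplete_def
  proof (intro allI impI)
    fix \<sigma> assume "C.MCauchy \<sigma>"
    then have \<sigma>: "range \<sigma> \<subseteq> h ` carrier V"
      "\<And>e. e > 0 \<Longrightarrow> \<exists>N. \<forall>n n'. N \<le> n \<longrightarrow> N \<le> n' \<longrightarrow> vdist ?C (\<sigma> n) (\<sigma> n') < e"
      unfolding C.MCauchy_def by auto
    define \<tau> where "\<tau> n = inv_into UNIV h (\<sigma> n)" for n
    have \<tau>: "\<sigma> n = h (\<tau> n)" "\<tau> n \<in> carrier V" for n
    proof -
      have "\<sigma> n \<in> h ` carrier V" using \<sigma>(1) by blast
      then show "\<sigma> n = h (\<tau> n)" "\<tau> n \<in> carrier V" by (auto simp: \<tau>_def)
    qed
    have "V.MCauchy \<tau>"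
      unfolding V.MCauchy_def using \<sigma>(2) \<tau> by (auto simp: dist)
    then obtain l where l: "limitin V.mtopology \<tau> l sequentially"
      using V.complete unfolding V.mcomplete_def by meson
    have "limitin C.mtopology \<sigma> (h l) sequentially"
      using l unfolding C.limit_metric_sequentially V.limit_metric_sequentially
      by (auto simp: \<tau> dist)
    then show "\<exists>x. limitin C.mtopology \<sigma> x sequentially" by (rule exI)
  qed
  then show ?thesis by (intro banach_space.intro nC banach_space_axioms.intro)
qed

lemma copy_space_operators:
  fixes V :: "('k::{real_normed_field, euclidean_space}, 'a) nspace" and h :: "'a \<Rightarrow> 'b"
  assumes "inj h"
  shows "h \<in> bounded_operators V (copy_space h V)" "inv_into UNIV h \<in> bounded_operators (copy_space h V) V"
  using assms by (auto simp: copy_space_def intro!: bounded_operatorsI[where C = 1])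

text \<open>
  After rescaling \<open>y\<close> to norm 1, a point \<open>d\<close> of the net approximates it with error at most \<open>1/2\<close>,
  so a multiple of the unit vector at \<open>d\<close> is an approximate preimage of \<open>y\<close>.
\<close>

lemma net_imp_surjection:
  fixes Y :: "('k::{real_normed_field, euclidean_space}, 'y) nspace"
  assumes bY: "banach_space Y" and D: "D \<subseteq> carrier Y" "\<And>d. d \<in> D \<Longrightarrow> vnorm Y d \<le> 1"
    and net: "\<And>y. y \<in> carrier Y \<Longrightarrow> vnorm Y y \<le> 1 \<Longrightarrow> \<exists>d\<in>D. vdist Y y d \<le> 1 / 2"
  obtains T where "T \<in> bounded_operators (ell1 D) Y"
    "\<And>y. y \<in> carrier Y \<Longrightarrow> \<exists>f\<in>carrier (ell1 D). T f = y \<and> vnorm (ell1 D) f \<le> 2 * vnorm Y y"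
proof -
  let ?E = "ell1 D :: ('k, 'y \<Rightarrow> 'k) nspace"
  interpret Y: banach_space Y by fact
  interpret E: banach_space ?E by (rule ell1_banach)
  have nY: "normed_vspace Y" ..
  obtain T where T: "T \<in> bounded_operators ?E Y" "\<And>d. d \<in> D \<Longrightarrow> T (unit_vec d) = d"
    by (rule ell1_extension[OF bY zero_le_one, of D "\<lambda>d. d"]) (use D in auto)
  have approx: "\<exists>f\<in>carrier ?E. vnorm ?E f \<le> 1 * vnorm Y y \<and> vnorm Y (y \<ominus>\<^bsub>Y\<^esub> T f) \<le> vnorm Y y / 2"
    if y: "y \<in> carrier Y" for y
  proof (cases "vnorm Y y = 0")
    case True
    then have "y = \<zero>\<^bsub>Y\<^esub>" using y by (simp add: Y.vnorm_eq_zero)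
    then have "y \<ominus>\<^bsub>Y\<^esub> T \<zero>\<^bsub>?E\<^esub> = \<zero>\<^bsub>Y\<^esub>"
      by (simp add: bop_zero[OF ell1_normed nY T(1)] Y.diff_zero del: ell1_simps)
    then show ?thesis
      by (intro bexI[of _ "\<zero>\<^bsub>?E\<^esub>"]) (simp_all add: True E.vnorm_zero del: ell1_simps)
  next
    case False
    define n where "n = vnorm Y y"
    have n: "n > 0" using False Y.vnorm_nonneg[OF y] by (simp add: n_def)
    let ?c = "of_real n :: 'k"
    have u: "inverse ?c \<odot>\<^bsub>Y\<^esub> y \<in> carrier Y" using y by simp
    have "vnorm Y (inverse ?c \<odot>\<^bsub>Y\<^esub> y) = 1"
      using n by (simp add: Y.vnorm_smult[OF y] norm_inverse n_def)
    then obtain d where d: "d \<in> D" "vdist Y (inverse ?c \<odot>\<^bsub>Y\<^esub> y) d \<le> 1 / 2"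
      using net[OF u] by auto
    have dc: "d \<in> carrier Y" using d D by auto
    let ?f = "?c \<odot>\<^bsub>?E\<^esub> unit_vec d"
    have f: "?f \<in> carrier ?E" using E.smult_carrier[OF unit_vec_carrier[OF d(1)]] .
    have "vnorm ?E ?f = n"
      using E.vnorm_smult[OF unit_vec_carrier[OF d(1)], of ?c] vnorm_unit_vec[OF d(1), where 'k = 'k] n
      by (simp del: ell1_simps)
    moreover have "vnorm Y (y \<ominus>\<^bsub>Y\<^esub> T ?f) \<le> n / 2"
    proof -
      have Tf: "T ?f = ?c \<odot>\<^bsub>Y\<^esub> d"
        using bop_smult[OF T(1) unit_vec_carrier[OF d(1)]] T(2)[OF d(1)] by simp
      have "?c \<odot>\<^bsub>Y\<^esub> (inverse ?c \<odot>\<^bsub>Y\<^esub> y) = y"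
        using n y by (simp add: Y.smult_smult)
      then have "vdist Y y (?c \<odot>\<^bsub>Y\<^esub> d) = n * vdist Y (inverse ?c \<odot>\<^bsub>Y\<^esub> y) d"
        using Y.vdist_smult[OF u dc, of ?c] n by simp
      also have "\<dots> \<le> n * (1 / 2)" using d(2) n by (intro mult_left_mono) auto
      finally show ?thesis using y dc unfolding Tf by (simp add: Y.vdist_eq)
    qed
    ultimately show ?thesis using f by (intro bexI[of _ ?f]) (auto simp: n_def)
  qed
  show ?thesis
    by (rule that[OF T(1)])
      (use approx_surjective_imp_surjective[OF ell1_banach nY T(1) zero_le_one approx] in simp)
qed

lemma aqlp_net_retract:
  fixes Y :: "('k::{real_normed_field, euclidean_space}, 'y) nspace"
  assumes bY: "banach_space Y" and aqlp: "aqlp TYPE('u + ('y \<Rightarrow> 'k)) Y"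
    and D: "D \<subseteq> carrier Y" "\<And>d. d \<in> D \<Longrightarrow> vnorm Y d \<le> 1"
    and net: "\<And>y. y \<in> carrier Y \<Longrightarrow> vnorm Y y \<le> 1 \<Longrightarrow> \<exists>d\<in>D. vdist Y y d \<le> 1 / 2"
  shows "retract Y (ell1 D)"
proof -
  let ?E = "ell1 D :: ('k, 'y \<Rightarrow> 'k) nspace"
  let ?h = "Inr :: ('y \<Rightarrow> 'k) \<Rightarrow> 'u + ('y \<Rightarrow> 'k)"
  let ?X = "copy_space ?h ?E"
  interpret Y: banach_space Y by fact
  have nY: "normed_vspace Y" ..
  have bX: "banach_space ?X" by (rule copy_space_banach[OF ell1_banach]) simp
  then have nX: "normed_vspace ?X" by (rule banach_space.axioms)
  note h = copy_space_operators[of ?h ?E, OF inj_Inr]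
  obtain T where T: "T \<in> bounded_operators ?E Y"
    "\<And>y. y \<in> carrier Y \<Longrightarrow> \<exists>f\<in>carrier ?E. T f = y \<and> vnorm ?E f \<le> 2 * vnorm Y y"
    using net_imp_surjection[OF bY D net] by metis
  have "retract Y ?X"
  proof (rule aqlp_right_inverse[OF aqlp nY bX])
    show "(\<lambda>x. T (inv_into UNIV ?h x)) \<in> bounded_operators ?X Y"
      by (rule bop_compose[OF nX ell1_normed h(2) T(1)])
    fix y assume "y \<in> carrier Y"
    then obtain f where "f \<in> carrier ?E" "T f = y" "vnorm ?E f \<le> 2 * vnorm Y y"
      using T(2) by blast
    then show "\<exists>x\<in>carrier ?X. T (inv_into UNIV ?h x) = y \<and> vnorm ?X x \<le> 2 * vnorm Y y"
      by (intro bexI[of _ "?h f"]) (auto simp: copy_space_def)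
  qed
  moreover have "retract ?X ?E"
    unfolding retract_def
    by (rule bexI[OF _ h(2)], rule bexI[OF _ h(1)]) (auto simp: copy_space_def)
  ultimately show ?thesis
    by (intro retract_trans[OF nY nX ell1_normed])
qed

section \<open>The decomposition method\<close>

text \<open>
  From here on the vectors of \<open>\<ell>\<^sub>1\<close> are handled by the laws of normed spaces, which do not match
  once the operations are unfolded to pointwise ones.
\<close>

declare ell1_simps [simp del]

lemma bop_const_zero:
  assumes "normed_vspace V" "normed_vspace W"
  shows "(\<lambda>_. \<zero>\<^bsub>W\<^esub>) \<in> bounded_operators V W"
proof -
  interpret V: normed_vspace V by fact
  interpret W: normed_vspace W by fact
  show ?thesis
    by (rule bounded_operatorsI[where C = 0]) auto
qed

text \<open>
  \<open>X\<close> is the direct sum of \<open>U\<close> and \<open>W\<close>, with injections \<open>j\<close>, \<open>k\<close> and projections \<open>p\<close>, \<open>q\<close>. The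
  equations describe \<open>X\<close> up to isomorphism (\<open>splits_isomorphic\<close>), which makes the relation a substitute
  for the product space.
\<close>

definition splits ::
    "('k, 'x) nspace \<Rightarrow> ('k, 'u) nspace \<Rightarrow> ('k, 'w) nspace \<Rightarrow> bool" where
  "splits X U W \<longleftrightarrow>
     (\<exists>j\<in>bounded_operators U X. \<exists>p\<in>bounded_operators X U.
      \<exists>k\<in>bounded_operators W X. \<exists>q\<in>bounded_operators X W.
        (\<forall>u\<in>carrier U. p (j u) = u \<and> q (j u) = \<zero>\<^bsub>W\<^esub>) \<and>
        (\<forall>w\<in>carrier W. q (k w) = w \<and> p (k w) = \<zero>\<^bsub>U\<^esub>) \<and>
        (\<forall>x\<in>carrier X. j (p x) \<oplus>\<^bsub>X\<^esub> k (q x) = x))"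

lemma splits_swap:
  assumes "normed_vspace X" "splits X U W"
  shows "splits X W U"
proof -
  interpret X: normed_vspace X by fact
  obtain j p k q where ops: "j \<in> bounded_operators U X" "p \<in> bounded_operators X U"
      "k \<in> bounded_operators W X" "q \<in> bounded_operators X W"
    and eqs: "\<forall>u\<in>carrier U. p (j u) = u \<and> q (j u) = \<zero>\<^bsub>W\<^esub>"
      "\<forall>w\<in>carrier W. q (k w) = w \<and> p (k w) = \<zero>\<^bsub>U\<^esub>"
      "\<forall>x\<in>carrier X. j (p x) \<oplus>\<^bsub>X\<^esub> k (q x) = x"
    using assms(2) unfolding splits_def by blast
  have "k (q x) \<oplus>\<^bsub>X\<^esub> j (p x) = x" if x: "x \<in> carrier X" for x
    using X.M.a_comm[OF bop_closed[OF ops(3) bop_closed[OF ops(4) x]]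
        bop_closed[OF ops(1) bop_closed[OF ops(2) x]]] eqs(3) x by simp
  then show ?thesis
    unfolding splits_def using ops eqs(1,2) by blast
qed

lemma splits_isomorphic:
  assumes nX: "normed_vspace X" and nX': "normed_vspace X'" and nU: "normed_vspace U" and nW: "normed_vspace W"
    and "splits X U W" "splits X' U W"
  shows "isomorphic X X'"
proof -
  interpret U: normed_vspace U by fact
  interpret W: normed_vspace W by fact
  obtain j p k q where ops: "j \<in> bounded_operators U X" "p \<in> bounded_operators X U"
      "k \<in> bounded_operators W X" "q \<in> bounded_operators X W"
    and eqs: "\<And>u. u \<in> carrier U \<Longrightarrow> p (j u) = u \<and> q (j u) = \<zero>\<^bsub>W\<^esub>"
      "\<And>w. w \<in> carrier W \<Longrightarrow> q (k w) = w \<and> p (k w) = \<zero>\<^bsub>U\<^esub>"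
      "\<And>x. x \<in> carrier X \<Longrightarrow> j (p x) \<oplus>\<^bsub>X\<^esub> k (q x) = x"
    using assms(5) unfolding splits_def by blast
  obtain j' p' k' q' where ops': "j' \<in> bounded_operators U X'" "p' \<in> bounded_operators X' U"
      "k' \<in> bounded_operators W X'" "q' \<in> bounded_operators X' W"
    and eqs': "\<And>u. u \<in> carrier U \<Longrightarrow> p' (j' u) = u \<and> q' (j' u) = \<zero>\<^bsub>W\<^esub>"
      "\<And>w. w \<in> carrier W \<Longrightarrow> q' (k' w) = w \<and> p' (k' w) = \<zero>\<^bsub>U\<^esub>"
      "\<And>x. x \<in> carrier X' \<Longrightarrow> j' (p' x) \<oplus>\<^bsub>X'\<^esub> k' (q' x) = x"
    using assms(6) unfolding splits_def by blast
  note closed = ops[THEN bop_closed] ops'[THEN bop_closed]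
  have T: "(\<lambda>x. j' (p x) \<oplus>\<^bsub>X'\<^esub> k' (q x)) \<in> bounded_operators X X'"
    by (intro bop_plus bop_compose[of X U p j'] bop_compose[of X W q k'] nX nX' nU nW ops ops')
  have S: "(\<lambda>x. j (p' x) \<oplus>\<^bsub>X\<^esub> k (q' x)) \<in> bounded_operators X' X"
    by (intro bop_plus bop_compose[of X' U p' j] bop_compose[of X' W q' k] nX nX' nU nW ops ops')
  show ?thesis
    unfolding isomorphic_iff[OF nX nX']
  proof (rule bexI[OF _ T], rule bexI[OF _ S], intro conjI ballI)
    fix x assume x: "x \<in> carrier X"
    show "j (p' (j' (p x) \<oplus>\<^bsub>X'\<^esub> k' (q x))) \<oplus>\<^bsub>X\<^esub> k (q' (j' (p x) \<oplus>\<^bsub>X'\<^esub> k' (q x))) = x"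
      using x by (simp add: closed bop_add[OF ops'(2)] bop_add[OF ops'(4)] eqs' eqs)
  next
    fix x assume x: "x \<in> carrier X'"
    show "j' (p (j (p' x) \<oplus>\<^bsub>X\<^esub> k (q' x))) \<oplus>\<^bsub>X'\<^esub> k' (q (j (p' x) \<oplus>\<^bsub>X\<^esub> k (q' x))) = x"
      using x by (simp add: closed bop_add[OF ops(2)] bop_add[OF ops(4)] eqs' eqs)
  qed
qed

text \<open>
  If \<open>F\<close> absorbs \<open>U\<close>, then so does every space that contains \<open>F\<close> as a complemented subspace: the
  complement of \<open>F\<close>, onto which \<open>e\<close> projects, is left alone and \<open>U\<close> is absorbed by the part in \<open>F\<close>.
\<close>

lemma splits_retract:
  assumes nF: "normed_vspace F" and nU: "normed_vspace U" and nY: "normed_vspace Y"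
    and "splits F U F" "retract F Y"
  shows "splits Y U Y"
proof -
  interpret F: normed_vspace F by fact
  interpret U: normed_vspace U by fact
  interpret Y: normed_vspace Y by fact
  obtain j p k q where ops: "j \<in> bounded_operators U F" "p \<in> bounded_operators F U"
      "k \<in> bounded_operators F F" "q \<in> bounded_operators F F"
    and eqs: "\<And>u. u \<in> carrier U \<Longrightarrow> p (j u) = u \<and> q (j u) = \<zero>\<^bsub>F\<^esub>"
      "\<And>w. w \<in> carrier F \<Longrightarrow> q (k w) = w \<and> p (k w) = \<zero>\<^bsub>U\<^esub>"
      "\<And>x. x \<in> carrier F \<Longrightarrow> j (p x) \<oplus>\<^bsub>F\<^esub> k (q x) = x"
    using assms(4) unfolding splits_def by blast
  obtain i r where i: "i \<in> bounded_operators F Y" and r: "r \<in> bounded_operators Y F"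
    and ri: "\<And>f. f \<in> carrier F \<Longrightarrow> r (i f) = f"
    using assms(5) unfolding retract_def by blast
  define e where "e y = y \<ominus>\<^bsub>Y\<^esub> i (r y)" for y
  have ir: "(\<lambda>y. i (r y)) \<in> bounded_operators Y Y"
    by (rule bop_compose[OF nY nF r i])
  have e: "e \<in> bounded_operators Y Y"
    unfolding e_def[abs_def] by (rule bop_minus[OF nY nY bop_id ir])
  note closed = ops[THEN bop_closed] i[THEN bop_closed] r[THEN bop_closed] e[THEN bop_closed]
  note add = bop_add[OF i] bop_add[OF r] bop_add[OF e] bop_add[OF ops(1)] bop_add[OF ops(2)]
    bop_add[OF ops(3)] bop_add[OF ops(4)]
  have re: "r (e y) = \<zero>\<^bsub>F\<^esub>" if "y \<in> carrier Y" for y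
    using that by (simp add: e_def bop_diff[OF nY nF r] closed ri F.diff_self)
  have ei: "e (i f) = \<zero>\<^bsub>Y\<^esub>" if "f \<in> carrier F" for f
    using that by (simp add: e_def closed ri Y.diff_self)
  have ee: "e (e y) = e y" if "y \<in> carrier Y" for y
    unfolding e_def[of "e y"] using that
    by (simp add: re bop_zero[OF nF nY i] closed Y.diff_zero)
  have sum: "e y \<oplus>\<^bsub>Y\<^esub> i (r y) = y" if "y \<in> carrier Y" for y
    using Y.add_diff_cancel[of y "i (r y)"] that closed
    by (simp add: Y.M.a_comm[of "e y"]) (simp add: e_def)
  define k' where "k' y = e y \<oplus>\<^bsub>Y\<^esub> i (k (r y))" for y
  define q' where "q' y = e y \<oplus>\<^bsub>Y\<^esub> i (q (r y))" for y
  have k': "k' \<in> bounded_operators Y Y"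
    unfolding k'_def[abs_def]
    by (rule bop_plus[OF nY nY e bop_compose[OF nY nF bop_compose[OF nY nF r ops(3)] i]])
  have q': "q' \<in> bounded_operators Y Y"
    unfolding q'_def[abs_def]
    by (rule bop_plus[OF nY nY e bop_compose[OF nY nF bop_compose[OF nY nF r ops(4)] i]])
  have ek: "e (k' y) = e y" "r (k' y) = k (r y)" and eq: "e (q' y) = e y" "r (q' y) = q (r y)"
    if "y \<in> carrier Y" for y
    using that by (simp_all add: k'_def q'_def closed add ee ei re ri)
  have j': "(\<lambda>u. i (j u)) \<in> bounded_operators U Y" by (rule bop_compose[OF nU nF ops(1) i])
  have p': "(\<lambda>y. p (r y)) \<in> bounded_operators Y U" by (rule bop_compose[OF nY nF r ops(2)])
  show ?thesis
    unfolding splits_def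
  proof (rule bexI[OF _ j'], rule bexI[OF _ p'], rule bexI[OF _ k'], rule bexI[OF _ q'],
      intro conjI ballI)
    fix u assume u: "u \<in> carrier U"
    show "p (r (i (j u))) = u" using u by (simp add: closed ri eqs)
    show "q' (i (j u)) = \<zero>\<^bsub>Y\<^esub>"
      using u by (simp add: q'_def closed ei ri eqs bop_zero[OF nF nY i])
  next
    fix y assume y: "y \<in> carrier Y"
    show "q' (k' y) = y"
      unfolding q'_def[of "k' y"] using y by (simp add: ek closed eqs sum)
    show "p (r (k' y)) = \<zero>\<^bsub>U\<^esub>" using y by (simp add: ek closed eqs)
    have "i (j (p (r y))) \<oplus>\<^bsub>Y\<^esub> k' (q' y) = e y \<oplus>\<^bsub>Y\<^esub> i (j (p (r y)) \<oplus>\<^bsub>F\<^esub> k (q (r y)))"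
      unfolding k'_def[of "q' y"] using y by (simp add: eq closed add Y.M.a_lcomm)
    then show "i (j (p (r y))) \<oplus>\<^bsub>Y\<^esub> k' (q' y) = y"
      using y by (simp add: eqs closed sum)
  qed
qed

text \<open>
  An infinite swindle. Think of \<open>\<ell>\<^sub>1(\<nat> \<times> D)\<close> as a sequence of copies of \<open>\<ell>\<^sub>1(D)\<close>, each of which is
  the direct sum of a copy of \<open>U\<close> (the range of \<open>P\<close>) and a complement (the range of \<open>Q\<close>). Shifting
  the copies of \<open>U\<close> by one place, and leaving the complements where they are, makes room for one
  more copy of \<open>U\<close>. All operators are defined by their values at unit vectors, and all equations
  between them need to be checked only there.
\<close>

lemma ell1_shift_splits:
  fixes U :: "('k::{real_normed_field, euclidean_space}, 'u) nspace" and D :: "'g set"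
  assumes bU: "banach_space U" and "retract U (ell1 D)"
  shows "splits (ell1 (UNIV \<times> D :: (nat \<times> 'g) set)) U (ell1 (UNIV \<times> D :: (nat \<times> 'g) set))"
proof -
  let ?E = "ell1 D :: ('k, 'g \<Rightarrow> 'k) nspace"
  let ?F = "ell1 (UNIV \<times> D) :: ('k, nat \<times> 'g \<Rightarrow> 'k) nspace"
  interpret U: banach_space U by fact
  interpret E: banach_space ?E by (rule ell1_banach)
  interpret F: banach_space ?F by (rule ell1_banach)
  have nU: "normed_vspace U" ..
  note nE = ell1_normed[of D, where 'k = 'k]
  note nF = ell1_normed[of "UNIV \<times> D :: (nat \<times> 'g) set", where 'k = 'k]
  note bF = ell1_banach[of "UNIV \<times> D :: (nat \<times> 'g) set", where 'k = 'k]
  obtain i r where i: "i \<in> bounded_operators U ?E" and r: "r \<in> bounded_operators ?E U"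
    and ri: "\<And>u. u \<in> carrier U \<Longrightarrow> r (i u) = u"
    using assms(2) unfolding retract_def by blast
  define P where "P f = i (r f)" for f
  define Q where "Q f = f \<ominus>\<^bsub>?E\<^esub> P f" for f
  have P: "P \<in> bounded_operators ?E ?E"
    unfolding P_def[abs_def] by (rule bop_compose[OF nE nU r i])
  have Q: "Q \<in> bounded_operators ?E ?E"
    unfolding Q_def[abs_def] by (rule bop_minus[OF nE nE bop_id P])
  note closed0 = i[THEN bop_closed] r[THEN bop_closed] P[THEN bop_closed] Q[THEN bop_closed]
  have PP: "P (P f) = P f" and PQ: "P (Q f) = \<zero>\<^bsub>?E\<^esub>" and QP: "Q (P f) = \<zero>\<^bsub>?E\<^esub>"
    and rQ: "r (Q f) = \<zero>\<^bsub>U\<^esub>" and rP: "r (P f) = r f"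
    and PQsum: "P f \<oplus>\<^bsub>?E\<^esub> Q f = f"
    if f: "f \<in> carrier ?E" for f
  proof -
    show rP: "r (P f) = r f" and PP: "P (P f) = P f" using f by (simp_all add: P_def closed0 ri)
    show rQ: "r (Q f) = \<zero>\<^bsub>U\<^esub>"
      using f by (simp add: Q_def bop_diff[OF nE nU r] closed0 rP U.diff_self)
    show "P (Q f) = \<zero>\<^bsub>?E\<^esub>" by (simp add: P_def rQ bop_zero[OF nU nE i])
    show "Q (P f) = \<zero>\<^bsub>?E\<^esub>" using f by (simp add: Q_def[of "P f"] PP closed0 E.diff_self)
    show "P f \<oplus>\<^bsub>?E\<^esub> Q f = f" using f by (simp add: Q_def closed0 E.add_diff_cancel)
  qed
  have QQ: "Q (Q f) = Q f" if f: "f \<in> carrier ?E" for f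
    using PQsum[of "Q f"] f by (simp add: closed0 PQ)
  have Qi: "Q (i u) = \<zero>\<^bsub>?E\<^esub>" if "u \<in> carrier U" for u
    using QP[of "i u"] that by (simp add: P_def closed0 ri)
  obtain cr where cr: "cr > 0" "\<And>f. f \<in> carrier ?E \<Longrightarrow> vnorm U (r f) \<le> cr * vnorm ?E f"
    using bop_bound[OF nE r] by blast
  obtain cP where cP: "cP > 0" "\<And>f. f \<in> carrier ?E \<Longrightarrow> vnorm ?E (P f) \<le> cP * vnorm ?E f"
    using bop_bound[OF nE P] by blast
  obtain cQ where cQ: "cQ > 0" "\<And>f. f \<in> carrier ?E \<Longrightarrow> vnorm ?E (Q f) \<le> cQ * vnorm ?E f"
    using bop_bound[OF nE Q] by blast
  have nunit: "vnorm ?E (unit_vec d) = 1" if "d \<in> D" for d using vnorm_unit_vec[OF that] .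
  have "\<exists>T. T \<in> bounded_operators ?E ?F \<and> (\<forall>d\<in>D. T (unit_vec d) = unit_vec (n, d)) \<and>
      (\<forall>f\<in>carrier ?E. vnorm ?F (T f) \<le> 1 * vnorm ?E f)" for n
    by (rule ell1_extension[OF bF zero_le_one, of D "\<lambda>d. unit_vec (n, d)"])
      (auto simp: vnorm_unit_vec)
  \<comment> \<open>\<open>\<iota> n\<close> is the inclusion of the \<open>n\<close>-th copy of \<open>\<ell>\<^sub>1(D)\<close>.\<close>
  then obtain \<iota> where \<iota>: "\<And>n. \<iota> n \<in> bounded_operators ?E ?F"
    and \<iota>u: "\<And>n d. d \<in> D \<Longrightarrow> \<iota> n (unit_vec d) = unit_vec (n, d)"
    and \<iota>n: "\<And>n f. f \<in> carrier ?E \<Longrightarrow> vnorm ?F (\<iota> n f) \<le> vnorm ?E f"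
    unfolding mult_1 by metis
  note closed = closed0 \<iota>[THEN bop_closed]
  note \<iota>0 = bop_zero[OF nE nF \<iota>]
  have bP: "vnorm ?F (\<iota> n (P (unit_vec d))) \<le> cP" and bQ: "vnorm ?F (\<iota> n (Q (unit_vec d))) \<le> cQ"
    if "d \<in> D" for n d
    using that \<iota>n[of "P (unit_vec d)" n] \<iota>n[of "Q (unit_vec d)" n] cP(2)[of "unit_vec d"] cQ(2)[of "unit_vec d"]
    by (simp_all add: closed nunit)
  have "\<exists>p. p \<in> bounded_operators ?F U \<and>
      (\<forall>n. \<forall>d\<in>D. p (unit_vec (n, d)) = (if n = 0 then r (unit_vec d) else \<zero>\<^bsub>U\<^esub>))"
    by (rule ell1_extension[OF bU less_imp_le[OF cr(1)], of "UNIV \<times> D"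
          "\<lambda>(n, d). if n = 0 then r (unit_vec d) else \<zero>\<^bsub>U\<^esub>"])
      (use cr(1) cr(2)[OF unit_vec_carrier] in \<open>auto simp: closed nunit\<close>)
  then obtain p where p: "p \<in> bounded_operators ?F U"
    and pu: "\<And>n d. d \<in> D \<Longrightarrow> p (unit_vec (n, d)) = (if n = 0 then r (unit_vec d) else \<zero>\<^bsub>U\<^esub>)" by blast
  have bPQ: "vnorm ?F (\<iota> m (P (unit_vec d)) \<oplus>\<^bsub>?F\<^esub> \<iota> n (Q (unit_vec d))) \<le> cP + cQ" if "d \<in> D" for m n d
    using F.vnorm_triangle[of "\<iota> m (P (unit_vec d))" "\<iota> n (Q (unit_vec d))"] bP[OF that, of m] bQ[OF that, of n] that
    by (simp add: closed)
  have "\<exists>k. k \<in> bounded_operators ?F ?F \<and>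
      (\<forall>n. \<forall>d\<in>D. k (unit_vec (n, d)) = \<iota> (Suc n) (P (unit_vec d)) \<oplus>\<^bsub>?F\<^esub> \<iota> n (Q (unit_vec d)))"
    by (rule ell1_extension[OF bF, of "cP + cQ" "UNIV \<times> D"
          "\<lambda>(n, d). \<iota> (Suc n) (P (unit_vec d)) \<oplus>\<^bsub>?F\<^esub> \<iota> n (Q (unit_vec d))"])
      (use cP(1) cQ(1) in \<open>auto simp: closed bPQ\<close>)
  \<comment> \<open>\<open>k\<close> is the shift to the right and \<open>q\<close>, below, the shift to the left; \<open>p\<close> reads off the copy
    of \<open>U\<close> at place 0, which \<open>q\<close> drops.\<close>
  then obtain k where k: "k \<in> bounded_operators ?F ?F"
    and ku: "\<And>n d. d \<in> D \<Longrightarrow>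
      k (unit_vec (n, d)) = \<iota> (Suc n) (P (unit_vec d)) \<oplus>\<^bsub>?F\<^esub> \<iota> n (Q (unit_vec d))" by blast
  have bQ': "vnorm ?F (\<iota> n (Q (unit_vec d))) \<le> cP + cQ" if "d \<in> D" for n d
    using bQ[OF that, of n] cP(1) by linarith
  have "\<exists>q. q \<in> bounded_operators ?F ?F \<and>
      (\<forall>n. \<forall>d\<in>D. q (unit_vec (n, d)) =
        (case n of 0 \<Rightarrow> \<iota> 0 (Q (unit_vec d)) | Suc m \<Rightarrow> \<iota> m (P (unit_vec d)) \<oplus>\<^bsub>?F\<^esub> \<iota> n (Q (unit_vec d))))"
    by (rule ell1_extension[OF bF, of "cP + cQ" "UNIV \<times> D"
          "\<lambda>(n, d). case n of 0 \<Rightarrow> \<iota> 0 (Q (unit_vec d)) | Suc m \<Rightarrow> \<iota> m (P (unit_vec d)) \<oplus>\<^bsub>?F\<^esub> \<iota> n (Q (unit_vec d))"])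
      (use cP(1) cQ(1) in \<open>auto simp: closed bPQ bQ' split: nat.split\<close>)
  then obtain q where q: "q \<in> bounded_operators ?F ?F"
    and qu0: "\<And>d. d \<in> D \<Longrightarrow> q (unit_vec (0, d)) = \<iota> 0 (Q (unit_vec d))"
    and quS: "\<And>m d. d \<in> D \<Longrightarrow>
      q (unit_vec (Suc m, d)) = \<iota> m (P (unit_vec d)) \<oplus>\<^bsub>?F\<^esub> \<iota> (Suc m) (Q (unit_vec d))"
    by (metis (no_types, lifting) nat.case)
  note pq_closed = p[THEN bop_closed] k[THEN bop_closed] q[THEN bop_closed]
  have p0: "p (\<iota> 0 f) = r f" and pS: "p (\<iota> (Suc n) f) = \<zero>\<^bsub>U\<^esub>"
    and k\<iota>: "k (\<iota> n f) = \<iota> (Suc n) (P f) \<oplus>\<^bsub>?F\<^esub> \<iota> n (Q f)"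
    and q0: "q (\<iota> 0 f) = \<iota> 0 (Q f)"
    and qS: "q (\<iota> (Suc n) f) = \<iota> n (P f) \<oplus>\<^bsub>?F\<^esub> \<iota> (Suc n) (Q f)"
    if f: "f \<in> carrier ?E" for f n
  proof -
    have P\<iota>: "(\<lambda>f. \<iota> m (P f)) \<in> bounded_operators ?E ?F" and Q\<iota>: "(\<lambda>f. \<iota> m (Q f)) \<in> bounded_operators ?E ?F" for m
      by (rule bop_compose[OF nE nE P \<iota>], rule bop_compose[OF nE nE Q \<iota>])
    show "p (\<iota> 0 f) = r f"
      by (rule ell1_operator_eqI[OF nU bop_compose[OF nE nF \<iota> p] r _ f]) (simp add: \<iota>u pu)
    show "p (\<iota> (Suc n) f) = \<zero>\<^bsub>U\<^esub>"
      by (rule ell1_operator_eqI[OF nU bop_compose[OF nE nF \<iota> p] bop_const_zero[OF nE nU] _ f])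
        (simp add: \<iota>u pu)
    show "k (\<iota> n f) = \<iota> (Suc n) (P f) \<oplus>\<^bsub>?F\<^esub> \<iota> n (Q f)"
      by (rule ell1_operator_eqI[OF nF bop_compose[OF nE nF \<iota> k] bop_plus[OF nE nF P\<iota> Q\<iota>] _ f])
        (simp add: \<iota>u ku)
    show "q (\<iota> 0 f) = \<iota> 0 (Q f)"
      by (rule ell1_operator_eqI[OF nF bop_compose[OF nE nF \<iota> q] Q\<iota> _ f]) (simp add: \<iota>u qu0)
    show "q (\<iota> (Suc n) f) = \<iota> n (P f) \<oplus>\<^bsub>?F\<^esub> \<iota> (Suc n) (Q f)"
      by (rule ell1_operator_eqI[OF nF bop_compose[OF nE nF \<iota> q] bop_plus[OF nE nF P\<iota> Q\<iota>] _ f])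
        (simp add: \<iota>u quS)
  qed
  note add = p[THEN bop_add] k[THEN bop_add] q[THEN bop_add]
  note rules = p0 pS k\<iota> q0 qS PP PQ QP QQ rQ Qi \<iota>0 closed pq_closed add
  have merge: "\<iota> n (P f) \<oplus>\<^bsub>?F\<^esub> \<iota> n (Q f) = \<iota> n f" if f: "f \<in> carrier ?E" for n f
    using bop_add[OF \<iota>, of "P f" "Q f" n] f by (simp add: closed PQsum)
  have j: "(\<lambda>u. \<iota> 0 (i u)) \<in> bounded_operators U ?F" by (rule bop_compose[OF nU nE i \<iota>])
  show ?thesis
    unfolding splits_def
  proof (rule bexI[OF _ j], rule bexI[OF _ p], rule bexI[OF _ k], rule bexI[OF _ q],
      intro conjI ballI)
    fix u assume u: "u \<in> carrier U"
    then show "p (\<iota> 0 (i u)) = u" "q (\<iota> 0 (i u)) = \<zero>\<^bsub>?F\<^esub>"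
      by (simp_all add: rules ri)
  next
    fix f assume f: "f \<in> carrier ?F"
    have uni: "g \<in> UNIV \<times> D \<Longrightarrow> \<exists>n d. unit_vec g = \<iota> n (unit_vec d) \<and> d \<in> D" for g :: "nat \<times> 'g"
      by (cases g) (auto simp: \<iota>u intro!: exI)
    show "q (k f) = f"
    proof (rule ell1_operator_eqI[OF nF bop_compose[OF nF nF k q] bop_id _ f])
      fix g :: "nat \<times> 'g" assume "g \<in> UNIV \<times> D"
      then obtain n d where g: "unit_vec g = \<iota> n (unit_vec d)" "d \<in> D" using uni by blast
      show "q (k (unit_vec g)) = unit_vec g"
        unfolding g(1) using g(2) by (cases n) (simp_all add: rules merge)
    qed
    show "p (k f) = \<zero>\<^bsub>U\<^esub>"
    proof (rule ell1_operator_eqI[OF nU bop_compose[OF nF nF k p] bop_const_zero[OF nF nU] _ f])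
      fix g :: "nat \<times> 'g" assume "g \<in> UNIV \<times> D"
      then obtain n d where g: "unit_vec g = \<iota> n (unit_vec d)" "d \<in> D" using uni by blast
      show "p (k (unit_vec g)) = \<zero>\<^bsub>U\<^esub>"
        unfolding g(1) using g(2) by (cases n) (simp_all add: rules)
    qed
    show "\<iota> 0 (i (p f)) \<oplus>\<^bsub>?F\<^esub> k (q f) = f"
    proof (rule ell1_operator_eqI[OF nF bop_plus[OF nF nF bop_compose[OF nF nU p j] bop_compose[OF nF nF q k]] bop_id _ f])
      fix g :: "nat \<times> 'g" assume "g \<in> UNIV \<times> D"
      then obtain n d where g: "unit_vec g = \<iota> n (unit_vec d)" "d \<in> D" using uni by blast
      show "\<iota> 0 (i (p (unit_vec g))) \<oplus>\<^bsub>?F\<^esub> k (q (unit_vec g)) = unit_vec g"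
      proof (cases n)
        case 0
        then show ?thesis
          unfolding g(1) using g(2) merge[of "unit_vec d" 0] by (simp add: rules flip: P_def)
      next
        case (Suc m)
        then show ?thesis
          unfolding g(1) using g(2) by (simp add: rules merge bop_zero[OF nU nE i])
      qed
    qed
  qed
qed

lemma ell1_reindex:
  fixes h :: "'a \<Rightarrow> 'b"
  assumes h: "inj_on h A" "h ` A \<subseteq> B"
  obtains T S where "T \<in> bounded_operators (ell1 A :: ('k::{real_normed_field, euclidean_space}, 'a \<Rightarrow> 'k) nspace) (ell1 B)"
    and "S \<in> bounded_operators (ell1 B) (ell1 A)"
    and "\<And>f. f \<in> carrier (ell1 A) \<Longrightarrow> S (T f) = f"
    and "\<And>f. h ` A = B \<Longrightarrow> f \<in> carrier (ell1 B) \<Longrightarrow> T (S f) = f"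
proof -
  let ?A = "ell1 A :: ('k, 'a \<Rightarrow> 'k) nspace" and ?B = "ell1 B :: ('k, 'b \<Rightarrow> 'k) nspace"
  interpret A: banach_space ?A by (rule ell1_banach)
  note nA = ell1_normed[of A, where 'k = 'k] and nB = ell1_normed[of B, where 'k = 'k]
  have "\<exists>T. T \<in> bounded_operators ?A ?B \<and> (\<forall>a\<in>A. T (unit_vec a) = unit_vec (h a))"
    by (rule ell1_extension[OF ell1_banach zero_le_one, of A "\<lambda>a. unit_vec (h a)" B])
      (use h in \<open>auto simp: vnorm_unit_vec image_subset_iff\<close>)
  then obtain T where T: "T \<in> bounded_operators ?A ?B" "\<And>a. a \<in> A \<Longrightarrow> T (unit_vec a) = unit_vec (h a)" by blast
  have "\<exists>S. S \<in> bounded_operators ?B ?A \<and>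
      (\<forall>b\<in>B. S (unit_vec b) = (if b \<in> h ` A then unit_vec (inv_into A h b) else \<zero>\<^bsub>?A\<^esub>))"
    by (rule ell1_extension[OF ell1_banach zero_le_one, of B
          "\<lambda>b. if b \<in> h ` A then unit_vec (inv_into A h b) else \<zero>\<^bsub>?A\<^esub>" A])
      (auto simp: vnorm_unit_vec inv_into_into)
  then obtain S where S: "S \<in> bounded_operators ?B ?A"
    "\<And>b. b \<in> B \<Longrightarrow> S (unit_vec b) = (if b \<in> h ` A then unit_vec (inv_into A h b) else \<zero>\<^bsub>?A\<^esub>)" by blast
  show ?thesis
  proof (rule that[OF T(1) S(1)])
    show "S (T f) = f" if "f \<in> carrier ?A" for f
      by (rule ell1_operator_eqI[OF nA bop_compose[OF nA nB T(1) S(1)] bop_id _ that])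
        (use h in \<open>auto simp: T(2) S(2) image_subset_iff\<close>)
    show "T (S f) = f" if "h ` A = B" "f \<in> carrier ?B" for f
      by (rule ell1_operator_eqI[OF nB bop_compose[OF nB nA S(1) T(1)] bop_id _ that(2)])
        (use h that(1) in \<open>auto simp: T(2) S(2)\<close>)
  qed
qed

lemma ell1_retract_reindex:
  fixes h :: "'a \<Rightarrow> 'b"
  assumes "inj_on h A" "h ` A \<subseteq> B"
  shows "retract (ell1 A :: ('k::{real_normed_field, euclidean_space}, 'a \<Rightarrow> 'k) nspace) (ell1 B)"
  by (rule ell1_reindex[OF assms, where 'k = 'k]) (auto simp: retract_def)

lemma ell1_isomorphic_image:
  fixes h :: "'a \<Rightarrow> 'b"
  assumes "inj_on h A"
  shows "isomorphic (ell1 A :: ('k::{real_normed_field, euclidean_space}, 'a \<Rightarrow> 'k) nspace) (ell1 (h ` A))"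
proof (rule ell1_reindex[OF assms subset_refl, where 'k = 'k])
  fix T S
  assume T: "T \<in> bounded_operators (ell1 A :: ('k, 'a \<Rightarrow> 'k) nspace) (ell1 (h ` A))"
    and S: "S \<in> bounded_operators (ell1 (h ` A)) (ell1 A)"
    and inv: "\<And>f. f \<in> carrier (ell1 A) \<Longrightarrow> S (T f) = f"
    "\<And>f. h ` A = h ` A \<Longrightarrow> f \<in> carrier (ell1 (h ` A)) \<Longrightarrow> T (S f) = f"
  show ?thesis
    unfolding isomorphic_iff[OF ell1_normed ell1_normed]
    by (rule bexI[OF _ T], rule bexI[OF _ S]) (simp add: inv)
qed

text \<open>
  With \<open>E = \<ell>\<^sub>1(D)\<close> and \<open>F = \<ell>\<^sub>1(\<nat> \<times> D)\<close>, the swindle shows that \<open>F\<close> absorbs both \<open>E\<close> and \<open>Y\<close>,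
  which are retracts of \<open>E\<close>. Now \<open>F\<close> is a retract of \<open>Y\<close>, so \<open>Y\<close> absorbs \<open>E\<close>, and \<open>F\<close> is a retract of \<open>E\<close>,
  so \<open>E\<close> absorbs \<open>Y\<close>. Hence both \<open>Y\<close> and \<open>E\<close> are isomorphic to the direct sum of \<open>E\<close> and \<open>Y\<close>.
\<close>

lemma isomorphic_ell1_of_mutual_retracts:
  fixes Y :: "('k::{real_normed_field, euclidean_space}, 'y) nspace"
    and D :: "'g set" and G :: "'h set" and h :: "nat \<times> 'g \<Rightarrow> 'h"
  assumes bY: "banach_space Y" and YE: "retract Y (ell1 D)" and GY: "retract (ell1 G) Y"
    and h: "inj_on h (UNIV \<times> D)" "h ` (UNIV \<times> D) \<subseteq> G"
  shows "isomorphic Y (ell1 D)"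
proof -
  let ?E = "ell1 D :: ('k, 'g \<Rightarrow> 'k) nspace"
  let ?F = "ell1 (UNIV \<times> D) :: ('k, nat \<times> 'g \<Rightarrow> 'k) nspace"
  interpret Y: banach_space Y by fact
  have nY: "normed_vspace Y" ..
  have FY: "retract ?F Y"
    by (rule retract_trans[OF ell1_normed ell1_normed nY ell1_retract_reindex[OF h] GY])
  have FE: "retract ?F ?E"
    by (rule retract_trans[OF ell1_normed nY ell1_normed FY YE])
  have EE: "retract ?E ?E"
    unfolding retract_def by (rule bexI[OF _ bop_id], rule bexI[OF _ bop_id]) simp
  have "splits Y ?E Y"
    by (rule splits_retract[OF ell1_normed ell1_normed nY ell1_shift_splits[OF ell1_banach EE] FY])
  moreover have "splits ?E ?E Y"
    by (rule splits_swap[OF ell1_normed splits_retract[OF ell1_normed nY ell1_normed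
            ell1_shift_splits[OF bY YE] FE]])
  ultimately show ?thesis
    by (intro splits_isomorphic[OF nY ell1_normed ell1_normed nY])
qed

section \<open>Cardinalities and maximal disjoint families\<close>

lemma lepoll_iff_card_of: "A \<lesssim> B \<longleftrightarrow> ordLeq3 (card_of A) (card_of B)"
  by (simp add: lepoll_def card_of_ordLeq)

lemma Times_lepoll_infinite: "infinite C \<Longrightarrow> A \<lesssim> C \<Longrightarrow> B \<lesssim> C \<Longrightarrow> A \<times> B \<lesssim> C"
  unfolding lepoll_iff_card_of by (rule card_of_Sigma_ordLeq_infinite) auto

lemma UN_lepoll_infinite:
  "infinite C \<Longrightarrow> I \<lesssim> C \<Longrightarrow> (\<And>i. i \<in> I \<Longrightarrow> A i \<lesssim> C) \<Longrightarrow> (\<Union>i\<in>I. A i) \<lesssim> C"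
  unfolding lepoll_iff_card_of by (rule card_of_UNION_ordLeq_infinite) auto

lemma lists_lepoll_infinite:
  assumes A: "infinite A"
  shows "lists A \<lesssim> A"
proof -
  have len: "{xs \<in> lists A. length xs = n} \<lesssim> A" for n
  proof (induction n)
    case 0
    have "{xs \<in> lists A. length xs = 0} = {[]}" by auto
    then show ?case using A by (simp add: finite_lepoll_infinite)
  next
    case (Suc n)
    have "{xs \<in> lists A. length xs = Suc n} \<subseteq> (\<lambda>(a, xs). a # xs) ` (A \<times> {xs \<in> lists A. length xs = n})"
      by (force simp: length_Suc_conv image_iff)
    then have "{xs \<in> lists A. length xs = Suc n} \<lesssim> A \<times> {xs \<in> lists A. length xs = n}"
      by (rule subset_image_lepoll)
    also have "\<dots> \<lesssim> A" using A Suc by (intro Times_lepoll_infinite) auto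
    finally show ?case .
  qed
  have "lists A = (\<Union>n. {xs \<in> lists A. length xs = n})" by auto
  also have "\<dots> \<lesssim> A"
    using A len by (intro UN_lepoll_infinite) (auto simp flip: infinite_le_lepoll)
  finally show ?thesis .
qed

lemma maximal_disjoint_family:
  obtains \<G> where "\<And>G. G \<in> \<G> \<Longrightarrow> P G" "pairwise disjnt \<G>"
    "\<And>G. P G \<Longrightarrow> (\<And>H. H \<in> \<G> \<Longrightarrow> disjnt G H) \<Longrightarrow> G \<in> \<G>"
proof -
  let ?A = "{\<G>. (\<forall>G\<in>\<G>. P G) \<and> pairwise disjnt \<G>}"
  have "\<exists>M\<in>?A. \<forall>X\<in>?A. M \<subseteq> X \<longrightarrow> X = M"
  proof (rule subset_Zorn')
    fix C assume C: "subset.chain ?A C"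
    then have "chain\<^sub>\<subseteq> C" by (simp add: subset_chain_def chain_subset_def)
    then have "pairwise disjnt (\<Union>C)"
      using C by (intro pairwise_chain_Union) (auto simp: subset.chain_def)
    then show "\<Union>C \<in> ?A" using C by (auto simp: subset.chain_def)
  qed
  then obtain M where M: "M \<in> ?A" and max: "\<forall>X\<in>?A. M \<subseteq> X \<longrightarrow> X = M" ..
  show ?thesis
  proof (rule that)
    show "G \<in> M" if "P G" "\<And>H. H \<in> M \<Longrightarrow> disjnt G H" for G
    proof -
      have "disjnt H G" if "H \<in> M" for H
        using \<open>\<And>H. H \<in> M \<Longrightarrow> disjnt G H\<close>[OF that] by (rule disjnt_sym)
      then have "insert G M \<in> ?A"
        using M that by (simp add: pairwise_insert)
      then have "insert G M = M" by (rule max[THEN bspec, THEN mp]) (rule subset_insertI)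
      then show ?thesis by blast
    qed
  qed (use M in auto)
qed

section \<open>Almost disjointly supported vectors\<close>

lemma ell1_operator_norm_le:
  fixes V :: "('k::{real_normed_field, euclidean_space}, 'a) nspace" and f :: "'g \<Rightarrow> 'k"
  assumes bV: "banach_space V" and T: "T \<in> bounded_operators (ell1 \<Gamma>) V" and C: "C \<ge> 0"
    and le: "\<And>g. g \<in> \<Gamma> \<Longrightarrow> vnorm V (T (unit_vec g)) \<le> C" and f: "f \<in> carrier (ell1 \<Gamma>)"
  shows "vnorm V (T f) \<le> C * vnorm (ell1 \<Gamma>) f"
proof -
  have nV: "normed_vspace V" using bV by (rule banach_space.axioms)
  obtain S where S: "S \<in> bounded_operators (ell1 \<Gamma>) V" "\<And>g. g \<in> \<Gamma> \<Longrightarrow> S (unit_vec g) = T (unit_vec g)"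
    "\<And>f. f \<in> carrier (ell1 \<Gamma>) \<Longrightarrow> vnorm V (S f) \<le> C * vnorm (ell1 \<Gamma>) f"
    by (rule ell1_extension[OF bV C, of \<Gamma> "\<lambda>g. T (unit_vec g)"])
      (use bop_closed[OF T] le in auto)
  show ?thesis
    using S(3)[OF f] ell1_operator_eqI[OF nV S(1) T S(2) f] by simp
qed

text \<open>
  If \<open>T\<close> maps a bounded family close to the unit vectors, then the operator \<open>V\<close> defined by that
  family is an approximate right inverse of \<open>T\<close>. So every unit vector has an exact preimage of
  bounded norm, and these preimages define an exact right inverse.
\<close>

lemma almost_units_imp_retract:
  fixes Y :: "('k::{real_normed_field, euclidean_space}, 'y) nspace" and A :: "'g set"
  assumes bY: "banach_space Y" and T: "T \<in> bounded_operators Y (ell1 A)" and C: "C \<ge> 0"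
    and y: "\<And>a. a \<in> A \<Longrightarrow> y a \<in> carrier Y" "\<And>a. a \<in> A \<Longrightarrow> vnorm Y (y a) \<le> C"
    and near: "\<And>a. a \<in> A \<Longrightarrow> vdist (ell1 A) (unit_vec a) (T (y a)) \<le> 1 / 2"
  shows "retract (ell1 A) Y"
proof -
  let ?E = "ell1 A :: ('k, 'g \<Rightarrow> 'k) nspace"
  note nE = ell1_normed[of A, where 'k = 'k] and bE = ell1_banach[of A, where 'k = 'k]
  have nY: "normed_vspace Y" using bY by (rule banach_space.axioms)
  interpret E: banach_space ?E by (rule bE)
  obtain V where V: "V \<in> bounded_operators ?E Y" "\<And>a. a \<in> A \<Longrightarrow> V (unit_vec a) = y a"
    "\<And>f. f \<in> carrier ?E \<Longrightarrow> vnorm Y (V f) \<le> C * vnorm ?E f"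
    by (rule ell1_extension[OF bY C, of A y]) (use y in auto)
  have N: "(\<lambda>f. f \<ominus>\<^bsub>?E\<^esub> T (V f)) \<in> bounded_operators ?E ?E"
    by (rule bop_minus[OF nE nE bop_id bop_compose[OF nE nY V(1) T]])
  have "vnorm ?E (f \<ominus>\<^bsub>?E\<^esub> T (V f)) \<le> 1 / 2 * vnorm ?E f" if f: "f \<in> carrier ?E" for f
  proof (rule ell1_operator_norm_le[OF bE N _ _ f])
    fix a assume a: "a \<in> A"
    show "vnorm ?E (unit_vec a \<ominus>\<^bsub>?E\<^esub> T (V (unit_vec a))) \<le> 1 / 2"
      using near[OF a] E.vdist_eq[OF unit_vec_carrier[OF a] bop_closed[OF T y(1)[OF a]]] V(2)[OF a]
      by simp
  qed simp
  then have "\<exists>x\<in>carrier Y. vnorm Y x \<le> C * vnorm ?E f \<and> vnorm ?E (f \<ominus>\<^bsub>?E\<^esub> T x) \<le> vnorm ?E f / 2"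
    if "f \<in> carrier ?E" for f
    using that V(3) bop_closed[OF V(1)] by force
  then have "\<exists>x\<in>carrier Y. T x = unit_vec a \<and> vnorm Y x \<le> 2 * C" if "a \<in> A" for a
    using approx_surjective_imp_surjective[OF bY nE T C _ unit_vec_carrier[OF that]]
      vnorm_unit_vec[OF that, where 'k = 'k] by simp
  then obtain x where x: "\<And>a. a \<in> A \<Longrightarrow> x a \<in> carrier Y" "\<And>a. a \<in> A \<Longrightarrow> T (x a) = unit_vec a"
    "\<And>a. a \<in> A \<Longrightarrow> vnorm Y (x a) \<le> 2 * C"
    by metis
  have "2 * C \<ge> 0" using C by simp
  obtain W where W: "W \<in> bounded_operators ?E Y" "\<And>a. a \<in> A \<Longrightarrow> W (unit_vec a) = x a"
    by (rule ell1_extension[OF bY \<open>2 * C \<ge> 0\<close>, of A x]) (use x in auto)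
  have "T (W f) = f" if "f \<in> carrier ?E" for f
    by (rule ell1_operator_eqI[OF nE bop_compose[OF nE nY W(1) T] bop_id _ that])
      (simp add: W(2) x(2))
  then show ?thesis unfolding retract_def using W(1) T by blast
qed

text \<open>
  The fraction \<open>3/4\<close> leaves an error of \<open>1/4\<close> on \<open>G\<close> and one of \<open>1/4\<close> off \<open>G\<close>, together the \<open>1/2\<close> of
  \<open>almost_units_imp_retract\<close>.
\<close>

definition norming :: "('k::real_normed_field, 'y) nspace \<Rightarrow> ('y \<Rightarrow> 'g \<Rightarrow> 'k) \<Rightarrow> 'g set \<Rightarrow> 'g set \<Rightarrow> bool" where
  "norming Y i \<Gamma> G \<longleftrightarrow> finite G \<and> G \<subseteq> \<Gamma> \<and>
     (\<exists>y\<in>carrier Y. vnorm (ell1 \<Gamma>) (i y) = 1 \<and> 3 / 4 \<le> (\<Sum>g\<in>G. norm (i y g)))"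

text \<open>
  If a vector had less than a quarter of its norm on the union of the family, then some finite set
  disjoint from the union would carry three quarters of its norm and could be added to the family.
\<close>

lemma maximal_norming_bounded_below:
  fixes Y :: "('k::{real_normed_field, euclidean_space}, 'y) nspace" and i :: "'y \<Rightarrow> 'g \<Rightarrow> 'k"
  assumes nY: "normed_vspace Y" and i: "i \<in> bounded_operators Y (ell1 \<Gamma>)"
    and \<G>: "\<And>G. G \<in> \<G> \<Longrightarrow> norming Y i \<Gamma> G"
    and max: "\<And>G. norming Y i \<Gamma> G \<Longrightarrow> (\<And>H. H \<in> \<G> \<Longrightarrow> disjnt G H) \<Longrightarrow> G \<in> \<G>"
    and y: "y \<in> carrier Y"
  shows "vnorm (ell1 \<Gamma>) (i y) / 4 \<le> vnorm (ell1 (\<Union>\<G>)) (restrict_to (\<Union>\<G>) (i y))"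
proof -
  let ?E = "ell1 \<Gamma> :: ('k, 'g \<Rightarrow> 'k) nspace" and ?B = "ell1 (\<Union>\<G>) :: ('k, 'g \<Rightarrow> 'k) nspace"
  interpret Y: normed_vspace Y by fact
  interpret E: normed_vspace ?E by (rule ell1_normed)
  interpret B: normed_vspace ?B by (rule ell1_normed)
  have sub: "\<Union>\<G> \<subseteq> \<Gamma>" using \<G> by (auto simp: norming_def)
  note R = restrict_to_bounded(1)[OF sub, where 'k = 'k]
  have unit_case: "1 / 4 \<le> vnorm ?B (restrict_to (\<Union>\<G>) (i z))"
    if z: "z \<in> carrier Y" "vnorm ?E (i z) = 1" for z
  proof (rule ccontr)
    define m where "m = vnorm ?B (restrict_to (\<Union>\<G>) (i z))"
    assume "\<not> 1 / 4 \<le> vnorm ?B (restrict_to (\<Union>\<G>) (i z))"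
    then have m: "1 / 4 - m > 0" by (simp add: m_def)
    have iz: "i z \<in> carrier ?E" by (rule bop_closed[OF i z(1)])
    obtain F where F: "finite F" "F \<subseteq> \<Gamma>" and t: "tail \<Gamma> F (i z) < 1 / 4 - m"
      using tail_small[OF iz m] by (metis order_refl)
    let ?G = "F - \<Union>\<G>"
    have "(\<Sum>g\<in>F \<inter> \<Union>\<G>. norm (i z g)) = (\<Sum>g\<in>F \<inter> \<Union>\<G>. norm (restrict_to (\<Union>\<G>) (i z) g))"
      by (intro sum.cong) (auto simp: restrict_to_def)
    also have "\<dots> \<le> m"
      unfolding m_def by (rule ell1_sum_le_vnorm[OF bop_closed[OF R iz]]) (use F in auto)
    finally have "(\<Sum>g\<in>F \<inter> \<Union>\<G>. norm (i z g)) \<le> m" .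
    moreover have "(\<Sum>g\<in>F. norm (i z g)) = (\<Sum>g\<in>F \<inter> \<Union>\<G>. norm (i z g)) + (\<Sum>g\<in>?G. norm (i z g))"
      using sum.Int_Diff[OF F(1), of "\<lambda>g. norm (i z g)" "\<Union>\<G>"] .
    ultimately have G: "3 / 4 \<le> (\<Sum>g\<in>?G. norm (i z g))"
      using t z(2) by (simp add: tail_def)
    then have "norming Y i \<Gamma> ?G"
      unfolding norming_def using F z by auto
    then have "?G \<in> \<G>" by (rule max) (auto simp: disjnt_iff)
    \<comment> \<open>As a member of the family \<open>?G\<close> is contained in the union, from which it is disjoint.\<close>
    then have "?G = {}" by blast
    then have "(\<Sum>g\<in>?G. norm (i z g)) = 0" by (simp only: sum.empty)
    with G show False by simp
  qed
  have iy: "i y \<in> carrier ?E" by (rule bop_closed[OF i y])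
  show ?thesis
  proof (cases "vnorm ?E (i y) = 0")
    case True
    then show ?thesis using B.vnorm_nonneg[OF bop_closed[OF R iy]] by simp
  next
    case False
    define n where "n = vnorm ?E (i y)"
    have n: "n > 0" using False E.vnorm_nonneg[OF iy] by (simp add: n_def)
    let ?z = "of_real (inverse n) \<odot>\<^bsub>Y\<^esub> y"
    have iz: "i ?z = of_real (inverse n) \<odot>\<^bsub>?E\<^esub> i y" by (rule bop_smult[OF i y])
    have "vnorm ?E (i ?z) = 1"
      unfolding iz using n by (simp add: E.vnorm_smult[OF iy] norm_inverse flip: n_def)
    then have "1 / 4 \<le> vnorm ?B (restrict_to (\<Union>\<G>) (i ?z))"
      using unit_case y by simp
    also have "\<dots> = inverse n * vnorm ?B (restrict_to (\<Union>\<G>) (i y))"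
      unfolding iz bop_smult[OF R iy] using n by (simp add: B.vnorm_smult[OF bop_closed[OF R iy]] norm_inverse)
    finally show ?thesis using n by (simp add: n_def field_simps)
  qed
qed

text \<open>
  For each \<open>G\<close> let \<open>y G\<close> be a vector most of whose norm is carried by \<open>G\<close>. The operator \<open>W\<close> sums
  the coordinates in each \<open>G\<close>, with weights \<open>\<phi>\<close> of norm at most 1 that turn the coordinates of
  \<open>y G\<close> into their norms. So it sends the part of \<open>y G\<close> on \<open>G\<close> to \<open>m\<close> times the unit vector at
  \<open>G\<close>, with \<open>m\<close> between \<open>3/4\<close> and 1, and the rest to a vector of norm at most \<open>1/4\<close>: the vectors
  \<open>y G\<close> are mapped close to unit vectors.
\<close>

lemma disjoint_norming_retract:
  fixes Y :: "('k::{real_normed_field, euclidean_space}, 'y) nspace" and i :: "'y \<Rightarrow> 'g \<Rightarrow> 'k"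
  assumes bY: "banach_space Y" and i: "i \<in> bounded_operators Y (ell1 \<Gamma>)"
    and K: "K \<ge> 0" "\<And>y. y \<in> carrier Y \<Longrightarrow> vnorm Y y \<le> K * vnorm (ell1 \<Gamma>) (i y)"
    and \<G>: "\<And>G. G \<in> \<G> \<Longrightarrow> norming Y i \<Gamma> G" and disj: "pairwise disjnt \<G>"
  shows "retract (ell1 \<G>) Y"
proof -
  let ?E = "ell1 \<Gamma> :: ('k, 'g \<Rightarrow> 'k) nspace" and ?G = "ell1 \<G> :: ('k, 'g set \<Rightarrow> 'k) nspace"
  note nE = ell1_normed[of \<Gamma>, where 'k = 'k] and nG = ell1_normed[of \<G>, where 'k = 'k]
  note bG = ell1_banach[of \<G>, where 'k = 'k]
  have nY: "normed_vspace Y" using bY by (rule banach_space.axioms)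
  interpret G: normed_vspace ?G by (rule nG)
  have fin: "finite G" "G \<subseteq> \<Gamma>" if "G \<in> \<G>" for G using \<G>[OF that] by (auto simp: norming_def)
  obtain y where y: "\<And>G. G \<in> \<G> \<Longrightarrow> y G \<in> carrier Y" "\<And>G. G \<in> \<G> \<Longrightarrow> vnorm ?E (i (y G)) = 1"
    "\<And>G. G \<in> \<G> \<Longrightarrow> 3 / 4 \<le> (\<Sum>g\<in>G. norm (i (y G) g))"
    using \<G> unfolding norming_def by metis
  define owner where "owner g = (SOME G. G \<in> \<G> \<and> g \<in> G)" for g
  have owner: "owner g = G" if "G \<in> \<G>" "g \<in> G" for g G
  proof -
    have "owner g \<in> \<G> \<and> g \<in> owner g" unfolding owner_def using that by (intro someI) auto
    then show ?thesis
      using disj that by (auto simp: pairwise_def disjnt_iff)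
  qed
  define \<phi> where "\<phi> g = (let c = i (y (owner g)) g in of_real (norm c) / c)" for g
  have \<phi>n: "norm (\<phi> g) \<le> 1" for g by (simp add: \<phi>_def Let_def norm_divide)
  have \<phi>: "i (y G) g * \<phi> g = of_real (norm (i (y G) g))" if "G \<in> \<G>" "g \<in> G" for g G
    using owner[OF that] by (simp add: \<phi>_def Let_def)
  define w where "w g = (if g \<in> \<Union>\<G> then \<phi> g \<odot>\<^bsub>?G\<^esub> unit_vec (owner g) else \<zero>\<^bsub>?G\<^esub>)" for g
  have "unit_vec (owner g) \<in> carrier ?G" "vnorm ?G (unit_vec (owner g)) = 1" if "g \<in> \<Union>\<G>" for g
    using that owner by (auto simp: vnorm_unit_vec)
  then have w: "w g \<in> carrier ?G" "vnorm ?G (w g) \<le> 1" for g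
    using \<phi>n[of g] by (auto simp: w_def G.vnorm_smult)
  have "\<exists>W. W \<in> bounded_operators ?E ?G \<and> (\<forall>g\<in>\<Gamma>. W (unit_vec g) = w g) \<and>
      (\<forall>f\<in>carrier ?E. vnorm ?G (W f) \<le> 1 * vnorm ?E f)"
    by (rule ell1_extension[OF bG zero_le_one, of \<Gamma> w]) (use w in auto)
  then obtain W where W: "W \<in> bounded_operators ?E ?G"
    and Wu: "\<And>g. g \<in> \<Gamma> \<Longrightarrow> W (unit_vec g) = w g"
    and Wn: "\<And>f. f \<in> carrier ?E \<Longrightarrow> vnorm ?G (W f) \<le> 1 * vnorm ?E f"
    by blast
  have near: "vdist ?G (unit_vec G) (W (i (y G))) \<le> 1 / 2" if G: "G \<in> \<G>" for G
  proof -
    define x where "x = i (y G)"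
    have x: "x \<in> carrier ?E" unfolding x_def by (rule bop_closed[OF i y(1)[OF G]])
    have u: "unit_vec G \<in> carrier ?G" using G by simp
    define m where "m = (\<Sum>g\<in>G. norm (x g))"
    have m: "3 / 4 \<le> m" "m \<le> 1"
      using y(3)[OF G] ell1_sum_le_vnorm[OF x fin[OF G]] y(2)[OF G] by (simp_all add: m_def x_def)
    have "W (restrict_to F x) = of_real (\<Sum>g\<in>F. norm (x g)) \<odot>\<^bsub>?G\<^esub> unit_vec G"
      if "finite F" "F \<subseteq> G" for F
      using that
    proof (induction F rule: finite_induct)
      case empty
      have "restrict_to {} x = \<zero>\<^bsub>?E\<^esub>" by (simp add: restrict_to_def ell1_simps)
      then show ?case using u by (simp add: bop_zero[OF nE nG W])
    next
      case (insert g F)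
      have g: "g \<in> \<Gamma>" "g \<in> \<Union>\<G>" "owner g = G" "x g * \<phi> g = of_real (norm (x g))"
        using insert.prems G fin(2)[OF G] owner[OF G] \<phi>[OF G] by (auto simp: x_def)
      have "W (restrict_to (insert g F) x) = W (restrict_to F x) \<oplus>\<^bsub>?G\<^esub> x g \<odot>\<^bsub>?G\<^esub> W (unit_vec g)"
        by (rule operator_restrict_insert[OF W x insert.hyps(1) _ insert.hyps(2)])
          (use insert.prems fin(2)[OF G] in auto)
      then show ?case
        using insert g u
        by (simp add: Wu w_def G.smult_smult add.commute[of "of_real (norm (x g))"] flip: G.smult_add_left)
    qed
    then have WG: "W (restrict_to G x) = of_real m \<odot>\<^bsub>?G\<^esub> unit_vec G"
      using fin(1)[OF G] by (simp add: m_def)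
    note r = vdist_restrict_finite[OF x fin[OF G]]
    have Wc: "W x \<in> carrier ?G" "W (restrict_to G x) \<in> carrier ?G"
      using bop_closed[OF W] x r(1) by auto
    have "vdist ?G (unit_vec G) (W x) \<le> vdist ?G (unit_vec G) (W (restrict_to G x)) + vdist ?G (W (restrict_to G x)) (W x)"
      by (rule G.triangle[OF u Wc(2,1)])
    also have "vdist ?G (W (restrict_to G x)) (W x) \<le> 1 / 4"
    proof -
      have "vdist ?G (W x) (W (restrict_to G x)) \<le> 1 * vdist ?E x (restrict_to G x)"
        by (rule bop_lipschitz[OF nE nG W Wn x r(1)])
      moreover have "tail \<Gamma> G x \<le> 1 / 4"
        using m y(2)[OF G] by (simp add: tail_def m_def x_def)
      ultimately show ?thesis using r(2) G.commute[of "W x"] by simp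
    qed
    also have "vdist ?G (unit_vec G) (W (restrict_to G x)) \<le> 1 / 4"
    proof -
      have "unit_vec G \<ominus>\<^bsub>?G\<^esub> of_real m \<odot>\<^bsub>?G\<^esub> unit_vec G = (1 - of_real m) \<odot>\<^bsub>?G\<^esub> unit_vec G"
        using G.smult_add_left[OF u, of 1 "- of_real m"] u
        by (simp add: G.diff_eq G.smult_smult)
      then have "vdist ?G (unit_vec G) (W (restrict_to G x)) = norm (1 - of_real m :: 'k)"
        using u vnorm_unit_vec[OF G, where 'k = 'k] by (simp add: WG G.vdist_eq G.vnorm_smult)
      also have "\<dots> = \<bar>1 - m\<bar>" by (metis norm_of_real of_real_1 of_real_diff)
      finally show ?thesis using m by simp
    qed
    finally show ?thesis by (simp add: x_def)
  qed
  have T: "(\<lambda>z. W (i z)) \<in> bounded_operators Y ?G"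
    by (rule bop_compose[OF nY nE i W])
  show ?thesis
  proof (rule almost_units_imp_retract[OF bY T K(1)])
    show "vnorm Y (y G) \<le> K" if "G \<in> \<G>" for G
      using K(2)[OF y(1)[OF that]] y(2)[OF that] by simp
  qed (use y near in auto)
qed

section \<open>Finite dimension\<close>

text \<open>
  Choose a maximal set \<open>A\<close> of coordinates onto which \<open>T\<close> followed by the restriction is still
  surjective. Then it is also injective: a vector of \<open>Y\<close> that vanishes on \<open>A\<close> but not at a coordinate
  \<open>b\<close> could be used to adjust the value at \<open>b\<close>, so that \<open>b\<close> could be added to \<open>A\<close>.
\<close>

lemma finite_dimensional_isomorphic_ell1:
  fixes Y :: "('k::{real_normed_field, euclidean_space}, 'y) nspace" and B :: "'g set"
  assumes bY: "banach_space Y" and fin: "finite B" and T: "T \<in> bounded_operators Y (ell1 B)"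
    and inj: "\<And>y. y \<in> carrier Y \<Longrightarrow> T y = \<zero>\<^bsub>ell1 B\<^esub> \<Longrightarrow> y = \<zero>\<^bsub>Y\<^esub>"
  obtains A where "A \<subseteq> B" "isomorphic Y (ell1 A)"
proof -
  interpret Y: banach_space Y by fact
  have nY: "normed_vspace Y" ..
  note nB = ell1_normed[of B, where 'k = 'k]
  define onto where "onto A \<longleftrightarrow> A \<subseteq> B \<and>
    (\<forall>f\<in>carrier (ell1 A :: ('k, 'g \<Rightarrow> 'k) nspace). \<exists>y\<in>carrier Y. restrict_to A (T y) = f)" for A
  have "onto {}"
  proof -
    have "f = (\<lambda>_. 0)" if "f \<in> carrier (ell1 {} :: ('k, 'g \<Rightarrow> 'k) nspace)" for f
      using ell1_outside[OF that] by auto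
    then show ?thesis
      unfolding onto_def by (auto simp: restrict_to_def intro: exI[of _ "\<zero>\<^bsub>Y\<^esub>"])
  qed
  moreover have "finite {A. onto A}"
    by (rule finite_subset[of _ "Pow B"]) (use fin in \<open>auto simp: onto_def\<close>)
  ultimately obtain A where A: "onto A" and max: "\<And>A'. onto A' \<Longrightarrow> A \<subseteq> A' \<Longrightarrow> A' = A"
    using finite_has_maximal[of "{A. onto A}"] by (metis empty_iff mem_Collect_eq)
  let ?E = "ell1 A :: ('k, 'g \<Rightarrow> 'k) nspace"
  have AB: "A \<subseteq> B" using A by (simp add: onto_def)
  interpret E: banach_space ?E by (rule ell1_banach)
  have nE: "normed_vspace ?E" ..
  note R = restrict_to_bounded(1)[OF AB, where 'k = 'k]
  define U where "U y = restrict_to A (T y)" for y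
  have U: "U \<in> bounded_operators Y ?E"
    unfolding U_def[abs_def] by (rule bop_compose[OF nY nB T R])
  have Uinj: "y = \<zero>\<^bsub>Y\<^esub>" if y: "y \<in> carrier Y" and U0: "U y = \<zero>\<^bsub>?E\<^esub>" for y
  proof (rule ccontr)
    assume "y \<noteq> \<zero>\<^bsub>Y\<^esub>"
    then have "T y \<noteq> (\<lambda>_. 0)" using inj[OF y] by (auto simp: ell1_simps)
    then obtain b where b: "T y b \<noteq> 0" by auto
    have bB: "b \<in> B" using b ell1_outside[OF bop_closed[OF T y]] by auto
    have yA: "T y a = 0" if "a \<in> A" for a
      using fun_cong[OF U0, of a] that by (simp add: U_def restrict_to_def ell1_simps)
    have bA: "b \<notin> A" using yA b by auto
    have "onto (insert b A)"
      unfolding onto_def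
    proof (intro conjI ballI)
      show "insert b A \<subseteq> B" using AB bB by simp
      fix f assume f: "f \<in> carrier (ell1 (insert b A) :: ('k, 'g \<Rightarrow> 'k) nspace)"
      have "restrict_to A f \<in> carrier ?E"
        using bop_closed[OF restrict_to_bounded(1)[of A "insert b A", where 'k = 'k]] f by auto
      then obtain z where z: "z \<in> carrier Y" "restrict_to A (T z) = restrict_to A f"
        using A by (auto simp: onto_def)
      have zA: "T z a = f a" if "a \<in> A" for a
        using fun_cong[OF z(2), of a] that by (simp add: restrict_to_def)
      define c where "c = (f b - T z b) / T y b"
      have "T (z \<oplus>\<^bsub>Y\<^esub> c \<odot>\<^bsub>Y\<^esub> y) = (\<lambda>g. T z g + c * T y g)"
        using z(1) y by (simp add: bop_add[OF T] bop_smult[OF T] ell1_simps)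
      then have "restrict_to (insert b A) (T (z \<oplus>\<^bsub>Y\<^esub> c \<odot>\<^bsub>Y\<^esub> y)) = f"
        using ell1_outside[OF f] b zA yA by (auto simp: restrict_to_def c_def)
      then show "\<exists>x\<in>carrier Y. restrict_to (insert b A) (T x) = f"
        using z(1) y by (intro bexI[of _ "z \<oplus>\<^bsub>Y\<^esub> c \<odot>\<^bsub>Y\<^esub> y"]) auto
    qed
    then show False using max[of "insert b A"] bA by auto
  qed
  have "\<exists>y\<in>carrier Y. U y = unit_vec a" if "a \<in> A" for a
    using A unit_vec_carrier[OF that] unfolding onto_def U_def by blast
  then obtain y where y: "\<And>a. a \<in> A \<Longrightarrow> y a \<in> carrier Y" "\<And>a. a \<in> A \<Longrightarrow> U (y a) = unit_vec a"
    by metis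
  define C where "C = (\<Sum>a\<in>A. vnorm Y (y a))"
  have finA: "finite A" using AB fin by (rule finite_subset)
  have C: "C \<ge> 0" unfolding C_def by (intro sum_nonneg Y.vnorm_nonneg y)
  have yC: "vnorm Y (y a) \<le> C" if "a \<in> A" for a
    unfolding C_def using that finA by (intro member_le_sum Y.vnorm_nonneg y) auto
  obtain V where V: "V \<in> bounded_operators ?E Y" "\<And>a. a \<in> A \<Longrightarrow> V (unit_vec a) = y a"
    by (rule ell1_extension[OF bY C, of A y]) (use y yC in auto)
  have UV: "U (V f) = f" if "f \<in> carrier ?E" for f
    by (rule ell1_operator_eqI[OF nE bop_compose[OF nE nY V(1) U] bop_id _ that])
      (simp add: V(2) y(2))
  have VU: "V (U x) = x" if x: "x \<in> carrier Y" for x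
  proof -
    have c: "U x \<in> carrier ?E" "V (U x) \<in> carrier Y"
      using x bop_closed[OF U] bop_closed[OF V(1)] by auto
    have "U (V (U x) \<ominus>\<^bsub>Y\<^esub> x) = \<zero>\<^bsub>?E\<^esub>"
      using c x by (simp add: bop_diff[OF nY nE U] UV E.diff_self)
    then have "V (U x) \<ominus>\<^bsub>Y\<^esub> x = \<zero>\<^bsub>Y\<^esub>" using c x by (intro Uinj) auto
    then show ?thesis using Y.add_diff_cancel[OF c(2) x] x by simp
  qed
  have "isomorphic Y ?E"
    unfolding isomorphic_iff[OF nY nE]
    by (rule bexI[OF _ U], rule bexI[OF _ V(1)]) (simp add: UV VU)
  with AB show ?thesis by (rule that)
qed

section \<open>Nets of controlled size\<close>

text \<open>
  There are at most as many finitely supported vectors with entries in a countable dense set \<open>Q\<close>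
  as there are lists over \<open>B \<times> Q\<close>, hence at most as many as elements of \<open>B\<close>. Every image \<open>T y\<close> is close
  to such a vector, and one point of the ball is chosen for each such vector that is close to the
  image of the ball. Two points that are close to the same vector are within distance \<open>1/2\<close> of each
  other, as \<open>T\<close> is bounded below.
\<close>

lemma small_net:
  fixes Y :: "('k::{real_normed_field, euclidean_space}, 'y) nspace" and B :: "'g set"
  assumes nY: "normed_vspace Y" and B: "infinite B" and T: "T \<in> bounded_operators Y (ell1 B)"
    and c: "c > 0" "\<And>y. y \<in> carrier Y \<Longrightarrow> c * vnorm Y y \<le> vnorm (ell1 B) (T y)"
  obtains D where "D \<subseteq> carrier Y" "\<And>d. d \<in> D \<Longrightarrow> vnorm Y d \<le> 1"
    "\<And>y. y \<in> carrier Y \<Longrightarrow> vnorm Y y \<le> 1 \<Longrightarrow> \<exists>d\<in>D. vdist Y y d \<le> 1 / 2" "D \<lesssim> B"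
proof -
  let ?E = "ell1 B :: ('k, 'g \<Rightarrow> 'k) nspace"
  interpret Y: normed_vspace Y by fact
  interpret E: normed_vspace ?E by (rule ell1_normed)
  note nE = ell1_normed[of B, where 'k = 'k]
  obtain Q :: "'k set" where Q: "countable Q" "\<And>X. open X \<Longrightarrow> X \<noteq> {} \<Longrightarrow> \<exists>q\<in>Q. q \<in> X"
    using countable_dense_setE by blast
  \<comment> \<open>A list of pairs stands for the finitely supported vector with these entries.\<close>
  define fn where "fn xs g = (case map_of xs g of None \<Rightarrow> 0 | Some a \<Rightarrow> a)" for xs :: "('g \<times> 'k) list" and g
  \<comment> \<open>Two images within \<open>\<delta>\<close> of a vector differ by at most \<open>c / 2\<close>.\<close>
  define \<delta> where "\<delta> = c / 4"
  have \<delta>: "\<delta> > 0" using c(1) by (simp add: \<delta>_def)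
  define near where "near xs y \<longleftrightarrow> y \<in> carrier Y \<and> vnorm Y y \<le> 1 \<and>
    (\<forall>G. finite G \<longrightarrow> G \<subseteq> B \<longrightarrow> (\<Sum>g\<in>G. norm (T y g - fn xs g)) \<le> \<delta>)" for xs y
  define D where "D = (\<lambda>xs. SOME y. near xs y) ` {xs \<in> lists (B \<times> Q). \<exists>y. near xs y}"
  have "D \<lesssim> B"
  proof -
    have "Q \<lesssim> (UNIV :: nat set)"
      using Q(1) by (auto simp: countable_def lepoll_def)
    then have "Q \<lesssim> B" using B lepoll_trans infinite_le_lepoll by blast
    then have BQ: "B \<times> Q \<lesssim> B" using B by (intro Times_lepoll_infinite) auto
    have "D \<lesssim> {xs \<in> lists (B \<times> Q). \<exists>y. near xs y}" unfolding D_def by (rule image_lepoll)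
    also have "\<dots> \<lesssim> lists (B \<times> Q)" by (rule subset_imp_lepoll) auto
    also have "\<dots> \<lesssim> lists B" using BQ by (rule lists_lepoll_mono)
    also have "\<dots> \<lesssim> B" using B by (rule lists_lepoll_infinite)
    finally show ?thesis .
  qed
  moreover have D: "near xs (SOME y. near xs y)" if "\<exists>y. near xs y" for xs
    using that by (rule someI_ex)
  then have "D \<subseteq> carrier Y" "\<And>d. d \<in> D \<Longrightarrow> vnorm Y d \<le> 1"
    unfolding D_def near_def by blast+
  moreover have "\<exists>d\<in>D. vdist Y y d \<le> 1 / 2" if y: "y \<in> carrier Y" "vnorm Y y \<le> 1" for y
  proof -
    have Ty: "T y \<in> carrier ?E" by (rule bop_closed[OF T y(1)])
    obtain F where F: "finite F" "F \<subseteq> B" and t: "tail B F (T y) < \<delta> / 2"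
      using tail_small[OF Ty, of "\<delta> / 2"] \<delta> by (metis half_gt_zero order_refl)
    define \<eta> where "\<eta> = \<delta> / (2 * (real (card F) + 1))"
    have \<eta>: "\<eta> > 0" using \<delta> by (simp add: \<eta>_def)
    have "\<exists>q\<in>Q. norm (T y g - q) < \<eta>" for g
      using Q(2)[of "ball (T y g) \<eta>"] \<eta> by (auto simp: dist_norm)
    then obtain q where q: "\<And>g. q g \<in> Q" "\<And>g. norm (T y g - q g) < \<eta>" by metis
    obtain l where l: "set l = F" using F(1) finite_list by blast
    define xs where "xs = map (\<lambda>g. (g, q g)) l"
    have xs: "xs \<in> lists (B \<times> Q)" using l F(2) q(1) by (auto simp: xs_def)
    have fn: "fn xs g = (if g \<in> F then q g else 0)" for g
      using l by (simp add: fn_def xs_def map_of_map_restrict restrict_map_def)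
    have "near xs y"
      unfolding near_def
    proof (intro conjI y allI impI)
      fix G assume G: "finite G" "G \<subseteq> B"
      have "(\<Sum>g\<in>G. norm (T y g - fn xs g)) =
          (\<Sum>g\<in>G \<inter> F. norm (T y g - fn xs g)) + (\<Sum>g\<in>G - F. norm (T y g - fn xs g))"
        by (rule sum.Int_Diff[OF G(1)])
      also have "(\<Sum>g\<in>G \<inter> F. norm (T y g - fn xs g)) \<le> real (card (G \<inter> F)) * \<eta>"
        using q(2) by (intro sum_bounded_above) (auto simp: fn less_imp_le)
      also have "\<dots> \<le> real (card F) * \<eta>"
        using \<eta> F(1) by (intro mult_right_mono) (auto intro: card_mono)
      also have "\<dots> \<le> \<delta> / 2"
        using \<delta> by (simp add: \<eta>_def field_simps)
      also have "(\<Sum>g\<in>G - F. norm (T y g - fn xs g)) = (\<Sum>g\<in>G - F. norm (T y g))"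
        by (intro sum.cong) (auto simp: fn)
      also have "\<dots> \<le> tail B F (T y)"
        by (rule sum_disjoint_le_tail[OF Ty F]) (use G in auto)
      finally show "(\<Sum>g\<in>G. norm (T y g - fn xs g)) \<le> \<delta>" using t by simp
    qed
    define d where "d = (SOME y. near xs y)"
    have d: "near xs d" "d \<in> D" using D[of xs] \<open>near xs y\<close> xs unfolding d_def D_def by auto
    have dc: "d \<in> carrier Y" using d(1) by (simp add: near_def)
    have "vdist ?E (T y) (T d) \<le> \<delta> + \<delta>"
    proof (rule ell1_vdist_leI[OF Ty bop_closed[OF T dc]])
      fix G assume G: "finite G" "G \<subseteq> B"
      have "(\<Sum>g\<in>G. norm (T y g - T d g)) \<le> (\<Sum>g\<in>G. norm (T y g - fn xs g) + norm (T d g - fn xs g))"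
        by (intro sum_mono) (metis norm_triangle_ineq4 diff_diff_eq2 diff_add_cancel add_diff_cancel_right')
      also have "\<dots> \<le> \<delta> + \<delta>"
        unfolding sum.distrib using \<open>near xs y\<close> d(1) G by (intro add_mono) (auto simp: near_def)
      finally show "(\<Sum>g\<in>G. norm (T y g - T d g)) \<le> \<delta> + \<delta>" .
    qed
    moreover have "c * vdist Y y d \<le> vdist ?E (T y) (T d)"
      using c(2)[of "y \<ominus>\<^bsub>Y\<^esub> d"] y(1) dc
      by (simp add: Y.vdist_eq E.vdist_eq bop_diff[OF nY nE T] bop_closed[OF T])
    ultimately have "c * vdist Y y d \<le> c * (1 / 2)" by (simp add: \<delta>_def)
    then have "vdist Y y d \<le> 1 / 2" using c(1) by simp
    then show ?thesis using d(2) by blast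
  qed
  ultimately show ?thesis using that by blast
qed

section \<open>Spaces with the lifting property\<close>

lemma aqlp_imp_isomorphic_ell1:
  fixes Y :: "('k::{real_normed_field, euclidean_space}, 'y) nspace"
  assumes bY: "banach_space Y" and aqlp: "aqlp TYPE('u + ('y \<Rightarrow> 'k)) Y"
  obtains D :: "'y set" where "isomorphic Y (ell1 D)"
proof -
  interpret Y: banach_space Y by fact
  have nY: "normed_vspace Y" ..
  \<comment> \<open>The whole unit ball is a net of itself, without any control of its size.\<close>
  define \<Gamma> where "\<Gamma> = {y \<in> carrier Y. vnorm Y y \<le> 1}"
  have "retract Y (ell1 \<Gamma>)"
    by (rule aqlp_net_retract[OF bY aqlp]) (use Y.zero in \<open>force simp: \<Gamma>_def\<close>)+
  then obtain i r where i: "i \<in> bounded_operators Y (ell1 \<Gamma>)"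
    and r: "r \<in> bounded_operators (ell1 \<Gamma>) Y" and ri: "\<And>y. y \<in> carrier Y \<Longrightarrow> r (i y) = y"
    unfolding retract_def by blast
  obtain K where K: "K > 0"
    "\<And>f. f \<in> carrier (ell1 \<Gamma>) \<Longrightarrow> vnorm Y (r f) \<le> K * vnorm (ell1 \<Gamma>) f"
    using bop_bound[OF ell1_normed r] by blast
  have Ki: "vnorm Y y \<le> K * vnorm (ell1 \<Gamma>) (i y)" if "y \<in> carrier Y" for y
    using K(2)[OF bop_closed[OF i that]] ri[OF that] by simp
  obtain \<G> where \<G>: "\<And>G. G \<in> \<G> \<Longrightarrow> norming Y i \<Gamma> G" "pairwise disjnt \<G>"
    and max: "\<And>G. norming Y i \<Gamma> G \<Longrightarrow> (\<And>H. H \<in> \<G> \<Longrightarrow> disjnt G H) \<Longrightarrow> G \<in> \<G>"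
    using maximal_disjoint_family[of "norming Y i \<Gamma>"] by metis
  let ?B = "\<Union>\<G>"
  have finG: "finite G" if "G \<in> \<G>" for G
    using \<G>(1)[OF that] by (simp add: norming_def)
  have B: "?B \<subseteq> \<Gamma>" using \<G>(1) by (auto simp: norming_def)
  define T where "T y = restrict_to ?B (i y)" for y
  have T: "T \<in> bounded_operators Y (ell1 ?B)"
    unfolding T_def[abs_def]
    by (rule bop_compose[OF nY ell1_normed i restrict_to_bounded(1)[OF B]])
  define c where "c = 1 / (4 * K)"
  have c: "c > 0" using K(1) by (simp add: c_def)
  have Tc: "c * vnorm Y y \<le> vnorm (ell1 ?B) (T y)" if y: "y \<in> carrier Y" for y
  proof -
    have "c * vnorm Y y \<le> c * (K * vnorm (ell1 \<Gamma>) (i y))"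
      using Ki[OF y] c by (intro mult_left_mono) auto
    also have "\<dots> = vnorm (ell1 \<Gamma>) (i y) / 4" using K(1) by (simp add: c_def)
    also have "\<dots> \<le> vnorm (ell1 ?B) (T y)"
      unfolding T_def by (rule maximal_norming_bounded_below[OF nY i \<G>(1) max y])
    finally show ?thesis .
  qed
  show ?thesis
  proof (cases "finite \<G>")
    case True
    then have finB: "finite ?B" using finG by blast
    have "y = \<zero>\<^bsub>Y\<^esub>" if y: "y \<in> carrier Y" "T y = \<zero>\<^bsub>ell1 ?B\<^esub>" for y
    proof -
      have "vnorm (ell1 ?B) (T y) = 0"
        unfolding y(2) by (rule normed_vspace.vnorm_zero[OF ell1_normed])
      then have "vnorm Y y \<le> 0"
        using Tc[OF y(1)] c by (simp add: mult_le_0_iff)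
      then show ?thesis using Y.vnorm_nonneg[OF y(1)] Y.vnorm_eq_zero[OF y(1)] by simp
    qed
    then show ?thesis
      using finite_dimensional_isomorphic_ell1[OF bY finB T] that by metis
  next
    case False
    have "{} \<notin> \<G>" using \<G>(1)[of "{}"] by (auto simp: norming_def)
    then have "infinite ?B"
      using False finite_UnionD by blast
    obtain D where D: "D \<subseteq> carrier Y" "\<And>d. d \<in> D \<Longrightarrow> vnorm Y d \<le> 1"
      "\<And>y. y \<in> carrier Y \<Longrightarrow> vnorm Y y \<le> 1 \<Longrightarrow> \<exists>d\<in>D. vdist Y y d \<le> 1 / 2" and DB: "D \<lesssim> ?B"
      using small_net[OF nY \<open>infinite ?B\<close> T c Tc] by metis
    have "?B = (\<Union>G\<in>\<G>. G)" by simp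
    also have "\<dots> \<lesssim> \<G>"
      using False finG by (intro UN_lepoll_infinite) (auto intro: finite_lepoll_infinite)
    finally have "D \<lesssim> \<G>" using DB lepoll_trans by blast
    then have "(UNIV :: nat set) \<times> D \<lesssim> \<G>"
      using False by (intro Times_lepoll_infinite) (auto simp flip: infinite_le_lepoll)
    then obtain h where h: "inj_on h ((UNIV :: nat set) \<times> D)" "h ` (UNIV \<times> D) \<subseteq> \<G>"
      by (auto simp: lepoll_def)
    \<comment> \<open>The lifting property is used a second time, now with a net of controlled size.\<close>
    have "isomorphic Y (ell1 D)"
      by (rule isomorphic_ell1_of_mutual_retracts[OF bY aqlp_net_retract[OF bY aqlp D]
            disjoint_norming_retract[OF bY i less_imp_le[OF K(1)] Ki \<G>] h])
    then show ?thesis by (rule that)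
  qed
qed

lemma isomorphic_trans:
  assumes "isomorphic U V" "isomorphic V W"
  shows "isomorphic U W"
proof -
  obtain S T where S: "linear_map U V S" "homeomorphic_map (vtopology U) (vtopology V) S"
    and T: "linear_map V W T" "homeomorphic_map (vtopology V) (vtopology W) T"
    using assms unfolding isomorphic_def by blast
  have "linear_map U W (T \<circ> S)"
    using S(1) T(1) by (simp add: linear_map_def Pi_iff)
  moreover have "homeomorphic_map (vtopology U) (vtopology W) (T \<circ> S)"
    using S(2) T(2) by (rule homeomorphic_map_compose)
  ultimately show ?thesis unfolding isomorphic_def by blast
qed

theorem theorem3:
  fixes Y :: "('k::{real_normed_field, euclidean_space}, 'y) nspace"
  assumes "banach_space Y"
  shows "aqlp TYPE('u + ('y \<Rightarrow> 'k)) Y \<longleftrightarrow>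
    (\<exists>\<Gamma> :: ('u + ('y \<Rightarrow> 'k)) set. isomorphic Y (ell1 \<Gamma>))"
proof
  assume "aqlp TYPE('u + ('y \<Rightarrow> 'k)) Y"
  then obtain D :: "'y set" where D: "isomorphic Y (ell1 D)"
    by (rule aqlp_imp_isomorphic_ell1[OF assms])
  \<comment> \<open>The index type contains a copy of the type of the vectors: each \<open>y\<close> is represented by its
    indicator function.\<close>
  define e :: "'y \<Rightarrow> 'u + ('y \<Rightarrow> 'k)" where "e y = Inr (unit_vec y)" for y
  have "inj e"
  proof (rule injI)
    fix y z assume "e y = e z"
    then have "unit_vec y y = (unit_vec z y :: 'k)" by (simp add: e_def)
    then show "y = z" by (simp add: unit_vec_def split: if_splits)
  qed
  then have "inj_on e D" by (rule inj_on_subset) simp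
  then have "isomorphic Y (ell1 (e ` D))"
    by (rule isomorphic_trans[OF D ell1_isomorphic_image])
  then show "\<exists>\<Gamma> :: ('u + ('y \<Rightarrow> 'k)) set. isomorphic Y (ell1 \<Gamma>)" by blast
next
  assume "\<exists>\<Gamma> :: ('u + ('y \<Rightarrow> 'k)) set. isomorphic Y (ell1 \<Gamma>)"
  then obtain \<Gamma> :: "('u + ('y \<Rightarrow> 'k)) set" where \<Gamma>: "isomorphic Y (ell1 \<Gamma>)" by blast
  have "normed_vspace Y" using assms by (rule banach_space.axioms)
  then show "aqlp TYPE('u + ('y \<Rightarrow> 'k)) Y"
    by (rule isomorphic_aqlp[OF _ ell1_normed \<Gamma> ell1_aqlp])
qed

end
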